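(* Let $d$ be a fixed constant. The container packing problem (defined in the context) with a constant number of containers admits a PTAS, both when items may not be rotated and when items may be rotated by 90 degrees: for every fixed $\epsilon>0$ there is a polynomial-time algorithm that outputs a feasible solution of profit at least $(1-\epsilon)$ times the optimum.
   Context: Container packing problem: the input is a set $I$ of items, each with width $w(i)$, height $h(i)$, profit $p(i)\ge0$ and nonnegative weights $v_1(i),\dots,v_d(i)$; a constant-size set $C$ of containers (axis-parallel rectangles with given widths and heights), each labeled as large, wide, tall or area; and a constant $\epsilon'\in(0,1)$. A feasible solution packs a subset of $I$ into the containers (axis-parallel, non-overlapping, each item inside one container; in the rotation version an item may be turned by 90 degrees) such that: a large container is empty or contains exactly one item; in a wide container all items are stacked one on top of another; in a tall container all items are arranged side by side; an area container of width $w$ and height $h$ contains only items of width at most $\epsilon' w$ and height at most $\epsilon' h$, with total item area at most $(1-\epsilon')^2wh$; and for every $j\in[d]$ the total $j$-th weight of all packed items is at most $1$. The objective is to maximize total profit of packed items. *)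

theory Defs
  imports Complex_Main "HOL-Computational_Algebra.Polynomial" "HOL-Library.Log_Nat"
begin

section \<open>Model of computation\<close>

text \<open>
  Algorithms are programs of a first-order functional language over binary trees with integer
  leaves. A program is a finite list of unary functions; variables are de Bruijn indices into the
  local environment, and a call evaluates the callee's body in the environment that consists of
  the argument alone. Running time follows the logarithmic cost criterion: an integer operation is
  charged the binary lengths of its operands and every other step is charged 1 (trees are shared,
  so a step on trees moves a pointer). Every integer operation is polynomial-time computable and
  produces at most as many bits as it charges for, so that the functions computable in polynomial
  time are those of polynomial-time Turing machines.
\<close>

datatype val = IntV int | PairV val val

datatype arith = Add | Sub | Mul | Div | Less

datatype exp =
    EVar nat
  | EInt int
  | EArith arith exp exp
  | EPair exp exp
  | EFst exp
  | ESnd exp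
  | EIsPair exp
  | EIf exp exp exp
  | ELet exp exp
  | ECall nat exp

type_synonym prog = "exp list"

fun arith_op :: "arith \<Rightarrow> int \<Rightarrow> int \<Rightarrow> int" where
  "arith_op Add a b = a + b"
| "arith_op Sub a b = a - b"
| "arith_op Mul a b = a * b"
| "arith_op Div a b = a div b"
| "arith_op Less a b = of_bool (a < b)"

definition bitlength :: "int \<Rightarrow> nat" where
  "bitlength a = floorlog 2 (nat \<bar>a\<bar>)"

inductive evals_to :: "prog \<Rightarrow> val list \<Rightarrow> exp \<Rightarrow> val \<Rightarrow> nat \<Rightarrow> bool" for P where
  Var: "i < length \<Gamma> \<Longrightarrow> evals_to P \<Gamma> (EVar i) (\<Gamma> ! i) 1"
| Int: "evals_to P \<Gamma> (EInt a) (IntV a) 1"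
| Arith: "\<lbrakk>evals_to P \<Gamma> e1 (IntV a) t1; evals_to P \<Gamma> e2 (IntV b) t2\<rbrakk>
    \<Longrightarrow> evals_to P \<Gamma> (EArith f e1 e2) (IntV (arith_op f a b))
          (t1 + t2 + 1 + bitlength a + bitlength b)"
| Pair: "\<lbrakk>evals_to P \<Gamma> e1 u t1; evals_to P \<Gamma> e2 v t2\<rbrakk>
    \<Longrightarrow> evals_to P \<Gamma> (EPair e1 e2) (PairV u v) (t1 + t2 + 1)"
| Fst: "evals_to P \<Gamma> e (PairV u v) t \<Longrightarrow> evals_to P \<Gamma> (EFst e) u (t + 1)"
| Snd: "evals_to P \<Gamma> e (PairV u v) t \<Longrightarrow> evals_to P \<Gamma> (ESnd e) v (t + 1)"
| IsPair: "evals_to P \<Gamma> e (PairV u v) t \<Longrightarrow> evals_to P \<Gamma> (EIsPair e) (IntV 1) (t + 1)"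
| IsNoPair: "evals_to P \<Gamma> e (IntV a) t \<Longrightarrow> evals_to P \<Gamma> (EIsPair e) (IntV 0) (t + 1)"
| IfTrue: "\<lbrakk>evals_to P \<Gamma> e (IntV a) t1; a \<noteq> 0; evals_to P \<Gamma> e1 v t2\<rbrakk>
    \<Longrightarrow> evals_to P \<Gamma> (EIf e e1 e2) v (t1 + t2 + 1)"
| IfFalse: "\<lbrakk>evals_to P \<Gamma> e (IntV 0) t1; evals_to P \<Gamma> e2 v t2\<rbrakk>
    \<Longrightarrow> evals_to P \<Gamma> (EIf e e1 e2) v (t1 + t2 + 1)"
| Let: "\<lbrakk>evals_to P \<Gamma> e1 u t1; evals_to P (u # \<Gamma>) e2 v t2\<rbrakk>
    \<Longrightarrow> evals_to P \<Gamma> (ELet e1 e2) v (t1 + t2 + 1)"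
| Call: "\<lbrakk>f < length P; evals_to P \<Gamma> e u t1; evals_to P [u] (P ! f) v t2\<rbrakk>
    \<Longrightarrow> evals_to P \<Gamma> (ECall f e) v (t1 + t2 + 1)"

inductive_cases evals_to_elims:
  "evals_to P \<Gamma> (EVar i) v t"
  "evals_to P \<Gamma> (EInt a) v t"
  "evals_to P \<Gamma> (EArith f e1 e2) v t"
  "evals_to P \<Gamma> (EPair e1 e2) v t"
  "evals_to P \<Gamma> (EFst e) v t"
  "evals_to P \<Gamma> (ESnd e) v t"
  "evals_to P \<Gamma> (EIsPair e) v t"
  "evals_to P \<Gamma> (EIf e e1 e2) v t"
  "evals_to P \<Gamma> (ELet e1 e2) v t"
  "evals_to P \<Gamma> (ECall f e) v t"

lemma evals_to_deterministic:
  "evals_to P \<Gamma> e v t \<Longrightarrow> evals_to P \<Gamma> e v' t' \<Longrightarrow> v = v' \<and> t = t'"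
proof (induction arbitrary: v' t' rule: evals_to.induct)
  case Var
  then show ?case by (auto elim: evals_to_elims)
next
  case Int
  then show ?case by (auto elim: evals_to_elims)
next
  case Arith
  from Arith.prems show ?case by (rule evals_to_elims) (drule Arith.IH(1), drule Arith.IH(2), simp)
next
  case Pair
  from Pair.prems show ?case by (rule evals_to_elims) (metis Pair.IH Suc_eq_plus1 val.inject val.distinct)
next
  case Fst
  from Fst.prems show ?case by (rule evals_to_elims) (metis Fst.IH Suc_eq_plus1 val.inject val.distinct)
next
  case Snd
  from Snd.prems show ?case by (rule evals_to_elims) (metis Snd.IH Suc_eq_plus1 val.inject val.distinct)
next
  case IsPair
  from IsPair.prems show ?case by (rule evals_to_elims) (metis IsPair.IH Suc_eq_plus1 val.inject val.distinct)+
next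
  case IsNoPair
  from IsNoPair.prems show ?case by (rule evals_to_elims) (metis IsNoPair.IH Suc_eq_plus1 val.inject val.distinct)+
next
  case IfTrue
  from IfTrue.prems show ?case by (rule evals_to_elims) (metis Suc_eq_plus1 IfTrue.IH IfTrue.hyps val.inject)+
next
  case IfFalse
  from IfFalse.prems show ?case by (rule evals_to_elims) (metis IfFalse.IH Suc_eq_plus1 val.inject val.distinct)+
next
  case Let
  from Let.prems show ?case by (rule evals_to_elims) (metis Suc_eq_plus1 Let.IH)
next
  case Call
  from Call.prems show ?case by (rule evals_to_elims) (metis Suc_eq_plus1 Call.IH)
qed

definition runs :: "prog \<Rightarrow> val \<Rightarrow> val \<Rightarrow> nat \<Rightarrow> bool" where
  "runs P x y t \<longleftrightarrow> evals_to P [x] (ECall 0 (EVar 0)) y t"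

fun val_size :: "val \<Rightarrow> nat" where
  "val_size (IntV a) = 1 + bitlength a"
| "val_size (PairV u v) = 1 + val_size u + val_size v"


section \<open>Approximation schemes for maximization problems\<close>

record ('i, 's) max_problem =
  instances :: "'i set"
  encode :: "'i \<Rightarrow> val"
  represents :: "val \<Rightarrow> 's \<Rightarrow> bool"
  feasible :: "'i \<Rightarrow> 's \<Rightarrow> bool"
  objective :: "'i \<Rightarrow> 's \<Rightarrow> real"

definition opt :: "('i, 's) max_problem \<Rightarrow> 'i \<Rightarrow> real" where
  "opt \<Pi> I = (SUP S \<in> {S. feasible \<Pi> I S}. objective \<Pi> I S)"

definition poly_time_approx :: "('i, 's) max_problem \<Rightarrow> real \<Rightarrow> prog \<Rightarrow> bool" where
  "poly_time_approx \<Pi> \<alpha> P \<longleftrightarrow>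
     (\<exists>q :: nat poly. \<forall>I \<in> instances \<Pi>. \<exists>y t.
        runs P (encode \<Pi> I) y t \<and> t \<le> poly q (val_size (encode \<Pi> I)) \<and>
        (\<exists>S. represents \<Pi> y S \<and> feasible \<Pi> I S \<and> objective \<Pi> I S \<ge> \<alpha> * opt \<Pi> I))"

definition admits_PTAS :: "('i, 's) max_problem \<Rightarrow> bool" where
  "admits_PTAS \<Pi> \<longleftrightarrow> (\<forall>\<epsilon>>0. \<exists>P. poly_time_approx \<Pi> (1 - \<epsilon>) P)"


section \<open>The container packing problem\<close>

record item =
  width :: rat
  height :: rat
  profit :: rat
  weights :: "rat list"

datatype label = Large | Wide | Tall | Area

record container =
  cwidth :: rat
  cheight :: rat
  clabel :: label

text \<open>Items and containers are identified by their positions in the lists, so that distinct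
  items (containers) may have the same data.\<close>

record cp_instance =
  items :: "item list"
  containers :: "container list"
  eps' :: rat

definition valid_instance :: "nat \<Rightarrow> nat \<Rightarrow> cp_instance \<Rightarrow> bool" where
  "valid_instance d k I \<longleftrightarrow>
     (\<forall>a \<in> set (items I). width a > 0 \<and> height a > 0 \<and> profit a \<ge> 0 \<and>
        length (weights a) = d \<and> (\<forall>w \<in> set (weights a). w \<ge> 0)) \<and>
     (\<forall>c \<in> set (containers I). cwidth c > 0 \<and> cheight c > 0) \<and>
     length (containers I) \<le> k \<and>
     0 < eps' I \<and> eps' I < 1"

text \<open>A placement gives the lower left corner of an item relative to the lower left corner of its
  container. The entry at position \<open>i\<close> of a solution tells whether and how item \<open>i\<close> is packed.\<close>

record placement =
  cont :: nat
  rotated :: bool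
  xpos :: real
  ypos :: real

type_synonym solution = "placement option list"

definition packed :: "solution \<Rightarrow> nat set" where
  "packed S = {i. i < length S \<and> S ! i \<noteq> None}"

definition packed_in :: "solution \<Rightarrow> nat \<Rightarrow> nat set" where
  "packed_in S c = {i \<in> packed S. cont (the (S ! i)) = c}"

definition pwidth :: "cp_instance \<Rightarrow> solution \<Rightarrow> nat \<Rightarrow> real" where
  "pwidth I S i =
     of_rat (if rotated (the (S ! i)) then height (items I ! i) else width (items I ! i))"

definition pheight :: "cp_instance \<Rightarrow> solution \<Rightarrow> nat \<Rightarrow> real" where
  "pheight I S i =
     of_rat (if rotated (the (S ! i)) then width (items I ! i) else height (items I ! i))"

definition left_edge :: "solution \<Rightarrow> nat \<Rightarrow> real" where
  "left_edge S i = xpos (the (S ! i))"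

definition right_edge :: "cp_instance \<Rightarrow> solution \<Rightarrow> nat \<Rightarrow> real" where
  "right_edge I S i = left_edge S i + pwidth I S i"

definition bottom_edge :: "solution \<Rightarrow> nat \<Rightarrow> real" where
  "bottom_edge S i = ypos (the (S ! i))"

definition top_edge :: "cp_instance \<Rightarrow> solution \<Rightarrow> nat \<Rightarrow> real" where
  "top_edge I S i = bottom_edge S i + pheight I S i"

definition rect :: "cp_instance \<Rightarrow> solution \<Rightarrow> nat \<Rightarrow> (real \<times> real) set" where
  "rect I S i = {left_edge S i..right_edge I S i} \<times> {bottom_edge S i..top_edge I S i}"

definition open_rect :: "cp_instance \<Rightarrow> solution \<Rightarrow> nat \<Rightarrow> (real \<times> real) set" where
  "open_rect I S i = {left_edge S i<..<right_edge I S i} \<times> {bottom_edge S i<..<top_edge I S i}"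

definition container_ok :: "cp_instance \<Rightarrow> solution \<Rightarrow> nat \<Rightarrow> bool" where
  "container_ok I S c \<longleftrightarrow>
     (let W = of_rat (cwidth (containers I ! c)); H = of_rat (cheight (containers I ! c));
          \<epsilon>' = of_rat (eps' I); A = packed_in S c
      in (\<forall>i \<in> A. rect I S i \<subseteq> {0..W} \<times> {0..H}) \<and>
         (\<forall>i \<in> A. \<forall>j \<in> A. i \<noteq> j \<longrightarrow> open_rect I S i \<inter> open_rect I S j = {}) \<and>
         (case clabel (containers I ! c) of
            Large \<Rightarrow> card A \<le> 1
          | Wide \<Rightarrow> (\<forall>i \<in> A. \<forall>j \<in> A. i \<noteq> j \<longrightarrow> top_edge I S i \<le> bottom_edge S j \<or> top_edge I S j \<le> bottom_edge S i)
          | Tall \<Rightarrow> (\<forall>i \<in> A. \<forall>j \<in> A. i \<noteq> j \<longrightarrow> right_edge I S i \<le> left_edge S j \<or> right_edge I S j \<le> left_edge S i)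
          | Area \<Rightarrow> (\<forall>i \<in> A. pwidth I S i \<le> \<epsilon>' * W \<and> pheight I S i \<le> \<epsilon>' * H) \<and>
              (\<Sum>i \<in> A. pwidth I S i * pheight I S i) \<le> (1 - \<epsilon>')\<^sup>2 * W * H))"

definition feasible_packing :: "bool \<Rightarrow> nat \<Rightarrow> cp_instance \<Rightarrow> solution \<Rightarrow> bool" where
  "feasible_packing rotation d I S \<longleftrightarrow>
     length S = length (items I) \<and>
     (\<forall>i \<in> packed S. cont (the (S ! i)) < length (containers I)) \<and>
     (\<forall>i \<in> packed S. rotated (the (S ! i)) \<longrightarrow> rotation) \<and>
     (\<forall>c < length (containers I). container_ok I S c) \<and>
     (\<forall>j < d. (\<Sum>i \<in> packed S. weights (items I ! i) ! j) \<le> 1)"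

definition total_profit :: "cp_instance \<Rightarrow> solution \<Rightarrow> real" where
  "total_profit I S = (\<Sum>i \<in> packed S. of_rat (profit (items I ! i)))"


subsection \<open>Encodings\<close>

fun enc_list :: "val list \<Rightarrow> val" where
  "enc_list [] = IntV 0"
| "enc_list (v # vs) = PairV v (enc_list vs)"

definition enc_rat :: "rat \<Rightarrow> val" where
  "enc_rat r = (case quotient_of r of (a, b) \<Rightarrow> PairV (IntV a) (IntV b))"

definition enc_item :: "item \<Rightarrow> val" where
  "enc_item a = enc_list
     [enc_rat (width a), enc_rat (height a), enc_rat (profit a), enc_list (map enc_rat (weights a))]"

fun enc_label :: "label \<Rightarrow> val" where
  "enc_label Large = IntV 0"
| "enc_label Wide = IntV 1"
| "enc_label Tall = IntV 2"
| "enc_label Area = IntV 3"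

definition enc_container :: "container \<Rightarrow> val" where
  "enc_container c = enc_list [enc_rat (cwidth c), enc_rat (cheight c), enc_label (clabel c)]"

definition enc_instance :: "cp_instance \<Rightarrow> val" where
  "enc_instance I = enc_list
     [enc_list (map enc_item (items I)), enc_list (map enc_container (containers I)),
      enc_rat (eps' I)]"

text \<open>In the output, coordinates are fractions that need not be in lowest terms.\<close>

definition repr_coord :: "val \<Rightarrow> real \<Rightarrow> bool" where
  "repr_coord v x \<longleftrightarrow>
     (\<exists>a b. v = PairV (IntV a) (IntV b) \<and> b \<noteq> 0 \<and> x = real_of_int a / real_of_int b)"

fun repr_entry :: "val \<Rightarrow> placement option \<Rightarrow> bool" where
  "repr_entry v None \<longleftrightarrow> v = IntV 0"
| "repr_entry v (Some p) \<longleftrightarrow>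
     (\<exists>x y. v = enc_list [IntV (int (cont p)), IntV (of_bool (rotated p)), x, y] \<and>
        repr_coord x (xpos p) \<and> repr_coord y (ypos p))"

definition repr_solution :: "val \<Rightarrow> solution \<Rightarrow> bool" where
  "repr_solution v S \<longleftrightarrow> (\<exists>vs. v = enc_list vs \<and> list_all2 repr_entry vs S)"

text \<open>\<open>d\<close> is the number of weights per item and \<open>k\<close> bounds the number of containers.\<close>

definition container_packing :: "bool \<Rightarrow> nat \<Rightarrow> nat \<Rightarrow> (cp_instance, solution) max_problem" where
  "container_packing rotation d k =
     \<lparr>instances = {I. valid_instance d k I},
      encode = enc_instance,
      represents = repr_solution,
      feasible = feasible_packing rotation d,
      objective = total_profit\<rparr>"

text \<open>The supremum in the definition of the optimum is attained.\<close>

lemma opt_container_packing_attained: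
  assumes "valid_instance d k I"
  shows "\<exists>S. feasible_packing rotation d I S \<and>
     total_profit I S = opt (container_packing rotation d k) I \<and>
     (\<forall>S'. feasible_packing rotation d I S' \<longrightarrow> total_profit I S' \<le> total_profit I S)"
proof -
  let ?F = "{S. feasible_packing rotation d I S}"
  let ?X = "total_profit I ` ?F"
  have "?X \<subseteq> (\<lambda>A. \<Sum>i \<in> A. of_rat (profit (items I ! i))) ` Pow {..<length (items I)}"
    by (auto simp: total_profit_def feasible_packing_def packed_def)
  then have fin: "finite ?X"
    by (rule finite_subset) simp
  have none: "packed (replicate (length (items I)) None) = {}"
    by (auto simp: packed_def)
  have pos: "cwidth (containers I ! c) > 0 \<and> cheight (containers I ! c) > 0"
    if "c < length (containers I)" for c
    using assms that by (simp add: valid_instance_def)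
  have "container_ok I (replicate (length (items I)) None) c" if "c < length (containers I)" for c
    using pos[OF that] none
    by (simp add: container_ok_def packed_in_def Let_def less_imp_le split: label.split)
  then have "feasible_packing rotation d I (replicate (length (items I)) None)"
    using none by (simp add: feasible_packing_def)
  then have "?X \<noteq> {}"
    by blast
  with fin have "Max ?X \<in> ?X" and "Sup ?X = Max ?X"
    by (auto simp: cSup_eq_Max)
  then obtain S where S: "S \<in> ?F" "total_profit I S = Max ?X"
    by (metis (no_types, lifting) imageE)
  moreover have "opt (container_packing rotation d k) I = Max ?X"
    using \<open>Sup ?X = Max ?X\<close> by (simp add: opt_def container_packing_def)
  ultimately show ?thesis
    using fin by (intro exI[of _ S]) auto
qed

end

theory Submission
  imports Defs
begin

text \<open>
  By the area argument for next fit decreasing height, an area container can hold every set of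
  sufficiently small items whose total area respects the bound. Hence every container imposes only a
  knapsack constraint on the items assigned to it, and the problem becomes a multiple-choice
  knapsack problem with the constant number \<open>m = |C| + d\<close> of dimensions.

  Let \<open>P\<close> be the optimal profit. At most \<open>r\<close> of the packed items have profit above \<open>P / r\<close>; they are
  guessed. For one dimension with residual capacity \<open>R\<close>, either the remaining items leave a fraction
  \<open>1 / (2 r + 1)\<close> of \<open>R\<close> free, or a single item fills that much, or the items split into \<open>r\<close> groups
  that each do; so discarding profit at most \<open>P / r\<close> frees this fraction. After this has been done in
  all dimensions (which costs \<open>m P / r\<close>), sizes can be rounded up to multiples of
  \<open>R / ((2 r + 1) n)\<close> without exceeding \<open>R\<close>, and the rounded problem has a polynomial number of load
  vectors, so that dynamic programming solves it exactly.

  The running time is handled by a calculus of polynomial-time computable functions on encoded data,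
  which is closed under the constructs of the language and under folds with polynomially bounded
  intermediate results.
\<close>

section \<open>Relocation of programs\<close>

text \<open>Why \<open>2 r + 1\<close>: let \<open>u = R / (2 r + 1)\<close>. Items of size below
  \<open>u\<close> can be gathered one by one into groups of size between \<open>u\<close> and
  \<open>2 u\<close>, so a total above \<open>R - u = 2 r u\<close> contains \<open>r\<close>
  disjoint groups, and the cheapest costs at most \<open>P / r\<close>. Rounding \<open>n\<close>
  sizes up to multiples of \<open>u / n\<close> adds at most \<open>u\<close>, which is exactly the
  room gained. The unit is relative to the residual \<open>R\<close> and not to the full capacity,
  because the guessed items may leave very little of it; hence rounding comes after the guess. The
  algorithm does not know \<open>P\<close>: it tries all assignments of at most \<open>r\<close>
  items, and \<open>P\<close> occurs only in the analysis. The data is made integral exactly,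
  through the product of all denominators. This number is huge, but its bit length is polynomial,
  and the number of states of the dynamic program depends on the number of units per capacity, not
  on magnitudes. Taking \<open>r\<close> at least \<open>(k + d) / \<epsilon>\<close> makes the loss
  \<open>m P / r\<close> at most an \<open>\<epsilon>\<close> fraction.\<close>

fun reloc :: "nat \<Rightarrow> exp \<Rightarrow> exp" where
  "reloc n (EVar i) = EVar i"
| "reloc n (EInt a) = EInt a"
| "reloc n (EArith f e1 e2) = EArith f (reloc n e1) (reloc n e2)"
| "reloc n (EPair e1 e2) = EPair (reloc n e1) (reloc n e2)"
| "reloc n (EFst e) = EFst (reloc n e)"
| "reloc n (ESnd e) = ESnd (reloc n e)"
| "reloc n (EIsPair e) = EIsPair (reloc n e)"
| "reloc n (EIf e e1 e2) = EIf (reloc n e) (reloc n e1) (reloc n e2)"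
| "reloc n (ELet e1 e2) = ELet (reloc n e1) (reloc n e2)"
| "reloc n (ECall f e) = ECall (n + f) (reloc n e)"

text \<open>Parts of an algorithm are compiled separately and later share one list of functions. A
  call is the only construct that mentions a position in that list, so shifting call targets
  preserves value and cost exactly.\<close>

lemma evals_to_reloc:
  "evals_to P \<Gamma> e v t \<Longrightarrow>
    evals_to (Q @ map (reloc (length Q)) P @ R) \<Gamma> (reloc (length Q) e) v t"
proof (induction rule: evals_to.induct)
  case (Call f \<Gamma> e u t1 v t2)
  have "(Q @ map (reloc (length Q)) P @ R) ! (length Q + f) = reloc (length Q) (P ! f)"
    using Call.hyps(1) by (simp add: nth_append)
  then show ?case
    using evals_to.Call[of "length Q + f" "Q @ map (reloc (length Q)) P @ R"] Call by simp
qed (unfold reloc.simps, (blast intro: evals_to.intros)+)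

lemma evals_to_append:
  "evals_to P \<Gamma> e v t \<Longrightarrow> evals_to (P @ R) \<Gamma> e v t"
proof (induction rule: evals_to.induct)
  case (Call f \<Gamma> e u t1 v t2)
  then show ?case
    using evals_to.Call[of f "P @ R"] by (simp add: nth_append)
qed (blast intro: evals_to.intros)+


section \<open>Encodings and polynomial bounds\<close>

text \<open>Encodings of different types may coincide: \<open>[]\<close>, \<open>None\<close>,
  \<open>False\<close> and \<open>0\<close> share the leaf \<open>IntV 0\<close>, and a cons cell is
  encoded like a pair. Many conversions thereby become the identity on encodings.\<close>

class codable =
  fixes enc :: "'a \<Rightarrow> val"

instantiation int :: codable begin
definition enc_int :: "int \<Rightarrow> val" where "enc_int = IntV"
instance ..
end

instantiation bool :: codable begin
definition enc_bool :: "bool \<Rightarrow> val" where "enc_bool b = IntV (of_bool b)"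
instance ..
end

instantiation val :: codable begin
definition enc_val :: "val \<Rightarrow> val" where "enc_val v = v"
instance ..
end

instantiation prod :: (codable, codable) codable begin
definition enc_prod :: "'a \<times> 'b \<Rightarrow> val" where "enc_prod p = PairV (enc (fst p)) (enc (snd p))"
instance ..
end

instantiation list :: (codable) codable begin
definition enc_list_inst: "enc (xs :: 'a list) = enc_list (map enc xs)"
instance ..
end

instantiation option :: (codable) codable begin
text \<open>The extra pair lets \<open>EIsPair\<close> tell \<open>Some\<close> from
  \<open>None\<close> even if the value itself is a leaf.\<close>

definition enc_option :: "'a option \<Rightarrow> val" where
  "enc_option x = (case x of None \<Rightarrow> IntV 0 | Some a \<Rightarrow> PairV (enc a) (IntV 0))"
instance ..
end

instantiation rat :: codable begin
definition enc_rat_inst: "enc (r :: rat) = enc_rat r"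
instance ..
end

lemma enc_simps [simp]:
  "enc (a :: int) = IntV a"
  "enc b = IntV (of_bool b)"
  "enc v = v"
  "enc (x, y) = PairV (enc x) (enc y)"
  "enc ([] :: 'a :: codable list) = IntV 0"
  "enc (z # zs) = PairV (enc z) (enc zs)"
  "enc (None :: 'a option) = IntV 0"
  "enc (Some w) = PairV (enc w) (IntV 0)"
  by (simp_all add: enc_int_def enc_bool_def enc_val_def enc_prod_def enc_list_inst enc_option_def)

lemma enc_quotient_of: "enc (quotient_of r) = enc (r :: rat)"
  by (simp add: enc_rat_inst enc_rat_def split: prod.split)

abbreviation esize :: "'a :: codable \<Rightarrow> nat" where
  "esize x \<equiv> val_size (enc x)"

lemma esize_pair: "esize p = 1 + esize (fst p) + esize (snd p)"
  by (cases p) simp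

lemma esize_list: "esize xs = 1 + (\<Sum>x\<leftarrow>xs. 1 + esize x)"
  by (induction xs) (simp_all add: bitlength_def floorlog_def)

lemma esize_pos [simp]: "0 < val_size v"
  by (cases v) simp_all

lemma esize_member: "x \<in> set xs \<Longrightarrow> esize x \<le> esize xs"
  by (induction xs) auto

lemma length_le_esize: "length xs \<le> esize xs"
  by (induction xs) auto

lemma esize_list_le:
  assumes "\<And>x. x \<in> set xs \<Longrightarrow> esize x \<le> B"
  shows "esize xs \<le> 1 + length xs * (1 + B)"
  using assms by (induction xs) (force simp add: bitlength_def floorlog_def)+

lemma esize_append: "esize (xs @ ys) + 1 = esize xs + esize ys"
  by (induction xs) (simp_all add: bitlength_def floorlog_def)

section \<open>Bit lengths of the results of integer operations\<close>

lemma abs_less_bitlength: "\<bar>a\<bar> < 2 ^ bitlength a"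
proof -
  have "nat \<bar>a\<bar> < 2 ^ bitlength a"
    unfolding bitlength_def by (rule floorlog_leD) auto
  then have "int (nat \<bar>a\<bar>) < int (2 ^ bitlength a)"
    by (simp only: of_nat_less_iff)
  then show ?thesis by simp
qed

lemma bitlength_leI:
  assumes "\<bar>a\<bar> < 2 ^ w" shows "bitlength a \<le> w"
proof -
  have "int (nat \<bar>a\<bar>) < int (2 ^ w)" using assms by simp
  then have "nat \<bar>a\<bar> < 2 ^ w" by (simp only: of_nat_less_iff)
  then show ?thesis unfolding bitlength_def by (intro floorlog_leI) auto
qed

lemma bitlength_mult: "bitlength (a * b) \<le> bitlength a + bitlength b"
proof (rule bitlength_leI)
  have "\<bar>a\<bar> * \<bar>b\<bar> < 2 ^ bitlength a * 2 ^ bitlength b"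
    using abs_less_bitlength[of a] abs_less_bitlength[of b] by (intro mult_strict_mono) auto
  then show "\<bar>a * b\<bar> < 2 ^ (bitlength a + bitlength b)"
    by (simp add: abs_mult power_add)
qed

lemma bitlength_add_max: "bitlength (a + b) \<le> max (bitlength a) (bitlength b) + 1"
proof (rule bitlength_leI)
  let ?m = "max (bitlength a) (bitlength b)"
  have "\<bar>a\<bar> < 2 ^ ?m"
    by (rule less_le_trans[OF abs_less_bitlength]) (auto intro: power_increasing)
  moreover have "\<bar>b\<bar> < 2 ^ ?m"
    by (rule less_le_trans[OF abs_less_bitlength]) (auto intro: power_increasing)
  ultimately show "\<bar>a + b\<bar> < 2 ^ (?m + 1)" by simp
qed

lemma bitlength_uminus [simp]: "bitlength (- a) = bitlength a"
  by (simp add: bitlength_def)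

lemma bitlength_simps [simp]: "bitlength 0 = 0" "bitlength 1 = 1"
  by (simp_all add: bitlength_def floorlog_def)

text \<open>Division rounds towards minus infinity, so negative \<open>a\<close> needs care:
  monotonicity in the divisor, compared with the divisor 1, settles both signs of \<open>a\<close>.
  A negative \<open>b\<close> is removed by negating both arguments.\<close>

lemma abs_div_le: "\<bar>a div b\<bar> \<le> \<bar>a :: int\<bar>"
proof -
  have pos: "\<bar>a div b\<bar> \<le> \<bar>a\<bar>" if "0 < b" for a b :: int
  proof (cases "0 \<le> a")
    case True
    then show ?thesis using zdiv_mono2[of a 1 b] that by (simp add: pos_imp_zdiv_nonneg_iff)
  next
    case False
    then show ?thesis using zdiv_mono2_neg[of a 1 b] div_neg_pos_less0[of a b] that by simp
  qed
  show ?thesis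
  proof (cases "b < 0")
    case True
    then show ?thesis using pos[of "- b" "- a"] by simp
  next
    case False
    then show ?thesis using pos[of b a] by (cases "b = 0") auto
  qed
qed

lemma bitlength_div: "bitlength (a div b) \<le> bitlength a"
  by (rule bitlength_leI) (rule le_less_trans[OF abs_div_le abs_less_bitlength])

lemma bitlength_arith_op: "bitlength (arith_op f a b) \<le> bitlength a + bitlength b + 1"
proof (cases f)
  case Add
  with bitlength_add_max[of a b] show ?thesis by simp
next
  case Sub
  with bitlength_add_max[of a "- b"] show ?thesis by simp
next
  case Mul
  with bitlength_mult[of a b] show ?thesis by simp
next
  case Div
  with bitlength_div[of a b] show ?thesis by simp
qed (simp add: of_bool_def)

section \<open>Quantities bounded by a polynomial in the input size\<close>

lemma poly_nat_mono: "a \<le> b \<Longrightarrow> poly (q :: nat poly) a \<le> poly q b"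
  by (induction q) (simp_all add: add_mono mult_le_mono)

text \<open>Coefficients are natural numbers, so every bounding polynomial is monotone and may be
  applied to any upper bound of the size. The domain \<open>D\<close> makes preconditions on the
  input available.\<close>

definition poly_bounded :: "'a :: codable set \<Rightarrow> ('a \<Rightarrow> nat) \<Rightarrow> bool" where
  "poly_bounded D m \<longleftrightarrow> (\<exists>q. \<forall>x \<in> D. m x \<le> poly q (esize x))"

lemma poly_bounded_mono:
  "poly_bounded D m \<Longrightarrow> (\<And>x. x \<in> D \<Longrightarrow> m' x \<le> m x) \<Longrightarrow> poly_bounded D m'"
  unfolding poly_bounded_def by (meson order_trans)

lemma poly_bounded_const: "poly_bounded D (\<lambda>x. c)"
  unfolding poly_bounded_def by (rule exI[of _ "[:c:]"]) simp

lemma poly_bounded_esize: "poly_bounded D (\<lambda>x. esize x)"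
  unfolding poly_bounded_def by (rule exI[of _ "[:0, 1:]"]) simp

lemma poly_bounded_add:
  assumes "poly_bounded D m" "poly_bounded D m'"
  shows "poly_bounded D (\<lambda>x. m x + m' x)"
proof -
  from assms obtain q q' where "\<forall>x \<in> D. m x \<le> poly q (esize x)" "\<forall>x \<in> D. m' x \<le> poly q' (esize x)"
    unfolding poly_bounded_def by blast
  then show ?thesis
    unfolding poly_bounded_def by (intro exI[of _ "q + q'"]) (simp add: add_mono)
qed

lemma poly_bounded_mult:
  assumes "poly_bounded D m" "poly_bounded D m'"
  shows "poly_bounded D (\<lambda>x. m x * m' x)"
proof -
  from assms obtain q q' where "\<forall>x \<in> D. m x \<le> poly q (esize x)" "\<forall>x \<in> D. m' x \<le> poly q' (esize x)"
    unfolding poly_bounded_def by blast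
  then show ?thesis
    unfolding poly_bounded_def by (intro exI[of _ "q * q'"]) (simp add: mult_le_mono)
qed

lemma poly_bounded_poly:
  assumes "poly_bounded D m"
  shows "poly_bounded D (\<lambda>x. poly q (m x))"
proof -
  from assms obtain q' where "\<forall>x \<in> D. m x \<le> poly q' (esize x)"
    unfolding poly_bounded_def by blast
  then show ?thesis
    unfolding poly_bounded_def by (intro exI[of _ "pcompose q q'"]) (simp add: poly_pcompose poly_nat_mono)
qed

lemma poly_bounded_power: "poly_bounded D m \<Longrightarrow> poly_bounded D (\<lambda>x. m x ^ n)"
  by (induction n) (simp_all add: poly_bounded_const poly_bounded_mult)

lemmas poly_bounded_intros =
  poly_bounded_const poly_bounded_add poly_bounded_mult poly_bounded_poly poly_bounded_power
  poly_bounded_esize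

text \<open>\<open>m\<close> is bounded in terms of the size of \<open>f x\<close>, so the size of
  this intermediate value must be bounded too. For this reason computability facts carry a bound on
  the size of the result.\<close>

lemma poly_bounded_comp:
  assumes "poly_bounded E m" "poly_bounded D (\<lambda>x. esize (f x))" "\<And>x. x \<in> D \<Longrightarrow> f x \<in> E"
  shows "poly_bounded D (\<lambda>x. m (f x))"
proof -
  from assms(1) obtain q where "\<forall>x \<in> E. m x \<le> poly q (esize x)"
    unfolding poly_bounded_def by blast
  with assms(3) show ?thesis
    using poly_bounded_mono[OF poly_bounded_poly[OF assms(2), of q], of "\<lambda>x. m (f x)"] by blast
qed


section \<open>Functions computable in polynomial time\<close>

text \<open>Trees are shared, so the size of a result is not bounded by the running time and has to be
  bounded separately.\<close>

definition computes :: "prog \<Rightarrow> exp \<Rightarrow> 'a :: codable set \<Rightarrow> ('a \<Rightarrow> 'b :: codable) \<Rightarrow> bool" where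
  "computes P e D F \<longleftrightarrow> poly_bounded D (\<lambda>x. esize (F x)) \<and>
     (\<exists>T. poly_bounded D T \<and> (\<forall>x \<in> D. \<exists>t \<le> T x. evals_to P [enc x] e (enc (F x)) t))"

definition ptime :: "'a :: codable set \<Rightarrow> ('a \<Rightarrow> 'b :: codable) \<Rightarrow> bool" where
  "ptime D F \<longleftrightarrow> (\<exists>P e. computes P e D F)"

lemma computesI:
  assumes "poly_bounded D (\<lambda>x. esize (F x))" "poly_bounded D T"
    "\<And>x. x \<in> D \<Longrightarrow> \<exists>t \<le> T x. evals_to P [enc x] e (enc (F x)) t"
  shows "computes P e D F"
  using assms unfolding computes_def by blast

lemma computesE:
  assumes "computes P e D F"
  obtains T where "poly_bounded D (\<lambda>x. esize (F x))" "poly_bounded D T"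
    "\<And>x. x \<in> D \<Longrightarrow> \<exists>t \<le> T x. evals_to P [enc x] e (enc (F x)) t"
  using assms unfolding computes_def by blast

lemma ptimeI: "computes P e D F \<Longrightarrow> ptime D F"
  unfolding ptime_def by blast

lemma computes_reloc:
  "computes P e D F \<Longrightarrow> computes (Q @ map (reloc (length Q)) P @ R) (reloc (length Q) e) D F"
  unfolding computes_def by (meson evals_to_reloc)

lemma computes_append: "computes P e D F \<Longrightarrow> computes (P @ R) e D F"
  unfolding computes_def by (meson evals_to_append)

text \<open>A construct built from subprograms needs all of them in one function list. Conditionals,
  case analyses and folds combine three.\<close>

lemma ptime_merge3:
  assumes "ptime D F" "ptime E G" "ptime E' H"
  obtains P e1 e2 e3 where "computes P e1 D F" "computes P e2 E G" "computes P e3 E' H"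
proof -
  from assms obtain P1 e1 P2 e2 P3 e3
    where *: "computes P1 e1 D F" "computes P2 e2 E G" "computes P3 e3 E' H"
    unfolding ptime_def by blast
  show ?thesis
  proof
    let ?P2 = "map (reloc (length P1)) P2"
    let ?P3 = "map (reloc (length (P1 @ ?P2))) P3"
    show "computes (P1 @ ?P2 @ ?P3) e1 D F"
      by (rule computes_append) fact
    show "computes (P1 @ ?P2 @ ?P3) (reloc (length P1) e2) E G"
      by (rule computes_reloc) fact
    show "computes (P1 @ ?P2 @ ?P3) (reloc (length (P1 @ ?P2)) e3) E' H"
      using computes_reloc[OF *(3), of "P1 @ ?P2" "[]"] by simp
  qed
qed

lemma ptime_merge2:
  assumes "ptime D F" "ptime E G"
  obtains P e1 e2 where "computes P e1 D F" "computes P e2 E G"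
  using ptime_merge3[OF assms assms(2)] by blast

lemma ptime_poly_bounded: "ptime D F \<Longrightarrow> poly_bounded D (\<lambda>x. esize (F x))"
  unfolding ptime_def computes_def by blast

lemma ptime_cong: "ptime D F \<Longrightarrow> (\<And>x. x \<in> D \<Longrightarrow> F x = G x) \<Longrightarrow> ptime D G"
  unfolding ptime_def computes_def poly_bounded_def by simp

text \<open>A program only sees encodings, so a change of type that keeps the encoding is free, for
  example from \<open>nat\<close> to \<open>int\<close> or from a rational to its reduced
  fraction.\<close>

lemma ptime_enc_eq:
  assumes "ptime D F" "\<And>x. x \<in> D \<Longrightarrow> enc (G x) = enc (F x)"
  shows "ptime D G"
  using assms unfolding ptime_def computes_def poly_bounded_def by simp

lemma bounded_exI: "R t \<Longrightarrow> t \<le> b \<Longrightarrow> \<exists>t \<le> (b :: nat). R t"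
  by blast

section \<open>Closure under the constructs of the language\<close>

lemma evals_to_call:
  assumes "evals_to P \<Gamma> e u t1" "evals_to P [u] b v t2" "f < length P" "P ! f = b"
  shows "evals_to P \<Gamma> (ECall f e) v (t1 + t2 + 1)"
  using assms evals_to.Call by blast

lemma evals_to_const: "\<exists>e t. \<forall>P \<Gamma>. evals_to P \<Gamma> e v t"
proof (induction v)
  case (IntV a)
  show ?case by (blast intro: evals_to.Int)
next
  case (PairV u v)
  then show ?case by (blast intro: evals_to.Pair)
qed

lemma ptime_const: "ptime D (\<lambda>x. c)"
proof -
  obtain e t where "\<forall>P \<Gamma>. evals_to P \<Gamma> e (enc c) t"
    using evals_to_const by blast
  then have "computes [] e D (\<lambda>x. c)"
    by (intro computesI[where T = "\<lambda>_. t"]) (auto intro: poly_bounded_const)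
  then show ?thesis by (rule ptimeI)
qed

lemma evals_to_var0: "evals_to P [v] (EVar 0) v 1"
  using evals_to.Var[of 0 "[v]"] by simp

lemma ptime_id: "ptime D (\<lambda>x. x)"
  by (rule ptimeI[of "[]" "EVar 0"], rule computesI[where T = "\<lambda>_. 1"])
    (use evals_to_var0 in \<open>auto intro: poly_bounded_const poly_bounded_esize\<close>)

lemma ptime_comp:
  assumes G: "ptime E G" and F: "ptime D F" and sub: "\<And>x. x \<in> D \<Longrightarrow> F x \<in> E"
  shows "ptime D (\<lambda>x. G (F x))"
proof -
  obtain P e1 e2 where "computes P e1 E G" "computes P e2 D F"
    using ptime_merge2[OF G F] .
  then obtain T1 T2 where
    1: "poly_bounded E (\<lambda>x. esize (G x))" "poly_bounded E T1"
      "\<And>x. x \<in> E \<Longrightarrow> \<exists>t \<le> T1 x. evals_to P [enc x] e1 (enc (G x)) t" and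
    2: "poly_bounded D (\<lambda>x. esize (F x))" "poly_bounded D T2"
      "\<And>x. x \<in> D \<Longrightarrow> \<exists>t \<le> T2 x. evals_to P [enc x] e2 (enc (F x)) t"
    by (elim computesE) (rule that, assumption+)
  \<comment> \<open>\<open>e1\<close> is written for the environment that consists of its argument
    alone; as function number \<open>length P\<close> it receives this environment through a
    call.\<close>
  have "computes (P @ [e1]) (ECall (length P) e2) D (\<lambda>x. G (F x))"
  proof (rule computesI)
    show "poly_bounded D (\<lambda>x. esize (G (F x)))"
      by (rule poly_bounded_comp[OF 1(1) 2(1) sub])
    show "poly_bounded D (\<lambda>x. T2 x + T1 (F x) + 1)"
      by (intro poly_bounded_intros 2 poly_bounded_comp[OF 1(2) 2(1) sub])
    fix x assume x: "x \<in> D"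
    obtain t2 where t2: "t2 \<le> T2 x" "evals_to P [enc x] e2 (enc (F x)) t2"
      using 2(3)[OF x] by blast
    obtain t1 where t1: "t1 \<le> T1 (F x)" "evals_to P [enc (F x)] e1 (enc (G (F x))) t1"
      using 1(3)[OF sub[OF x]] by blast
    have "evals_to (P @ [e1]) [enc x] (ECall (length P) e2) (enc (G (F x))) (t2 + t1 + 1)"
      by (rule evals_to_call[OF evals_to_append[OF t2(2)] evals_to_append[OF t1(2)]]) simp_all
    then show "\<exists>t \<le> T2 x + T1 (F x) + 1.
        evals_to (P @ [e1]) [enc x] (ECall (length P) e2) (enc (G (F x))) t"
      using t1(1) t2(1) by (intro exI[of _ "t2 + t1 + 1"]) simp
  qed
  then show ?thesis by (rule ptimeI)
qed

lemma ptime_pair: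
  assumes F: "ptime D F" and G: "ptime D G"
  shows "ptime D (\<lambda>x. (F x, G x))"
proof -
  obtain P e1 e2 where "computes P e1 D F" "computes P e2 D G"
    using ptime_merge2[OF F G] .
  then obtain T1 T2 where
    1: "poly_bounded D (\<lambda>x. esize (F x))" "poly_bounded D T1"
      "\<And>x. x \<in> D \<Longrightarrow> \<exists>t \<le> T1 x. evals_to P [enc x] e1 (enc (F x)) t" and
    2: "poly_bounded D (\<lambda>x. esize (G x))" "poly_bounded D T2"
      "\<And>x. x \<in> D \<Longrightarrow> \<exists>t \<le> T2 x. evals_to P [enc x] e2 (enc (G x)) t"
    by (elim computesE) (rule that, assumption+)
  have "computes P (EPair e1 e2) D (\<lambda>x. (F x, G x))"
  proof (rule computesI)
    show "poly_bounded D (\<lambda>x. esize (F x, G x))"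
      using poly_bounded_add[OF poly_bounded_const[of D 1] poly_bounded_add[OF 1(1) 2(1)]] by simp
    show "poly_bounded D (\<lambda>x. T1 x + T2 x + 1)"
      by (intro poly_bounded_intros 1 2)
    fix x assume x: "x \<in> D"
    obtain t1 t2 where t: "t1 \<le> T1 x" "t2 \<le> T2 x"
      and ev: "evals_to P [enc x] e1 (enc (F x)) t1" "evals_to P [enc x] e2 (enc (G x)) t2"
      using 1(3)[OF x] 2(3)[OF x] by blast
    from evals_to.Pair[OF ev] show "\<exists>t \<le> T1 x + T2 x + 1. evals_to P [enc x] (EPair e1 e2) (enc (F x, G x)) t"
      unfolding enc_simps by (rule bounded_exI) (use t in linarith)
  qed
  then show ?thesis by (rule ptimeI)
qed

lemma ptime_arith:
  fixes F G :: "'a :: codable \<Rightarrow> int"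
  assumes F: "ptime D F" and G: "ptime D G"
  shows "ptime D (\<lambda>x. arith_op f (F x) (G x))"
proof -
  obtain P e1 e2 where "computes P e1 D F" "computes P e2 D G"
    using ptime_merge2[OF F G] .
  then obtain T1 T2 where
    1: "poly_bounded D (\<lambda>x. esize (F x))" "poly_bounded D T1"
      "\<And>x. x \<in> D \<Longrightarrow> \<exists>t \<le> T1 x. evals_to P [enc x] e1 (enc (F x)) t" and
    2: "poly_bounded D (\<lambda>x. esize (G x))" "poly_bounded D T2"
      "\<And>x. x \<in> D \<Longrightarrow> \<exists>t \<le> T2 x. evals_to P [enc x] e2 (enc (G x)) t"
    by (elim computesE) (rule that, assumption+)
  have "computes P (EArith f e1 e2) D (\<lambda>x. arith_op f (F x) (G x))"
  proof (rule computesI)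
    show "poly_bounded D (\<lambda>x. esize (arith_op f (F x) (G x)))"
      by (rule poly_bounded_mono[OF poly_bounded_add[OF 1(1) 2(1)]])
        (use bitlength_arith_op in \<open>auto simp: add.commute\<close>)
    show "poly_bounded D (\<lambda>x. T1 x + T2 x + 1 + (esize (F x) + esize (G x)))"
      by (intro poly_bounded_add poly_bounded_const 1 2)
    fix x assume x: "x \<in> D"
    obtain t1 t2 where t: "t1 \<le> T1 x" "t2 \<le> T2 x"
      and ev: "evals_to P [enc x] e1 (IntV (F x)) t1" "evals_to P [enc x] e2 (IntV (G x)) t2"
      using 1(3)[OF x] 2(3)[OF x] unfolding enc_simps by blast
    from evals_to.Arith[OF ev, of f] show "\<exists>t \<le> T1 x + T2 x + 1 + (esize (F x) + esize (G x)).
        evals_to P [enc x] (EArith f e1 e2) (enc (arith_op f (F x) (G x))) t"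
      unfolding enc_simps val_size.simps
      by (rule bounded_exI) (use t in linarith)
  qed
  then show ?thesis by (rule ptimeI)
qed

lemma
  fixes F G :: "'a :: codable \<Rightarrow> int"
  assumes "ptime D F" "ptime D G"
  shows ptime_add: "ptime D (\<lambda>x. F x + G x)"
    and ptime_diff: "ptime D (\<lambda>x. F x - G x)"
    and ptime_mult: "ptime D (\<lambda>x. F x * G x)"
    and ptime_div: "ptime D (\<lambda>x. F x div G x)"
    and ptime_less: "ptime D (\<lambda>x. F x < G x)"
proof -
  show "ptime D (\<lambda>x. F x < G x)"
    by (rule ptime_enc_eq[OF ptime_arith[OF assms, of Less]]) simp
qed (use ptime_arith[OF assms, of Add] ptime_arith[OF assms, of Sub]
    ptime_arith[OF assms, of Mul] ptime_arith[OF assms, of Div] in simp_all)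

lemma ptime_fst:
  assumes "ptime D F" shows "ptime D (\<lambda>x. fst (F x))"
proof -
  have "computes [] (EFst (EVar 0)) UNIV (fst :: 'b \<times> 'c \<Rightarrow> 'b)"
  proof (rule computesI)
    show "poly_bounded UNIV (\<lambda>x :: 'b \<times> 'c. esize (fst x))"
      by (rule poly_bounded_mono[OF poly_bounded_esize]) (simp add: esize_pair)
    show "poly_bounded UNIV (\<lambda>x :: 'b \<times> 'c. 2)"
      by (rule poly_bounded_const)
    show "\<exists>t \<le> 2. evals_to [] [enc x] (EFst (EVar 0)) (enc (fst x)) t" for x :: "'b \<times> 'c"
      using evals_to.Fst[OF evals_to_var0, of "[]" "enc (fst x)" "enc (snd x)"]
      by (cases x) (auto simp: numeral_2_eq_2)
  qed
  from ptime_comp[OF ptimeI[OF this] assms] show ?thesis by simp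
qed

lemma ptime_snd:
  assumes "ptime D F" shows "ptime D (\<lambda>x. snd (F x))"
proof -
  have "computes [] (ESnd (EVar 0)) UNIV (snd :: 'b \<times> 'c \<Rightarrow> 'c)"
  proof (rule computesI)
    show "poly_bounded UNIV (\<lambda>x :: 'b \<times> 'c. esize (snd x))"
      by (rule poly_bounded_mono[OF poly_bounded_esize]) (simp add: esize_pair)
    show "poly_bounded UNIV (\<lambda>x :: 'b \<times> 'c. 2)"
      by (rule poly_bounded_const)
    show "\<exists>t \<le> 2. evals_to [] [enc x] (ESnd (EVar 0)) (enc (snd x)) t" for x :: "'b \<times> 'c"
      using evals_to.Snd[OF evals_to_var0, of "[]" "enc (fst x)" "enc (snd x)"]
      by (cases x) (auto simp: numeral_2_eq_2)
  qed
  from ptime_comp[OF ptimeI[OF this] assms] show ?thesis by simp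
qed

lemma ptime_if:
  assumes C: "ptime D C" and F: "ptime D F" and G: "ptime D G"
  shows "ptime D (\<lambda>x. if C x then F x else G x)"
proof -
  obtain P e e1 e2 where "computes P e D C" "computes P e1 D F" "computes P e2 D G"
    using ptime_merge3[OF C F G] .
  then obtain T T1 T2 where
    0: "poly_bounded D T" "\<And>x. x \<in> D \<Longrightarrow> \<exists>t \<le> T x. evals_to P [enc x] e (enc (C x)) t" and
    1: "poly_bounded D (\<lambda>x. esize (F x))" "poly_bounded D T1"
      "\<And>x. x \<in> D \<Longrightarrow> \<exists>t \<le> T1 x. evals_to P [enc x] e1 (enc (F x)) t" and
    2: "poly_bounded D (\<lambda>x. esize (G x))" "poly_bounded D T2"
      "\<And>x. x \<in> D \<Longrightarrow> \<exists>t \<le> T2 x. evals_to P [enc x] e2 (enc (G x)) t"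
    by (elim computesE) (rule that, assumption+)
  have "computes P (EIf e e1 e2) D (\<lambda>x. if C x then F x else G x)"
  proof (rule computesI)
    show "poly_bounded D (\<lambda>x. esize (if C x then F x else G x))"
      by (rule poly_bounded_mono[OF poly_bounded_add[OF 1(1) 2(1)]]) simp
    show "poly_bounded D (\<lambda>x. T x + (T1 x + T2 x) + 1)"
      by (intro poly_bounded_intros 0 1 2)
    fix x assume x: "x \<in> D"
    obtain t t1 t2 where t: "t \<le> T x" "evals_to P [enc x] e (IntV (of_bool (C x))) t"
      and t1: "t1 \<le> T1 x" "evals_to P [enc x] e1 (enc (F x)) t1"
      and t2: "t2 \<le> T2 x" "evals_to P [enc x] e2 (enc (G x)) t2"
      using 0(2)[OF x] 1(3)[OF x] 2(3)[OF x] by auto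
    show "\<exists>t \<le> T x + (T1 x + T2 x) + 1.
        evals_to P [enc x] (EIf e e1 e2) (enc (if C x then F x else G x)) t"
    proof (cases "C x")
      case True
      with t t1 show ?thesis
        using evals_to.IfTrue[of P "[enc x]" e 1 t e1 "enc (F x)" t1 e2]
        by (intro exI[of _ "t + t1 + 1"]) auto
    next
      case False
      with t t2 show ?thesis
        using evals_to.IfFalse[of P "[enc x]" e t e2 "enc (G x)" t2 e1]
        by (intro exI[of _ "t + t2 + 1"]) auto
    qed
  qed
  then show ?thesis by (rule ptimeI)
qed

text \<open>Case analysis on a value whose encoding is either a leaf or a pair: this covers lists and
  options at once.\<close>

lemma ptime_case_pair:
  assumes L: "ptime D L" and F: "ptime D F" and G: "ptime {y. fst y \<in> D \<and> Q (fst y) (snd y)} G"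
    and leaf: "\<And>x. x \<in> D \<Longrightarrow> \<not> S x \<Longrightarrow> enc (L x) = IntV 0 \<and> H x = F x"
    and pair: "\<And>x. x \<in> D \<Longrightarrow> S x \<Longrightarrow> Q x (R x) \<and> enc (proj (L x)) = enc (R x) \<and> H x = G (x, R x)"
    and proj: "\<And>x. x \<in> D \<Longrightarrow> S x \<Longrightarrow> evals_to [] [enc (L x)] ep (enc (proj (L x))) c"
    and ispair: "\<And>x. x \<in> D \<Longrightarrow> S x \<Longrightarrow> \<exists>u v. enc (L x) = PairV u v"
    and size: "\<And>x. x \<in> D \<Longrightarrow> S x \<Longrightarrow> esize (R x) \<le> esize (L x)"
  shows "ptime D H"
proof -
  let ?E = "{y. fst y \<in> D \<and> Q (fst y) (snd y)}"
  obtain P e e1 e2 where "computes P e D L" "computes P e1 D F" "computes P e2 ?E G"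
    using ptime_merge3[OF L F G] .
  then obtain T T1 T2 where
    0: "poly_bounded D (\<lambda>x. esize (L x))" "poly_bounded D T"
      "\<And>x. x \<in> D \<Longrightarrow> \<exists>t \<le> T x. evals_to P [enc x] e (enc (L x)) t" and
    1: "poly_bounded D (\<lambda>x. esize (F x))" "poly_bounded D T1"
      "\<And>x. x \<in> D \<Longrightarrow> \<exists>t \<le> T1 x. evals_to P [enc x] e1 (enc (F x)) t" and
    2: "poly_bounded ?E (\<lambda>x. esize (G x))" "poly_bounded ?E T2"
      "\<And>x. x \<in> ?E \<Longrightarrow> \<exists>t \<le> T2 x. evals_to P [enc x] e2 (enc (G x)) t"
    by (elim computesE) (rule that, assumption+)
  from 2(1,2) obtain q1 q2 where q1: "\<And>y. y \<in> ?E \<Longrightarrow> esize (G y) \<le> poly q1 (esize y)"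
    and q2: "\<And>y. y \<in> ?E \<Longrightarrow> T2 y \<le> poly q2 (esize y)"
    unfolding poly_bounded_def by blast
  let ?M = "\<lambda>x. 1 + esize x + esize (L x)"
  have M: "poly_bounded D ?M"
    by (intro poly_bounded_intros 0)
  have le: "esize (x, R x) \<le> ?M x" if "x \<in> D" "S x" for x
    using size[OF that] by simp
  have E: "(x, R x) \<in> ?E" if "x \<in> D" "S x" for x
    using pair[OF that] that by simp
  \<comment> \<open>Function \<open>length P\<close> extracts the payload from the encoding of
    \<open>L x\<close>; function \<open>length P + 1\<close> is the pair branch, which receives the
    input together with the payload.\<close>
  let ?P = "P @ [ep, e2]"
  let ?e = "EIf (EIsPair e) (ECall (length P + 1) (EPair (EVar 0) (ECall (length P) e))) e1"
  have "computes ?P ?e D H"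
  proof (rule computesI)
    have "poly_bounded D (\<lambda>x. esize (F x) + poly q1 (?M x))"
      by (intro poly_bounded_add poly_bounded_poly 1 M)
    then show "poly_bounded D (\<lambda>x. esize (H x))"
    proof (rule poly_bounded_mono)
      fix x assume x: "x \<in> D"
      show "esize (H x) \<le> esize (F x) + poly q1 (?M x)"
      proof (cases "S x")
        case True
        have "esize (H x) \<le> poly q1 (esize (x, R x))"
          using q1[OF E[OF x True]] pair[OF x True] by simp
        also have "\<dots> \<le> poly q1 (?M x)"
          using le[OF x True] by (rule poly_nat_mono)
        finally show ?thesis by simp
      qed (use leaf[OF x] in simp)
    qed
    show "poly_bounded D (\<lambda>x. 2 * T x + T1 x + poly q2 (?M x) + (c + 20))"
      by (intro poly_bounded_add poly_bounded_mult poly_bounded_const poly_bounded_poly 0 1 M)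
    fix x assume x: "x \<in> D"
    obtain t where t: "t \<le> T x" "evals_to ?P [enc x] e (enc (L x)) t"
      using 0(3)[OF x] evals_to_append by blast
    show "\<exists>t \<le> 2 * T x + T1 x + poly q2 (?M x) + (c + 20). evals_to ?P [enc x] ?e (enc (H x)) t"
    proof (cases "S x")
      case True
      note p = pair[OF x True]
      obtain t2 where t2: "t2 \<le> T2 (x, R x)" "evals_to ?P [enc (x, R x)] e2 (enc (G (x, R x))) t2"
        using 2(3)[OF E[OF x True]] evals_to_append by blast
      have "T2 (x, R x) \<le> poly q2 (?M x)"
        using q2[OF E[OF x True]] poly_nat_mono[OF le[OF x True], of q2] by linarith
      with t2(1) have t2': "t2 \<le> poly q2 (?M x)" by linarith
      have ip: "evals_to ?P [enc x] (EIsPair e) (IntV 1) (t + 1)"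
        using ispair[OF x True] t(2) evals_to.IsPair by metis
      have "evals_to ?P [enc (L x)] ep (enc (R x)) c"
        using evals_to_append[OF proj[OF x True], of ?P] p by simp
      then have "evals_to ?P [enc x] (ECall (length P) e) (enc (R x)) (t + c + 1)"
        by (rule evals_to_call[OF t(2)]) simp_all
      then have "evals_to ?P [enc x] (EPair (EVar 0) (ECall (length P) e)) (enc (x, R x)) (1 + (t + c + 1) + 1)"
        unfolding enc_simps by (rule evals_to.Pair[OF evals_to_var0])
      then have "evals_to ?P [enc x] (ECall (length P + 1) (EPair (EVar 0) (ECall (length P) e)))
          (enc (G (x, R x))) (1 + (t + c + 1) + 1 + t2 + 1)"
        by (rule evals_to_call[OF _ t2(2)]) (simp_all add: nth_append)
      from evals_to.IfTrue[OF ip _ this, of e1] p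
      have "evals_to ?P [enc x] ?e (enc (H x)) (t + 1 + (1 + (t + c + 1) + 1 + t2 + 1) + 1)"
        by simp
      then show ?thesis
        by (rule bounded_exI) (use t(1) t2' in linarith)
    next
      case False
      note p = leaf[OF x False]
      obtain t1 where t1: "t1 \<le> T1 x" "evals_to ?P [enc x] e1 (enc (F x)) t1"
        using 1(3)[OF x] evals_to_append by blast
      have "evals_to ?P [enc x] (EIsPair e) (IntV 0) (t + 1)"
        using p t(2) evals_to.IsNoPair by metis
      from evals_to.IfFalse[OF this t1(2)] have "evals_to ?P [enc x] ?e (enc (H x)) (t + 1 + t1 + 1)"
        using p by simp
      then show ?thesis
        by (rule bounded_exI) (use t(1) t1(1) in linarith)
    qed
  qed
  then show ?thesis by (rule ptimeI)
qed

lemma ptime_case_option: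
  assumes "ptime D L" "ptime D F"
    "ptime {y. fst y \<in> D \<and> L (fst y) = Some (snd y)} (\<lambda>y. G (fst y) (snd y))"
  shows "ptime D (\<lambda>x. case L x of None \<Rightarrow> F x | Some a \<Rightarrow> G x a)"
proof (rule ptime_case_pair[OF assms, where S = "\<lambda>x. L x \<noteq> None" and R = "\<lambda>x. the (L x)"
      and proj = the and ep = "EFst (EVar 0)"])
  fix x assume "L x \<noteq> None"
  then obtain a where a: "L x = Some a" by blast
  show "evals_to [] [enc (L x)] (EFst (EVar 0)) (enc (the (L x))) (1 + 1)"
    unfolding a enc_simps option.sel by (rule evals_to.Fst[OF evals_to_var0])
qed auto

lemma ptime_case_list:
  assumes "ptime D L" "ptime D F"
    "ptime {y. fst y \<in> D \<and> L (fst y) = fst (snd y) # snd (snd y)}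
      (\<lambda>y. G (fst y) (fst (snd y)) (snd (snd y)))"
  shows "ptime D (\<lambda>x. case L x of [] \<Rightarrow> F x | a # as \<Rightarrow> G x a as)"
\<comment> \<open>A cons cell already has the encoding of the pair of head and tail, so the
  projection is the identity.\<close>
proof (rule ptime_case_pair[OF assms, where S = "\<lambda>x. L x \<noteq> []"
      and R = "\<lambda>x. (hd (L x), tl (L x))" and proj = "\<lambda>xs. (hd xs, tl xs)" and ep = "EVar 0"])
  fix x assume "L x \<noteq> []"
  then obtain a as where a: "L x = a # as" by (cases "L x") auto
  show "evals_to [] [enc (L x)] (EVar 0) (enc (hd (L x), tl (L x))) 1"
    unfolding a by simp (metis evals_to_var0 One_nat_def)
qed (simp, auto simp: neq_Nil_conv)

text \<open>This is the source of all iteration in the calculus. A polynomial-time step alone would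
  not suffice, since a step that doubles its state reaches exponential size; hence the bound
  \<open>B\<close> on every intermediate state. The step has to be computable only on states that
  really occur after some prefix \<open>ys\<close>.\<close>

lemma ptime_fold:
  assumes L: "ptime D L" and I: "ptime D I"
    and S: "ptime {y. fst y \<in> D \<and> (\<exists>ys zs. L (fst y) = ys @ fst (snd y) # zs \<and>
        snd (snd y) = fold (s (fst y)) ys (I (fst y)))} (\<lambda>y. s (fst y) (fst (snd y)) (snd (snd y)))"
    and B: "poly_bounded D B"
      "\<And>x ys zs. x \<in> D \<Longrightarrow> L x = ys @ zs \<Longrightarrow> esize (fold (s x) ys (I x)) \<le> B x"
  shows "ptime D (\<lambda>x. fold (s x) (L x) (I x))"
proof -
  let ?E = "{y. fst y \<in> D \<and> (\<exists>ys zs. L (fst y) = ys @ fst (snd y) # zs \<and>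
        snd (snd y) = fold (s (fst y)) ys (I (fst y)))}"
  let ?S = "\<lambda>y. s (fst y) (fst (snd y)) (snd (snd y))"
  obtain P eL eI eS where "computes P eL D L" "computes P eI D I" "computes P eS ?E ?S"
    using ptime_merge3[OF L I S] .
  then obtain TL TI TS where
    0: "poly_bounded D (\<lambda>x. esize (L x))" "poly_bounded D TL"
      "\<And>x. x \<in> D \<Longrightarrow> \<exists>t \<le> TL x. evals_to P [enc x] eL (enc (L x)) t" and
    1: "poly_bounded D (\<lambda>x. esize (I x))" "poly_bounded D TI"
      "\<And>x. x \<in> D \<Longrightarrow> \<exists>t \<le> TI x. evals_to P [enc x] eI (enc (I x)) t" and
    2: "poly_bounded ?E TS"
      "\<And>y. y \<in> ?E \<Longrightarrow> \<exists>t \<le> TS y. evals_to P [enc y] eS (enc (?S y)) t"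
    by (elim computesE) (rule that, assumption+)
  from 2(1) obtain q where q: "\<And>y. y \<in> ?E \<Longrightarrow> TS y \<le> poly q (esize y)"
    unfolding poly_bounded_def by blast
  \<comment> \<open>Bounds the size of the step's argument \<open>(x, b, a)\<close>: two pair nodes,
    the input, a list element and a state.\<close>
  let ?M = "\<lambda>x. 2 + esize x + esize (L x) + B x"
  let ?T = "\<lambda>x. poly q (?M x)"
  have T: "poly_bounded D ?T"
    by (intro poly_bounded_poly poly_bounded_add poly_bounded_const poly_bounded_esize 0 B)
  define n where "n = length P"
  \<comment> \<open>The loop runs on the triple of remaining list, input and state. Function
    \<open>n\<close> is the step and \<open>n + 1\<close> is the loop itself.\<close>
  define loop where "loop = EIf (EIsPair (EFst (EVar 0)))
    (ECall (n + 1) (EPair (ESnd (EFst (EVar 0))) (EPair (EFst (ESnd (EVar 0)))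
      (ECall n (EPair (EFst (ESnd (EVar 0))) (EPair (EFst (EFst (EVar 0))) (ESnd (ESnd (EVar 0)))))))))
    (ESnd (ESnd (EVar 0)))"
  let ?P = "P @ [eS, loop]"
  \<comment> \<open>The constant 40 generously covers the fixed cost of one round, which is 25
    besides the step; the summand 1 pays for the final visit to the empty list.\<close>
  have loop: "\<exists>t \<le> (length zs + 1) * (?T x + 40).
      evals_to ?P [enc (zs, x, fold (s x) ys (I x))] loop (enc (fold (s x) zs (fold (s x) ys (I x)))) t"
    if x: "x \<in> D" and "L x = ys @ zs" for x ys zs
    using that(2)
  proof (induction zs arbitrary: ys)
    case Nil
    let ?a = "fold (s x) ys (I x)"
    have v: "evals_to ?P [enc ([] :: 'b list, x, ?a)] (EVar 0) (PairV (IntV 0) (PairV (enc x) (enc ?a))) 1"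
      by (simp del: One_nat_def) (rule evals_to_var0)
    have "evals_to ?P [enc ([] :: 'b list, x, ?a)] loop (enc ?a)
        (1 + 1 + 1 + (1 + 1 + 1) + 1)"
      unfolding loop_def
      by (rule evals_to.IfFalse, rule evals_to.IsNoPair, rule evals_to.Fst, rule v[unfolded loop_def],
          rule evals_to.Snd, rule evals_to.Snd, rule v[unfolded loop_def])
    then show ?case
      by (simp only: fold_simps) (rule bounded_exI, assumption, simp)
  next
    case (Cons b zs)
    let ?a = "fold (s x) ys (I x)"
    have E: "(x, b, ?a) \<in> ?E"
      using x Cons.prems by auto
    have "esize b \<le> esize (L x)"
      using Cons.prems by (intro esize_member) simp
    moreover have "esize ?a \<le> B x"
      using B(2)[OF x] Cons.prems by blast
    ultimately have "esize (x, b, ?a) \<le> ?M x" by simp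
    from q[OF E] poly_nat_mono[OF this, of q] have TS: "TS (x, b, ?a) \<le> ?T x"
      by linarith
    from 2(2)[OF E] obtain ts where ts: "ts \<le> TS (x, b, ?a)"
      "evals_to P [enc (x, b, ?a)] eS (enc (s x b ?a)) ts"
      unfolding fst_conv snd_conv by blast
    have ts': "ts \<le> ?T x" using ts(1) TS by (rule order_trans)
    let ?\<Gamma> = "[enc (b # zs, x, ?a)]"
    have v: "evals_to ?P ?\<Gamma> (EVar 0) (PairV (PairV (enc b) (enc zs)) (PairV (enc x) (enc ?a))) 1"
      by (simp del: One_nat_def) (rule evals_to_var0)
    note fs = evals_to.Fst evals_to.Snd
    have vb: "evals_to ?P ?\<Gamma> (EFst (EFst (EVar 0))) (enc b) (1 + 1 + 1)"
      by (rule fs, rule fs, rule v)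
    have vz: "evals_to ?P ?\<Gamma> (ESnd (EFst (EVar 0))) (enc zs) (1 + 1 + 1)"
      by (rule evals_to.Snd, rule fs, rule v)
    have vx: "evals_to ?P ?\<Gamma> (EFst (ESnd (EVar 0))) (enc x) (1 + 1 + 1)"
      by (rule evals_to.Fst, rule evals_to.Snd, rule v)
    have va: "evals_to ?P ?\<Gamma> (ESnd (ESnd (EVar 0))) (enc ?a) (1 + 1 + 1)"
      by (rule evals_to.Snd, rule evals_to.Snd, rule v)
    have call: "evals_to ?P ?\<Gamma> (ECall n (EPair (EFst (ESnd (EVar 0))) (EPair (EFst (EFst (EVar 0))) (ESnd (ESnd (EVar 0))))))
      (enc (s x b ?a)) ((1 + 1 + 1) + ((1 + 1 + 1) + (1 + 1 + 1) + 1) + 1 + ts + 1)"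
    proof (rule evals_to_call)
      show "evals_to ?P ?\<Gamma> (EPair (EFst (ESnd (EVar 0))) (EPair (EFst (EFst (EVar 0))) (ESnd (ESnd (EVar 0)))))
         (enc (x, b, ?a)) ((1 + 1 + 1) + ((1 + 1 + 1) + (1 + 1 + 1) + 1) + 1)"
        using evals_to.Pair[OF vx evals_to.Pair[OF vb va]] unfolding enc_simps(4) .
      show "evals_to ?P [enc (x, b, ?a)] eS (enc (s x b ?a)) ts"
        by (rule evals_to_append[OF ts(2)])
    qed (simp_all add: n_def)
    have "L x = (ys @ [b]) @ zs" using Cons.prems by simp
    from Cons.IH[OF this] obtain tr where tr: "tr \<le> (length zs + 1) * (?T x + 40)"
      "evals_to ?P [enc (zs, x, s x b ?a)] loop (enc (fold (s x) (b # zs) ?a)) tr"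
      by auto
    have arg: "evals_to ?P ?\<Gamma> (EPair (ESnd (EFst (EVar 0))) (EPair (EFst (ESnd (EVar 0)))
      (ECall n (EPair (EFst (ESnd (EVar 0))) (EPair (EFst (EFst (EVar 0))) (ESnd (ESnd (EVar 0))))))))
      (enc (zs, x, s x b ?a))
      ((1 + 1 + 1) + ((1 + 1 + 1) + ((1 + 1 + 1) + ((1 + 1 + 1) + (1 + 1 + 1) + 1) + 1 + ts + 1) + 1) + 1)"
      using evals_to.Pair[OF vz evals_to.Pair[OF vx call]] unfolding enc_simps(4) .
    have rec: "evals_to ?P ?\<Gamma> (ECall (n + 1) (EPair (ESnd (EFst (EVar 0))) (EPair (EFst (ESnd (EVar 0)))
      (ECall n (EPair (EFst (ESnd (EVar 0))) (EPair (EFst (EFst (EVar 0))) (ESnd (ESnd (EVar 0)))))))))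
      (enc (fold (s x) (b # zs) ?a))
      ((1 + 1 + 1) + ((1 + 1 + 1) + ((1 + 1 + 1) + ((1 + 1 + 1) + (1 + 1 + 1) + 1) + 1 + ts + 1) + 1) + 1 + tr + 1)"
      by (rule evals_to_call[OF arg tr(2)]) (simp_all add: n_def nth_append)
    have ip: "evals_to ?P ?\<Gamma> (EIsPair (EFst (EVar 0))) (IntV 1) (1 + 1 + 1)"
      by (rule evals_to.IsPair, rule fs, rule v)
    have "evals_to ?P ?\<Gamma> loop (enc (fold (s x) (b # zs) ?a)) (ts + tr + 25)"
      using evals_to.IfTrue[OF ip _ rec, of "ESnd (ESnd (EVar 0))"] unfolding loop_def
      by (simp add: ac_simps eval_nat_numeral)
    moreover have "ts + tr + 25 \<le> (length (b # zs) + 1) * (?T x + 40)"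
      using ts' tr(1) by simp
    ultimately show ?case by blast
  qed
  let ?e = "ECall (n + 1) (EPair eL (EPair (EVar 0) eI))"
  have "computes ?P ?e D (\<lambda>x. fold (s x) (L x) (I x))"
  proof (rule computesI)
    show "poly_bounded D (\<lambda>x. esize (fold (s x) (L x) (I x)))"
      using B(2)[of _ "L _" "[]"] by (intro poly_bounded_mono[OF B(1)]) simp
    show "poly_bounded D (\<lambda>x. TL x + TI x + 4 + (esize (L x) + 1) * (?T x + 40))"
      by (intro poly_bounded_add poly_bounded_mult poly_bounded_const 0 1 T)
    fix x assume x: "x \<in> D"
    obtain tl ti where tl: "tl \<le> TL x" "evals_to ?P [enc x] eL (enc (L x)) tl"
      and ti: "ti \<le> TI x" "evals_to ?P [enc x] eI (enc (I x)) ti"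
      using 0(3)[OF x] 1(3)[OF x] evals_to_append by metis
    obtain t where t: "t \<le> (length (L x) + 1) * (?T x + 40)"
      "evals_to ?P [enc (L x, x, I x)] loop (enc (fold (s x) (L x) (I x))) t"
      using loop[OF x, of "[]" "L x"] by auto
    have "evals_to ?P [enc x] ?e (enc (fold (s x) (L x) (I x))) (tl + (1 + ti + 1) + 1 + t + 1)"
      by (rule evals_to_call[OF _ t(2)], unfold enc_simps(4),
          rule evals_to.Pair[OF tl(2) evals_to.Pair[OF evals_to_var0 ti(2)]])
        (simp_all add: n_def nth_append)
    moreover have "(length (L x) + 1) * (?T x + 40) \<le> (esize (L x) + 1) * (?T x + 40)"
      by (intro mult_right_mono) (simp_all add: length_le_esize)
    ultimately show "\<exists>t \<le> TL x + TI x + 4 + (esize (L x) + 1) * (?T x + 40).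
        evals_to ?P [enc x] ?e (enc (fold (s x) (L x) (I x))) t"
      using tl(1) ti(1) t(1) by (intro bounded_exI[of "evals_to ?P [enc x] ?e (enc (fold (s x) (L x) (I x)))"]) (assumption, linarith)
  qed
  then show ?thesis by (rule ptimeI)
qed

section \<open>Polynomial-time list processing\<close>

instantiation nat :: codable begin
definition enc_nat :: "nat \<Rightarrow> val" where "enc_nat n = IntV (int n)"
instance ..
end

lemma enc_nat [simp]: "enc (n :: nat) = IntV (int n)"
  by (simp add: enc_nat_def)

lemma ptime_Cons: "ptime D F \<Longrightarrow> ptime D G \<Longrightarrow> ptime D (\<lambda>x. F x # G x)"
  by (rule ptime_enc_eq[OF ptime_pair[of D F G]]) simp_all

lemma ptime_Some: "ptime D F \<Longrightarrow> ptime D (\<lambda>x. Some (F x))"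
  by (rule ptime_enc_eq[OF ptime_pair[OF _ ptime_const[of D "0 :: int"], of F]]) simp_all

lemma ptime_enc: "ptime D F \<Longrightarrow> ptime D (\<lambda>x. enc (F x))"
  by (rule ptime_enc_eq[of D F]) simp_all

lemma ptime_quotient_of: "ptime D F \<Longrightarrow> ptime D (\<lambda>x. quotient_of (F x))"
  by (rule ptime_enc_eq[of D F]) (simp_all add: enc_quotient_of)

lemma ptime_of_nat: "ptime D F \<Longrightarrow> ptime D (\<lambda>x. int (F x))"
  by (rule ptime_enc_eq[of D F]) simp_all

lemma ptime_Suc: "ptime D F \<Longrightarrow> ptime D (\<lambda>x. Suc (F x))"
  by (rule ptime_enc_eq[OF ptime_add[OF ptime_of_nat[of D F] ptime_const[of D 1]]]) simp_all

lemma ptime_not: "ptime D F \<Longrightarrow> ptime D (\<lambda>x. \<not> F x)"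
  by (rule ptime_cong[OF ptime_if[of D F, OF _ ptime_const[of D False] ptime_const[of D True]]]) simp_all

lemma ptime_conj: "ptime D F \<Longrightarrow> ptime D G \<Longrightarrow> ptime D (\<lambda>x. F x \<and> G x)"
  by (rule ptime_cong[OF ptime_if[of D F G, OF _ _ ptime_const[of D False]]]) simp_all

lemma ptime_imp: "ptime D F \<Longrightarrow> ptime D G \<Longrightarrow> ptime D (\<lambda>x. F x \<longrightarrow> G x)"
  by (rule ptime_cong[OF ptime_if[of D F G, OF _ _ ptime_const[of D True]]]) simp_all

lemma ptime_le:
  fixes F G :: "'a :: codable \<Rightarrow> int"
  shows "ptime D F \<Longrightarrow> ptime D G \<Longrightarrow> ptime D (\<lambda>x. F x \<le> G x)"
  by (rule ptime_cong[OF ptime_not[OF ptime_less[of D G F]]]) auto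

lemma ptime_eq_int:
  fixes F G :: "'a :: codable \<Rightarrow> int"
  shows "ptime D F \<Longrightarrow> ptime D G \<Longrightarrow> ptime D (\<lambda>x. F x = G x)"
  by (rule ptime_cong[OF ptime_conj[OF ptime_le[of D F G] ptime_le[of D G F]]]) auto

lemma ptime_eq_nat:
  fixes F G :: "'a :: codable \<Rightarrow> nat"
  shows "ptime D F \<Longrightarrow> ptime D G \<Longrightarrow> ptime D (\<lambda>x. F x = G x)"
  by (rule ptime_cong[OF ptime_eq_int[OF ptime_of_nat[of D F] ptime_of_nat[of D G]]]) auto

lemma ptime_Let:
  assumes F: "ptime D F"
    and G: "ptime {y. fst y \<in> D \<and> snd y = F (fst y)} (\<lambda>y. G (fst y) (snd y))"
  shows "ptime D (\<lambda>x. let a = F x in G x a)"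
  using ptime_comp[OF G ptime_pair[OF ptime_id F]] by simp

lemma ptime_case_prod:
  "ptime D (\<lambda>x. G x (fst (F x)) (snd (F x))) \<Longrightarrow> ptime D (\<lambda>x. case F x of (a, b) \<Rightarrow> G x a b)"
  by (simp add: case_prod_beta)

text \<open>Under a binder the domain becomes a set of pairs of the old input and the bound value;
  this rule carries facts about the old input over to such pairs.\<close>

lemma ptime_map_prod_comp:
  assumes "ptime D F" shows "ptime {y. fst y \<in> D \<and> Q y} (\<lambda>y. F (fst y))"
  by (rule ptime_comp[OF assms ptime_fst[OF ptime_id]]) simp

text \<open>Applied backwards, these rules decompose a function along the syntax of its body, so
  that most running time proofs below just unfold a definition.\<close>

lemmas ptime_intros =
  ptime_id ptime_const ptime_add ptime_diff ptime_mult ptime_div ptime_less ptime_le ptime_eq_int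
  ptime_eq_nat ptime_not ptime_conj ptime_imp ptime_of_nat ptime_Suc
  ptime_pair ptime_fst ptime_snd ptime_if ptime_Cons ptime_Some ptime_enc
  ptime_quotient_of ptime_Let ptime_case_prod ptime_case_option ptime_case_list

section \<open>Standard list functions as folds\<close>

lemma fold_Cons_rev: "fold Cons xs ys = rev xs @ ys"
  by (induction xs arbitrary: ys) auto

lemma esize_rev: "esize (rev xs) = esize xs"
  by (simp only: esize_list rev_map[symmetric] sum_list_rev)

lemma esize_append_le: "esize (xs @ ys) \<le> esize xs + esize ys"
  using esize_append[of xs ys] by simp

lemma ptime_rev:
  assumes "ptime D L" shows "ptime D (\<lambda>x. rev (L x))"
proof -
  have "ptime D (\<lambda>x. fold Cons (L x) [])"
  proof (rule ptime_fold[OF assms])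
    show "esize (fold Cons ys []) \<le> esize (L x)" if "L x = ys @ zs" for x ys zs
      using that esize_append[of ys zs] esize_pos[of "enc zs"] by (simp del: esize_pos add: fold_Cons_rev esize_rev)
  qed (intro ptime_intros ptime_poly_bounded assms)+
  then show ?thesis by (simp add: fold_Cons_rev)
qed

lemma ptime_append:
  assumes L: "ptime D L" and M: "ptime D M" shows "ptime D (\<lambda>x. L x @ M x)"
proof -
  have "ptime D (\<lambda>x. fold Cons (rev (L x)) (M x))"
  proof (rule ptime_fold[OF ptime_rev[OF L] M])
    show "poly_bounded D (\<lambda>x. esize (L x) + esize (M x))"
      by (intro poly_bounded_add ptime_poly_bounded L M)
    fix x ys zs assume "rev (L x) = ys @ zs"
    then have L: "L x = rev zs @ rev ys" by (simp add: rev_swap)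
    have "esize (rev ys @ M x) \<le> esize (rev ys) + esize (M x)"
      by (rule esize_append_le)
    moreover have "esize (rev ys) \<le> esize (L x)"
      unfolding L using esize_append[of "rev zs" "rev ys"] esize_pos[of "enc (rev zs)"] by linarith
    ultimately show "esize (fold Cons ys (M x)) \<le> esize (L x) + esize (M x)"
      by (simp add: fold_Cons_rev)
  qed (intro ptime_intros)
  then show ?thesis by (simp add: fold_Cons_rev)
qed

text \<open>An element is no larger than the list that contains it, so a polynomial in the size of a
  pair \<open>(x, b)\<close> yields one bound that serves all elements of \<open>L x\<close> at
  once.\<close>

lemma poly_bounded_over_list:
  assumes L: "poly_bounded D (\<lambda>x. esize (L x))"
    and G: "poly_bounded {y. fst y \<in> D \<and> snd y \<in> set (L (fst y))} (\<lambda>y. m (fst y) (snd y))"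
  obtains B where "poly_bounded D B" "\<And>x b. x \<in> D \<Longrightarrow> b \<in> set (L x) \<Longrightarrow> m x b \<le> B x"
proof -
  from G obtain q where q: "\<And>y. fst y \<in> D \<Longrightarrow> snd y \<in> set (L (fst y)) \<Longrightarrow>
      m (fst y) (snd y) \<le> poly q (esize y)"
    unfolding poly_bounded_def by blast
  show ?thesis
  proof
    show "poly_bounded D (\<lambda>x. poly q (1 + esize x + esize (L x)))"
      by (intro poly_bounded_poly poly_bounded_add poly_bounded_const poly_bounded_esize L)
    fix x b assume x: "x \<in> D" and b: "b \<in> set (L x)"
    have "m x b \<le> poly q (esize (x, b))"
      using q[of "(x, b)"] x b by simp
    also have "\<dots> \<le> poly q (1 + esize x + esize (L x))"
      using esize_member[OF b] by (intro poly_nat_mono) simp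
    finally show "m x b \<le> poly q (1 + esize x + esize (L x))" .
  qed
qed

lemma ptime_map:
  assumes L: "ptime D L"
    and G: "ptime {y. fst y \<in> D \<and> snd y \<in> set (L (fst y))} (\<lambda>y. g (fst y) (snd y))"
  shows "ptime D (\<lambda>x. map (g x) (L x))"
proof -
  obtain B where B: "poly_bounded D B" "\<And>x b. x \<in> D \<Longrightarrow> b \<in> set (L x) \<Longrightarrow> esize (g x b) \<le> B x"
    using poly_bounded_over_list[OF ptime_poly_bounded[OF L] ptime_poly_bounded[OF G]] by blast
  have fold: "fold (\<lambda>b. (#) (h b)) xs ys = rev (map h xs) @ ys" for h :: "'b \<Rightarrow> 'c" and xs ys
    by (induction xs arbitrary: ys) auto
  have "ptime D (\<lambda>x. fold (\<lambda>b s. g x b # s) (L x) [])"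
  proof (rule ptime_fold[OF L ptime_const])
    show "poly_bounded D (\<lambda>x. 1 + esize (L x) * (1 + B x))"
      by (intro poly_bounded_add poly_bounded_mult poly_bounded_const ptime_poly_bounded L B)
    show "esize (fold (\<lambda>b s. g x b # s) ys []) \<le> 1 + esize (L x) * (1 + B x)"
      if "x \<in> D" "L x = ys @ zs" for x ys zs
    proof -
      have "esize (rev (map (g x) ys)) \<le> 1 + length (rev (map (g x) ys)) * (1 + B x)"
        using that by (intro esize_list_le) (auto intro: B(2))
      also have "\<dots> \<le> 1 + esize (L x) * (1 + B x)"
        using length_le_esize[of "L x"] that(2) by (intro add_left_mono mult_right_mono) auto
      finally show ?thesis by (simp add: fold)
    qed
    show "ptime {y. fst y \<in> D \<and> (\<exists>ys zs. L (fst y) = ys @ fst (snd y) # zs \<and>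
        snd (snd y) = fold (\<lambda>b s. g (fst y) b # s) ys [])}
        (\<lambda>y. g (fst y) (fst (snd y)) # snd (snd y))"
    proof (rule ptime_Cons)
      show "ptime {y. fst y \<in> D \<and> (\<exists>ys zs. L (fst y) = ys @ fst (snd y) # zs \<and>
          snd (snd y) = fold (\<lambda>b s. g (fst y) b # s) ys [])} (\<lambda>y. g (fst y) (fst (snd y)))"
        using ptime_comp[OF G ptime_pair[OF ptime_fst[OF ptime_id] ptime_fst[OF ptime_snd[OF ptime_id]]],
            of "{y. fst y \<in> D \<and> (\<exists>ys zs. L (fst y) = ys @ fst (snd y) # zs \<and>
              snd (snd y) = fold (\<lambda>b s. g (fst y) b # s) ys [])}"]
        by force
    qed (intro ptime_intros)
  qed
  from ptime_rev[OF this] show ?thesis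
    by (simp add: fold)
qed

lemma ptime_concat:
  assumes L: "ptime D L" shows "ptime D (\<lambda>x. concat (L x))"
proof -
  have fold: "fold (\<lambda>b s. s @ b) xs ys = ys @ concat xs" for xs and ys :: "'b list"
    by (induction xs arbitrary: ys) auto
  have size: "esize (concat xs) \<le> esize xs" for xs :: "'b list list"
    by (induction xs) (auto intro: order_trans[OF esize_append_le] simp: le_SucI)
  have "ptime D (\<lambda>x. fold (\<lambda>b s. s @ b) (L x) [])"
  proof (rule ptime_fold[OF L ptime_const])
    show "esize (fold (\<lambda>b s. s @ b) ys []) \<le> esize (L x)" if "L x = ys @ zs" for x ys zs
      using size[of ys] esize_append[of ys zs] esize_pos[of "enc zs"] that
      by (simp del: esize_pos add: fold)
  qed (intro ptime_intros ptime_append ptime_poly_bounded L)+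
  then show ?thesis by (simp add: fold)
qed

lemma ptime_filter:
  assumes L: "ptime D L"
    and G: "ptime {y. fst y \<in> D \<and> snd y \<in> set (L (fst y))} (\<lambda>y. g (fst y) (snd y))"
  shows "ptime D (\<lambda>x. filter (g x) (L x))"
proof -
  have "filter h xs = concat (map (\<lambda>b. if h b then [b] else []) xs)" for h and xs :: "'b list"
    by (induction xs) auto
  then have eq: "(\<lambda>x. filter (g x) (L x)) = (\<lambda>x. concat (map (\<lambda>b. if g x b then [b] else []) (L x)))"
    by simp
  show ?thesis
    unfolding eq by (intro ptime_concat ptime_map ptime_intros L G)
qed

lemma ptime_ball:
  assumes L: "ptime D L"
    and G: "ptime {y. fst y \<in> D \<and> snd y \<in> set (L (fst y))} (\<lambda>y. g (fst y) (snd y))"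
  shows "ptime D (\<lambda>x. \<forall>b \<in> set (L x). g x b)"
proof (rule ptime_cong)
  show "ptime D (\<lambda>x. case filter (\<lambda>b. \<not> g x b) (L x) of [] \<Rightarrow> True | _ # _ \<Rightarrow> False)"
    by (intro ptime_intros ptime_filter L G)
  show "(case filter (\<lambda>b. \<not> g x b) (L x) of [] \<Rightarrow> True | _ # _ \<Rightarrow> False) = (\<forall>b \<in> set (L x). g x b)" for x
    by (auto simp: filter_empty_conv filter_eq_Cons_iff split: list.split)
qed

lemma ptime_bex:
  assumes L: "ptime D L"
    and G: "ptime {y. fst y \<in> D \<and> snd y \<in> set (L (fst y))} (\<lambda>y. g (fst y) (snd y))"
  shows "ptime D (\<lambda>x. \<exists>b \<in> set (L x). g x b)"
  by (rule ptime_cong[OF ptime_not[OF ptime_ball[OF L ptime_not[OF G]]]]) auto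

lemma bitlength_le: "\<bar>a\<bar> \<le> int n \<Longrightarrow> bitlength a \<le> n"
proof (rule bitlength_leI)
  assume "\<bar>a\<bar> \<le> int n"
  also have "int n < 2 ^ n"
    using less_exp[of n] by (metis of_nat_less_iff of_nat_numeral of_nat_power)
  finally show "\<bar>a\<bar> < 2 ^ n" .
qed

lemma ptime_length:
  assumes L: "ptime D L" shows "ptime D (\<lambda>x. length (L x))"
proof -
  have fold: "fold (\<lambda>_. Suc) xs n = n + length xs" for xs :: "'b list" and n
    by (induction xs arbitrary: n) auto
  have "ptime D (\<lambda>x. fold (\<lambda>_. Suc) (L x) 0)"
  proof (rule ptime_fold[OF L ptime_const])
    show "poly_bounded D (\<lambda>x. 1 + esize (L x))"
      by (intro poly_bounded_add poly_bounded_const ptime_poly_bounded L)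
    show "esize (fold (\<lambda>_. Suc) ys 0) \<le> 1 + esize (L x)" if "L x = ys @ zs" for x ys zs
      using that length_le_esize[of "L x"] by (auto simp: fold intro!: bitlength_le)
  qed (intro ptime_intros)
  then show ?thesis by (simp add: fold)
qed

text \<open>The upper end is the length of a list and not an arbitrary number, because the range
  below a number can be exponentially longer than its binary encoding.\<close>

lemma ptime_upt_length:
  assumes L: "ptime D L" shows "ptime D (\<lambda>x. [0..<length (L x)])"
proof -
  have fold: "fold (\<lambda>_ s. length s # s) xs [] = rev [0..<length xs]" for xs :: "'b list"
    by (induction xs rule: rev_induct) auto
  have "ptime D (\<lambda>x. fold (\<lambda>_ s. length s # s) (L x) [])"
  proof (rule ptime_fold[OF L ptime_const])
    show "poly_bounded D (\<lambda>x. 1 + esize (L x) * (1 + (1 + esize (L x))))"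
      by (intro poly_bounded_add poly_bounded_mult poly_bounded_const ptime_poly_bounded L)
    fix x ys zs assume x: "x \<in> D" "L x = ys @ zs"
    have "esize (rev [0..<length ys]) \<le> 1 + length (rev [0..<length ys]) * (1 + (1 + esize (L x)))"
      using x(2) length_le_esize[of "L x"] by (intro esize_list_le) (auto intro!: bitlength_le)
    also have "\<dots> \<le> 1 + esize (L x) * (1 + (1 + esize (L x)))"
      using length_le_esize[of "L x"] x(2) by (intro add_left_mono mult_right_mono) auto
    finally show "esize (fold (\<lambda>_ s. length s # s) ys []) \<le> 1 + esize (L x) * (1 + (1 + esize (L x)))"
      by (simp add: fold)
  qed (intro ptime_intros ptime_length)
  from ptime_rev[OF this] show ?thesis by (simp add: fold)
qed

text \<open>A fold consumes one list only, so the rest of the second list travels in the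
  state.\<close>

fun zip_step :: "'a \<Rightarrow> 'b list \<times> ('a \<times> 'b) list \<Rightarrow> 'b list \<times> ('a \<times> 'b) list" where
  "zip_step a (bs, acc) = (case bs of [] \<Rightarrow> ([], acc) | b # bs' \<Rightarrow> (bs', (a, b) # acc))"

lemma fold_zip_step:
  "fold zip_step xs (ys, acc) = (drop (length xs) ys, rev (zip xs ys) @ acc)"
  by (induction xs arbitrary: ys acc) (auto split: list.split)

lemma esize_drop: "esize (drop n xs) \<le> esize xs"
  using esize_append[of "take n xs" "drop n xs"] esize_pos[of "enc (take n xs)"]
  by (simp del: esize_pos)

lemma esize_take: "esize (take n xs) \<le> esize xs"
  using esize_append[of "take n xs" "drop n xs"] esize_pos[of "enc (drop n xs)"]
  by (simp del: esize_pos)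

lemma esize_zip: "esize (zip xs ys) \<le> 2 * esize xs + esize ys"
proof (induction xs arbitrary: ys)
  case Nil
  show ?case by simp
next
  case (Cons x xs)
  note IH = Cons.IH
  show ?case
  proof (cases ys)
    case (Cons y zs)
    then show ?thesis using IH[of zs] by simp
  qed simp
qed

lemma ptime_zip:
  assumes L: "ptime D L" and M: "ptime D M" shows "ptime D (\<lambda>x. zip (L x) (M x))"
proof -
  have "ptime D (\<lambda>x. fold zip_step (L x) (M x, []))"
  proof (rule ptime_fold[OF L ptime_pair[OF M ptime_const]])
    show "poly_bounded D (\<lambda>x. 1 + esize (M x) + (2 * esize (L x) + esize (M x)))"
      by (intro poly_bounded_add poly_bounded_mult poly_bounded_const ptime_poly_bounded L M)
    fix x ys zs assume "x \<in> D" and x: "L x = ys @ zs"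
    have "esize ys \<le> esize (L x)"
      using esize_take[of "length ys" "L x"] x by simp
    then have "esize (rev (zip ys (M x))) \<le> 2 * esize (L x) + esize (M x)"
      using esize_zip[of ys "M x"] by (simp add: esize_rev)
    then show "esize (fold zip_step ys (M x, [])) \<le> 1 + esize (M x) + (2 * esize (L x) + esize (M x))"
      using esize_drop[of "length ys" "M x"] by (simp add: fold_zip_step)
  next
    have "zip_step a s = (case fst s of [] \<Rightarrow> ([], snd s) | b # bs' \<Rightarrow> (bs', (a, b) # snd s))"
      for a :: 'b and s :: "'c list \<times> ('b \<times> 'c) list"
      by (cases s) (simp split: list.split)
    then show "ptime {y. fst y \<in> D \<and> (\<exists>ys zs. L (fst y) = ys @ fst (snd y) # zs \<and>
        snd (snd y) = fold zip_step ys (M (fst y), []))} (\<lambda>y. zip_step (fst (snd y)) (snd (snd y)))"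
      by (simp only:) (intro ptime_intros)
  qed
  from ptime_rev[OF ptime_snd[OF this]] show ?thesis
    by (simp add: fold_zip_step)
qed

lemma ptime_enumerate:
  assumes L: "ptime D L" shows "ptime D (\<lambda>x. List.enumerate 0 (L x))"
  using ptime_zip[OF ptime_upt_length[OF L] L] by (simp add: enumerate_eq_zip)

lemma ptime_list_update:
  assumes "ptime D L" "ptime D I" "ptime D V"
  shows "ptime D (\<lambda>x. (L x)[I x := V x])"
proof (rule ptime_cong)
  note c = ptime_map_prod_comp[OF assms(2)] ptime_map_prod_comp[OF assms(3)]
  show "ptime D (\<lambda>x. map (\<lambda>p. if fst p = I x then V x else snd p) (List.enumerate 0 (L x)))"
    by (intro ptime_map ptime_enumerate ptime_intros assms c)
  show "map (\<lambda>p. if fst p = I x then V x else snd p) (List.enumerate 0 (L x)) = (L x)[I x := V x]" for x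
    by (rule nth_equalityI) (auto simp: nth_enumerate_eq nth_list_update)
qed

section \<open>Sums and products of integer lists\<close>

lemma bitlength_sum_list: "bitlength (sum_list xs) \<le> (\<Sum>a\<leftarrow>xs. 1 + bitlength a)"
proof (induction xs)
  case (Cons a xs)
  then show ?case
    using bitlength_add_max[of a "sum_list xs"] by simp
qed simp

lemma esize_sum_list: "esize (sum_list xs) \<le> esize (xs :: int list)"
proof -
  have "(\<Sum>a\<leftarrow>xs. 1 + bitlength a) \<le> (\<Sum>a\<leftarrow>xs. 1 + esize a)"
    by (rule sum_list_mono) simp
  then show ?thesis
    using bitlength_sum_list[of xs] by (simp add: esize_list)
qed

lemma esize_prod_list: "esize (prod_list xs) \<le> 1 + esize (xs :: int list)"
proof -
  have "bitlength (prod_list xs) \<le> 1 + (\<Sum>a\<leftarrow>xs. bitlength a)"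
  proof (induction xs)
    case (Cons a xs)
    then show ?case
      using bitlength_mult[of a "prod_list xs"] by simp
  qed simp
  moreover have "(\<Sum>a\<leftarrow>xs. bitlength a) \<le> (\<Sum>a\<leftarrow>xs. 1 + esize a)"
    by (rule sum_list_mono) simp
  ultimately show ?thesis by (simp add: esize_list)
qed

lemma ptime_prod_list:
  fixes L :: "'a :: codable \<Rightarrow> int list"
  assumes L: "ptime D L" shows "ptime D (\<lambda>x. prod_list (L x))"
proof -
  have fold: "fold (\<lambda>b s. b * s) xs a = prod_list xs * a" for xs and a :: int
    by (induction xs arbitrary: a) auto
  have "ptime D (\<lambda>x. fold (\<lambda>b s. b * s) (L x) 1)"
  proof (rule ptime_fold[OF L ptime_const])
    show "poly_bounded D (\<lambda>x. 1 + esize (L x))"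
      by (intro poly_bounded_add poly_bounded_const ptime_poly_bounded L)
    show "esize (fold (\<lambda>b s. b * s) ys 1) \<le> 1 + esize (L x)" if "L x = ys @ zs" for x ys zs
      using esize_prod_list[of ys] esize_take[of "length ys" "L x"] that by (simp add: fold)
  qed (intro ptime_intros)
  then show ?thesis by (simp add: fold)
qed

lemmas ptime_list_intros =
  ptime_rev ptime_append ptime_map ptime_concat ptime_filter ptime_ball ptime_bex ptime_length
  ptime_zip ptime_enumerate ptime_list_update ptime_prod_list

section \<open>Vector knapsack with multiple choice\<close>

definition vadd :: "int list \<Rightarrow> int list \<Rightarrow> int list" where
  "vadd u v = map (\<lambda>(a, b). a + b) (zip u v)"

lemma length_vadd [simp]: "length (vadd u v) = min (length u) (length v)"
  by (simp add: vadd_def)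

lemma nth_vadd [simp]: "j < length u \<Longrightarrow> j < length v \<Longrightarrow> vadd u v ! j = u ! j + v ! j"
  by (simp add: vadd_def)

text \<open>A state consists of a profit, a load vector and the list of choices that leads to them; among
  states with the same load vector only one of largest profit is kept.\<close>

type_synonym 'c state = "int \<times> int list \<times> 'c"

definition insert_state :: "'c state \<Rightarrow> 'c state list \<Rightarrow> 'c state list" where
  "insert_state s L =
     (if \<exists>s' \<in> set L. fst (snd s') = fst (snd s) \<and> fst s \<le> fst s' then L
      else s # filter (\<lambda>s'. fst (snd s') \<noteq> fst (snd s)) L)"

lemma set_fold_insert_state: "set (fold insert_state xs L) \<subseteq> set xs \<union> set L"
proof (induction xs arbitrary: L)
  case (Cons x xs)
  have "set (insert_state x L) \<subseteq> insert x (set L)"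
    by (auto simp only: insert_state_def set_simps set_filter split: if_splits)
  with Cons.IH[of "insert_state x L"] show ?case by auto
qed simp

text \<open>A state is dropped only in favour of one with the same load and no smaller profit, and
  this relation is transitive, so it survives all later insertions.\<close>

lemma fold_insert_state_dominates:
  "s \<in> set xs \<union> set L \<Longrightarrow>
    \<exists>s' \<in> set (fold insert_state xs L). fst (snd s') = fst (snd s) \<and> fst s \<le> fst s'"
proof (induction xs arbitrary: s L)
  case (Cons x xs)
  have "\<exists>s' \<in> set (insert_state x L). fst (snd s') = fst (snd s) \<and> fst s \<le> fst s'"
    if "s \<in> insert x (set L)"
  proof (cases "\<exists>s' \<in> set L. fst (snd s') = fst (snd x) \<and> fst x \<le> fst s'")
    case True
    then have "insert_state x L = L" by (simp only: insert_state_def if_True)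
    with True that show ?thesis by (metis insert_iff order_refl)
  next
    case False
    then have eq: "insert_state x L = x # filter (\<lambda>s'. fst (snd s') \<noteq> fst (snd x)) L"
      by (simp only: insert_state_def if_False)
    show ?thesis
    proof (cases "fst (snd s) = fst (snd x)")
      case True
      then show ?thesis using False that unfolding eq by (intro bexI[of _ x]) force+
    next
      case False
      then show ?thesis using that unfolding eq by (intro bexI[of _ s]) auto
    qed
  qed
  with Cons.prems have "\<exists>s' \<in> set xs \<union> set (insert_state x L). fst (snd s') = fst (snd s) \<and> fst s \<le> fst s'"
    by auto
  then obtain s' where s': "s' \<in> set xs \<union> set (insert_state x L)" "fst (snd s') = fst (snd s)" "fst s \<le> fst s'"
    by blast
  from Cons.IH[OF s'(1)] s'(2,3) show ?case by (auto intro: order_trans)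
qed auto

lemma distinct_fold_insert_state:
  "distinct (map (fst \<circ> snd) L) \<Longrightarrow> distinct (map (fst \<circ> snd) (fold insert_state xs L))"
proof (induction xs arbitrary: L)
  case (Cons x xs)
  have "distinct (map (fst \<circ> snd) (insert_state x L))"
    using Cons.prems distinct_map_filter[OF Cons.prems] by (auto simp: insert_state_def comp_def)
  from Cons.IH[OF this] show ?case by simp
qed simp

definition extend_state :: "'c state \<Rightarrow> 'c list state \<Rightarrow> 'c list state" where
  "extend_state m s = (fst m + fst s, vadd (fst (snd m)) (fst (snd s)), snd (snd m) # snd (snd s))"

definition dp_step :: "int \<Rightarrow> 'c state list \<Rightarrow> 'c list state list \<Rightarrow> 'c list state list" where
  "dp_step N ms L =
     fold insert_state (filter (\<lambda>s. \<forall>a \<in> set (fst (snd s)). a \<le> N)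
       (concat (map (\<lambda>m. map (extend_state m) L) ms))) []"

text \<open>The last item is processed first, so that consing the choices lists them in the order of
  \<open>mss\<close>.\<close>

definition dp :: "int \<Rightarrow> int list \<Rightarrow> 'c state list list \<Rightarrow> 'c list state list" where
  "dp N z mss = fold (dp_step N) (rev mss) [(0, z, [])]"

definition vsum :: "int list \<Rightarrow> 'c state list \<Rightarrow> int list" where
  "vsum z \<sigma> = foldr (\<lambda>m. vadd (fst (snd m))) \<sigma> z"

lemma dp_simps:
  "dp N z [] = [(0, z, [])]" "dp N z (ms # mss) = dp_step N ms (dp N z mss)"
  by (simp_all add: dp_def)

lemma vsum_simps [simp]:
  "vsum z [] = z" "vsum z (m # \<sigma>) = vadd (fst (snd m)) (vsum z \<sigma>)"
  by (simp_all add: vsum_def)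

abbreviation "selection \<sigma> mss \<equiv> list_all2 (\<lambda>m ms. m \<in> set ms) \<sigma> mss"

lemma dp_sound:
  assumes "s \<in> set (dp N z mss)" "\<forall>a \<in> set z. a \<le> N"
  shows "(\<exists>\<sigma>. selection \<sigma> mss \<and> s = (\<Sum>m\<leftarrow>\<sigma>. fst m, vsum z \<sigma>, map (snd \<circ> snd) \<sigma>)) \<and>
    (\<forall>a \<in> set (fst (snd s)). a \<le> N)"
  using assms(1)
proof (induction mss arbitrary: s)
  case Nil
  then show ?case using assms(2) by (simp add: dp_simps)
next
  case (Cons ms mss)
  let ?X = "concat (map (\<lambda>m. map (extend_state m) (dp N z mss)) ms)"
  have "s \<in> set (filter (\<lambda>s. \<forall>a \<in> set (fst (snd s)). a \<le> N) ?X)"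
    using Cons.prems set_fold_insert_state[of "filter (\<lambda>s. \<forall>a \<in> set (fst (snd s)). a \<le> N) ?X" "[]"]
    unfolding dp_simps dp_step_def by auto
  then have N: "\<forall>a \<in> set (fst (snd s)). a \<le> N" and "s \<in> set ?X"
    unfolding set_filter by blast+
  then obtain m s' where m: "m \<in> set ms" "s' \<in> set (dp N z mss)" "s = extend_state m s'"
    by auto
  from Cons.IH[OF m(2)] obtain \<sigma> where "selection \<sigma> mss"
    "s' = (\<Sum>m\<leftarrow>\<sigma>. fst m, vsum z \<sigma>, map (snd \<circ> snd) \<sigma>)" by blast
  with m N show ?case
    by (intro conjI exI[of _ "m # \<sigma>"]) (simp_all add: extend_state_def)
qed

lemma vadd_nonneg_le:
  assumes "\<forall>a \<in> set (vadd u v). a \<le> N" "\<forall>a \<in> set u. 0 \<le> a" "length u = length v"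
  shows "\<forall>a \<in> set v. a \<le> N"
proof
  fix a assume "a \<in> set v"
  then obtain j where j: "j < length v" "a = v ! j" by (auto simp: in_set_conv_nth)
  then have "vadd u v ! j \<in> set (vadd u v)" using assms(3) by (intro nth_mem) simp
  then have "u ! j + v ! j \<le> N" using assms j by simp
  moreover have "0 \<le> u ! j" using assms j by simp
  ultimately show "a \<le> N" using j by simp
qed

lemma length_vsum:
  "\<forall>m \<in> set \<sigma>. length (fst (snd m)) = length z \<Longrightarrow> length (vsum z \<sigma>) = length z"
  by (induction \<sigma>) simp_all

text \<open>Loads are nonnegative, so if a selection respects \<open>N\<close>, all its suffixes do
  and survive the filter. Pruning only replaces them by states of the same load and no smaller
  profit.\<close>

lemma dp_complete:
  assumes "selection \<sigma> mss" "\<forall>a \<in> set (vsum z \<sigma>). a \<le> N"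
    and "\<forall>m \<in> set \<sigma>. length (fst (snd m)) = length z \<and> (\<forall>a \<in> set (fst (snd m)). 0 \<le> a)"
  shows "\<exists>s \<in> set (dp N z mss). fst (snd s) = vsum z \<sigma> \<and> (\<Sum>m\<leftarrow>\<sigma>. fst m) \<le> fst s"
  using assms
proof (induction rule: list_all2_induct)
  case Nil
  then show ?case by (simp add: dp_simps)
next
  case (Cons m \<sigma> ms mss)
  have len: "length (vsum z \<sigma>) = length z" using Cons.prems by (intro length_vsum) auto
  have "\<forall>a \<in> set (vsum z \<sigma>). a \<le> N"
    by (rule vadd_nonneg_le[of "fst (snd m)"]) (use Cons.prems len in simp_all)
  then obtain s where s: "s \<in> set (dp N z mss)" "fst (snd s) = vsum z \<sigma>" "(\<Sum>m\<leftarrow>\<sigma>. fst m) \<le> fst s"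
    using Cons.IH Cons.prems(2) by (meson list.set_intros(2))
  let ?e = "extend_state m s"
  have "?e \<in> set (filter (\<lambda>s. \<forall>a \<in> set (fst (snd s)). a \<le> N)
      (concat (map (\<lambda>m. map (extend_state m) (dp N z mss)) ms)))"
  proof -
    have "\<forall>a \<in> set (fst (snd ?e)). a \<le> N" using s(2) Cons.prems(1) by (simp add: extend_state_def)
    moreover have "?e \<in> set (concat (map (\<lambda>m. map (extend_state m) (dp N z mss)) ms))"
      using s(1) Cons.hyps(1) by simp (intro bexI[of _ m] imageI)
    ultimately show ?thesis by simp
  qed
  then obtain s' where "s' \<in> set (dp N z (ms # mss))" "fst (snd s') = fst (snd ?e)" "fst ?e \<le> fst s'"
    unfolding dp_simps dp_step_def using fold_insert_state_dominates[OF UnI1] by blast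
  then show ?case
    using s by (intro bexI[of _ s']) (auto simp: extend_state_def)
qed

lemma distinct_dp: "distinct (map (fst \<circ> snd) (dp N z mss))"
proof (cases mss)
  case (Cons ms mss')
  show ?thesis
    unfolding Cons dp_simps dp_step_def by (rule distinct_fold_insert_state) simp
qed (simp add: dp_simps)

lemma vsum_nonneg:
  assumes "\<forall>m \<in> set \<sigma>. length (fst (snd m)) = length z \<and> (\<forall>a \<in> set (fst (snd m)). 0 \<le> a)"
    "\<forall>a \<in> set z. 0 \<le> a"
  shows "\<forall>a \<in> set (vsum z \<sigma>). 0 \<le> a"
  using assms(1)
proof (induction \<sigma>)
  case (Cons m \<sigma>)
  have *: "\<forall>a \<in> set (vadd u v). 0 \<le> a" if "\<forall>a \<in> set u. 0 \<le> a" "\<forall>a \<in> set v. 0 \<le> a" for u v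
    using that by (auto simp: vadd_def elim!: in_set_zipE)
  show ?case unfolding vsum_simps by (rule *) (use Cons in simp_all)
qed (use assms(2) in simp)

lemma selection_member: "selection \<sigma> mss \<Longrightarrow> m \<in> set \<sigma> \<Longrightarrow> \<exists>ms \<in> set mss. m \<in> set ms"
  by (induction rule: list_all2_induct) auto

text \<open>States have distinct load vectors with entries between 0 and \<open>N\<close>. Here the
  number of dimensions enters the exponent, which is why it has to be a constant.\<close>

lemma length_dp:
  assumes "\<forall>ms \<in> set mss. \<forall>m \<in> set ms. length (fst (snd m)) = length z \<and> (\<forall>a \<in> set (fst (snd m)). 0 \<le> a)"
    and z: "\<forall>a \<in> set z. 0 \<le> a \<and> a \<le> N"
  shows "length (dp N z mss) \<le> nat (N + 1) ^ length z"
proof -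
  let ?V = "{v. set v \<subseteq> {0..N} \<and> length v = length z}"
  have "set (map (fst \<circ> snd) (dp N z mss)) \<subseteq> ?V"
  proof
    fix v assume "v \<in> set (map (fst \<circ> snd) (dp N z mss))"
    then obtain s where s: "s \<in> set (dp N z mss)" "v = fst (snd s)" by auto
    from dp_sound[OF s(1)] z obtain \<sigma> where \<sigma>: "selection \<sigma> mss" "v = vsum z \<sigma>" and N: "\<forall>a \<in> set v. a \<le> N"
      using s(2) by fastforce
    have "\<forall>m \<in> set \<sigma>. length (fst (snd m)) = length z \<and> (\<forall>a \<in> set (fst (snd m)). 0 \<le> a)"
      using assms(1) selection_member[OF \<sigma>(1)] by blast
    then show "v \<in> ?V"
      using vsum_nonneg[of \<sigma> z] length_vsum[of \<sigma> z] N \<sigma>(2) z by auto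
  qed
  then have "card (set (map (fst \<circ> snd) (dp N z mss))) \<le> card ?V"
    by (intro card_mono finite_lists_length_eq) auto
  also have "card ?V = nat (N + 1) ^ length z"
    by (simp add: card_lists_length_eq)
  finally show ?thesis
    using distinct_card[OF distinct_dp[of N z mss]] by simp
qed

lemma sum_if_member:
  "A \<subseteq> {..<n :: nat} \<Longrightarrow> (\<Sum>i<n. if i \<in> A then u i else 0) = (sum u A :: 'b :: comm_monoid_add)"
  using sum.inter_restrict[of "{..<n}" u A] by (simp add: Int_absorb1)

lemma nth_vsum:
  assumes "\<forall>m \<in> set \<sigma>. length (fst (snd m)) = length z" "j < length z"
  shows "vsum z \<sigma> ! j = z ! j + (\<Sum>i<length \<sigma>. fst (snd (\<sigma> ! i)) ! j)"
  using assms
proof (induction \<sigma>)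
  case (Cons m \<sigma>)
  then show ?case
    by (simp add: length_vsum sum.lessThan_Suc_shift del: sum.lessThan_Suc)
qed simp

section \<open>Discarding items to make room\<close>

text \<open>Add elements one by one: when the sum first reaches \<open>u\<close>, it exceeds the
  previous sum, which was below \<open>u\<close>, by a single element of size at most
  \<open>u\<close>.\<close>

lemma subset_sum_between:
  fixes s :: "'i \<Rightarrow> int"
  assumes "finite T" "\<And>i. i \<in> T \<Longrightarrow> s i \<le> u" "u \<le> sum s T" "0 \<le> u"
  shows "\<exists>X \<subseteq> T. u \<le> sum s X \<and> sum s X \<le> 2 * u"
  using assms
proof (induction T rule: finite_induct)
  case (insert x T)
  show ?case
  proof (cases "u \<le> sum s T")
    case True
    with insert.IH insert.prems obtain X where "X \<subseteq> T" "u \<le> sum s X" "sum s X \<le> 2 * u" by auto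
    then show ?thesis by (intro exI[of _ X]) auto
  next
    case False
    with insert show ?thesis
      by (intro exI[of _ "insert x T"]) fastforce
  qed
qed auto

text \<open>Splitting off a subset of size between \<open>u\<close> and \<open>2 * u\<close> leaves
  enough for the remaining \<open>r - 1\<close> ones, so there are \<open>r\<close> disjoint heavy
  subsets, and the cheapest costs at most the average. The induction keeps the cheaper of the new
  subset and the one found in the rest.\<close>

lemma cheap_heavy_subset:
  fixes s p :: "'i \<Rightarrow> int"
  assumes "1 \<le> r" "finite T" "\<And>i. i \<in> T \<Longrightarrow> s i \<le> u" "2 * int r * u \<le> sum s T" "0 \<le> u"
  shows "\<exists>X \<subseteq> T. u \<le> sum s X \<and> int r * sum p X \<le> sum p T"
  using assms
proof (induction r arbitrary: T rule: nat_induct_at_least)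
  case base
  then show ?case by (intro exI[of _ T]) auto
next
  case (Suc r)
  have "u \<le> sum s T"
  proof -
    have "1 * u \<le> 2 * int (Suc r) * u" by (rule mult_right_mono) (use Suc.prems in auto)
    with Suc.prems(3) show ?thesis by simp
  qed
  then obtain X where X: "X \<subseteq> T" "u \<le> sum s X" "sum s X \<le> 2 * u"
    using subset_sum_between[of T s u] Suc.prems by blast
  have sub: "sum f (T - X) = sum f T - sum f X" for f :: "'i \<Rightarrow> int"
    using Suc.prems(1) X(1) by (simp add: sum_diff)
  have "2 * int r * u \<le> sum s (T - X)"
    using X(3) Suc.prems(3) unfolding sub by (simp add: algebra_simps)
  then obtain Y where Y: "Y \<subseteq> T - X" "u \<le> sum s Y" "int r * sum p Y \<le> sum p (T - X)"
    using Suc.IH[of "T - X"] Suc.prems by auto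
  show ?case
  proof (cases "sum p X \<le> sum p Y")
    case True
    then have "int r * sum p X \<le> int r * sum p Y" by (intro mult_left_mono) auto
    then have "int (Suc r) * sum p X \<le> sum p T"
      using Y(3) unfolding sub by (simp add: algebra_simps)
    with X show ?thesis by blast
  next
    case False
    then have "int (Suc r) * sum p Y \<le> sum p T"
      using Y(3) unfolding sub by (simp add: algebra_simps)
    with Y show ?thesis by blast
  qed
qed

text \<open>The goal is to bring the load down to \<open>R - R / (2 r + 1)\<close>; all inequalities
  are multiplied out to stay within the integers.\<close>

lemma make_room_one:
  fixes s p :: "'i \<Rightarrow> int"
  assumes r: "1 \<le> r" and fin: "finite T" and s: "\<And>i. i \<in> T \<Longrightarrow> 0 \<le> s i"
    and R: "sum s T \<le> R" and small: "\<And>i. i \<in> T \<Longrightarrow> int r * p i \<le> P" and P: "sum p T \<le> P" "0 \<le> P"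
  shows "\<exists>X \<subseteq> T. (2 * int r + 1) * sum s (T - X) \<le> 2 * int r * R \<and> int r * sum p X \<le> P"
proof -
  let ?q = "2 * int r + 1"
  have sub: "sum s (T - X) = sum s T - sum s X" if "X \<subseteq> T" for X
    using fin that by (simp add: sum_diff)
  have "0 \<le> R" using R sum_nonneg[of T s] s by force
  have room: "?q * sum s (T - X) \<le> 2 * int r * R" if "X \<subseteq> T" "R \<le> ?q * sum s X" for X
  proof -
    have "?q * sum s T \<le> ?q * R" using R by (intro mult_left_mono) auto
    then show ?thesis using that by (simp add: sub algebra_simps)
  qed
  show ?thesis
  proof (cases "?q * sum s T \<le> 2 * int r * R")
    case True
    then show ?thesis using P(2) by (intro exI[of _ "{}"]) auto
  next
    case False
    show ?thesis
    proof (cases "\<exists>i \<in> T. R \<le> ?q * s i")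
      case True
      then obtain i where "i \<in> T" "R \<le> ?q * s i" by blast
      then show ?thesis using room[of "{i}"] small by (intro exI[of _ "{i}"]) auto
    next
      case all: False
      \<comment> \<open>Sizes are multiplied by \<open>?q\<close>, which turns the threshold
        \<open>R / (2 r + 1)\<close> of the groups into \<open>R\<close>.\<close>
      have "2 * int r * R \<le> (\<Sum>i \<in> T. ?q * s i)"
        using False by (simp add: sum_distrib_left[symmetric])
      then obtain X where "X \<subseteq> T" "R \<le> (\<Sum>i \<in> X. ?q * s i)" "int r * sum p X \<le> sum p T"
        using cheap_heavy_subset[OF r fin, of "\<lambda>i. ?q * s i" R p] all \<open>0 \<le> R\<close> by fastforce
      then show ?thesis using room[of X] P by (intro exI[of _ X]) (auto simp: sum_distrib_left[symmetric])
    qed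
  qed
qed

text \<open>Dimensions are treated one after another. Later removals can only lower the loads
  already treated, and every round loses profit at most \<open>P / r\<close>.\<close>

lemma make_room:
  fixes s :: "nat \<Rightarrow> 'i \<Rightarrow> int" and p :: "'i \<Rightarrow> int"
  assumes r: "1 \<le> r" and fin: "finite T" and s: "\<And>i j. i \<in> T \<Longrightarrow> j < m \<Longrightarrow> 0 \<le> s j i"
    and R: "\<And>j. j < m \<Longrightarrow> sum (s j) T \<le> R j" and p: "\<And>i. i \<in> T \<Longrightarrow> 0 \<le> p i"
    and small: "\<And>i. i \<in> T \<Longrightarrow> int r * p i \<le> P" and P: "sum p T \<le> P" "0 \<le> P"
  shows "\<exists>T' \<subseteq> T. (\<forall>j < m. (2 * int r + 1) * sum (s j) T' \<le> 2 * int r * R j) \<and>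
    int r * sum p T \<le> int r * sum p T' + int m * P"
  using s R
proof (induction m)
  case 0
  show ?case by (intro exI[of _ T]) auto
next
  case (Suc m)
  then obtain T1 where T1: "T1 \<subseteq> T" "\<forall>j < m. (2 * int r + 1) * sum (s j) T1 \<le> 2 * int r * R j"
    "int r * sum p T \<le> int r * sum p T1 + int m * P"
    by auto
  have fin1: "finite T1" using T1(1) fin finite_subset by blast
  have mono: "sum f A \<le> sum f B" if "A \<subseteq> B" "B \<subseteq> T" "\<And>i. i \<in> T \<Longrightarrow> 0 \<le> f i" for f :: "'i \<Rightarrow> int" and A B
    using that fin by (intro sum_mono2) (auto dest: finite_subset)
  have "\<exists>X \<subseteq> T1. (2 * int r + 1) * sum (s m) (T1 - X) \<le> 2 * int r * R m \<and> int r * sum p X \<le> P"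
  proof (rule make_room_one[OF r fin1])
    show "sum (s m) T1 \<le> R m"
      using mono[OF T1(1) order_refl, of "s m"] Suc.prems by force
    show "sum p T1 \<le> P"
      using mono[OF T1(1) order_refl, of p] p P by force
  qed (use Suc.prems T1 small P in auto)
  then obtain X where X: "X \<subseteq> T1" "(2 * int r + 1) * sum (s m) (T1 - X) \<le> 2 * int r * R m"
    "int r * sum p X \<le> P" by blast
  have "(2 * int r + 1) * sum (s j) (T1 - X) \<le> 2 * int r * R j" if "j < Suc m" for j
  proof (cases "j = m")
    case False
    have "sum (s j) (T1 - X) \<le> sum (s j) T1"
      using T1(1) Suc.prems that by (intro mono) auto
    then have "(2 * int r + 1) * sum (s j) (T1 - X) \<le> (2 * int r + 1) * sum (s j) T1"
      by (intro mult_left_mono) auto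
    also have "\<dots> \<le> 2 * int r * R j" using T1(2) False that by simp
    finally show ?thesis .
  qed (use X in simp)
  moreover have "int r * sum p T \<le> int r * sum p (T1 - X) + int (Suc m) * P"
  proof -
    have "int r * sum p (T1 - X) = int r * sum p T1 - int r * sum p X"
      using sum_diff[OF fin1 X(1), of p] by (simp add: right_diff_distrib)
    then show ?thesis using T1(3) X(3) by (simp add: algebra_simps)
  qed
  ultimately show ?case
    using T1(1) by (intro exI[of _ "T1 - X"]) auto
qed

section \<open>The approximation algorithm for the vector knapsack problem\<close>

text \<open>One way to pack an item: a tag, which the algorithm just hands back and which later
  names container and orientation, and the demand in every dimension.\<close>

type_synonym 't opt = "'t \<times> int list"

fun contrib :: "nat \<Rightarrow> 't opt option \<Rightarrow> int" where
  "contrib j None = 0"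
| "contrib j (Some a) = snd a ! j"

definition load :: "'t opt option list \<Rightarrow> nat \<Rightarrow> int" where
  "load c j = (\<Sum>i<length c. contrib j (c ! i))"

definition gain :: "(int \<times> 't opt list) list \<Rightarrow> 't opt option list \<Rightarrow> int" where
  "gain its c = (\<Sum>i<length its. if c ! i = None then 0 else fst (its ! i))"

definition admissible :: "(int \<times> 't opt list) list \<Rightarrow> 't opt option list \<Rightarrow> bool" where
  "admissible its c \<longleftrightarrow> length c = length its \<and>
     (\<forall>i < length its. \<forall>a. c ! i = Some a \<longrightarrow> a \<in> set (snd (its ! i)))"

definition fitting :: "(int \<times> 't opt list) list \<Rightarrow> int list \<Rightarrow> 't opt option list \<Rightarrow> bool" where
  "fitting its cap c \<longleftrightarrow> admissible its c \<and> (\<forall>j < length cap. load c j \<le> cap ! j)"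

definition wf_items :: "nat \<Rightarrow> (int \<times> 't opt list) list \<Rightarrow> bool" where
  "wf_items m its \<longleftrightarrow> (\<forall>it \<in> set its. 0 \<le> fst it \<and>
     (\<forall>a \<in> set (snd it). length (snd a) = m \<and> (\<forall>b \<in> set (snd a). 0 \<le> b)))"

text \<open>The quotient is the ceiling of \<open>s * N / R\<close>. A size above \<open>R\<close>
  becomes \<open>N + 1\<close>, beyond the cap \<open>N\<close> of the dynamic program, so that such
  an option is never taken.\<close>

definition scale :: "int \<Rightarrow> int \<Rightarrow> int \<Rightarrow> int" where
  "scale N R s = (if R < s then N + 1 else (s * N + R - 1) div R)"

text \<open>If \<open>R = 0\<close> and \<open>s \<le> R\<close>, then \<open>s = 0\<close> and the quotient is \<open>0\<close> as it should be.\<close>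

lemma scale_nonneg:
  assumes "0 \<le> s" "0 \<le> N" shows "0 \<le> scale N R s"
proof (cases "0 < R")
  case True
  with assms have "0 < s * N + R" by (intro add_nonneg_pos) auto
  with True assms show ?thesis by (simp add: scale_def pos_imp_zdiv_nonneg_iff)
next
  case False
  with assms have "R < s \<or> R = 0" by linarith
  with assms show ?thesis by (auto simp: scale_def)
qed

text \<open>Summed over the items and divided by \<open>N\<close>, this shows that rounded sizes of
  total at most \<open>N\<close> come from true sizes of total at most \<open>R\<close>.\<close>

lemma scale_lower:
  assumes "0 \<le> s" "0 \<le> R" "scale N R s \<le> N"
  shows "N * s \<le> R * scale N R s"
proof (cases "R = 0")
  case True
  then show ?thesis using assms by (auto simp: scale_def split: if_splits)
next
  case False
  then have R: "0 < R" "s \<le> R" using assms by (auto simp: scale_def split: if_splits)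
  let ?a = "s * N + R - 1"
  have "?a = R * (?a div R) + ?a mod R" by simp
  moreover have "?a mod R < R" using R by simp
  ultimately have "s * N \<le> R * (?a div R)" by linarith
  then show ?thesis using R by (simp add: scale_def mult.commute)
qed

text \<open>Rounding up costs at most one unit, that is \<open>R / N\<close> in terms of the true
  size.\<close>

lemma scale_upper:
  assumes "0 \<le> s" "s \<le> R" "0 \<le> N"
  shows "R * scale N R s \<le> s * N + R"
proof (cases "R = 0")
  case False
  then have R: "0 < R" using assms by simp
  let ?a = "s * N + R - 1"
  have "?a = R * (?a div R) + ?a mod R" by simp
  moreover have "0 \<le> ?a mod R" using R by simp
  ultimately have "R * (?a div R) \<le> ?a" by linarith
  then show ?thesis using assms by (simp add: scale_def)
qed (use assms in auto)

definition vscale :: "int \<Rightarrow> int list \<Rightarrow> int list \<Rightarrow> int list" where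
  "vscale N Rs v = map (\<lambda>(R, s). scale N R s) (zip Rs v)"

definition zero_vec :: "int list \<Rightarrow> int list" where
  "zero_vec cap = map (\<lambda>_. 0) cap"

lemma zero_vec_simps [simp]: "length (zero_vec cap) = length cap" "j < length cap \<Longrightarrow> zero_vec cap ! j = 0"
  "a \<in> set (zero_vec cap) \<Longrightarrow> a = 0"
  by (auto simp: zero_vec_def)

text \<open>A guessed item has a single move. Its load is zero because the guess is already
  subtracted in the residual capacities. Any other item may stay out or take any of its
  options.\<close>

definition moves :: "int \<Rightarrow> int list \<Rightarrow> (int \<times> 't opt list) \<times> 't opt option \<Rightarrow> 't opt option state list" where
  "moves N R x = (case snd x of
     Some a \<Rightarrow> [(fst (fst x), zero_vec R, Some a)]
   | None \<Rightarrow> (0, zero_vec R, None) # map (\<lambda>a. (fst (fst x), vscale N R (snd a), Some a)) (snd (fst x)))"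

definition residual :: "int list \<Rightarrow> 't opt option list \<Rightarrow> int list" where
  "residual cap c = fold (\<lambda>g R. case g of None \<Rightarrow> R | Some a \<Rightarrow> map (\<lambda>(x, y). x - y) (zip R (snd a))) c cap"

text \<open>Each round keeps a guess or sets one entry of it, so all assignments of at most
  \<open>g\<close> items occur. Duplicates are tolerated: for constant \<open>g\<close> the list
  still has polynomial length.\<close>

primrec guesses :: "(int \<times> 't opt list) list \<Rightarrow> nat \<Rightarrow> 't opt option list list" where
  "guesses its 0 = [map (\<lambda>_. None) its]"
| "guesses its (Suc g) = guesses its g @
     concat (map (\<lambda>c. concat (map (\<lambda>p. map (\<lambda>a. c[fst p := Some a]) (snd (snd p))) (List.enumerate 0 its)))
       (guesses its g))"

text \<open>The number of units per residual capacity: if each item wastes at most one unit, all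
  items together waste at most a fraction \<open>1 / (2 r + 1)\<close>.\<close>

definition grid :: "'a list \<Rightarrow> nat \<Rightarrow> int" where
  "grid its r = int (length its) * (2 * int r + 1)"

definition candidates :: "nat \<Rightarrow> (int \<times> 't opt list) list \<Rightarrow> int list \<Rightarrow> 't opt option list \<Rightarrow>
    't opt option list state list" where
  "candidates r its cap c =
     (let R = residual cap c; N = grid its r
      in if \<forall>b \<in> set R. 0 \<le> b then dp N (zero_vec R) (map (moves N R) (zip its c)) else [])"

definition better :: "'c state \<Rightarrow> 'c state \<Rightarrow> 'c state" where
  "better s b = (if fst b < fst s then s else b)"

lemma fold_better:
  "fold better xs b \<in> insert b (set xs)"
  "s \<in> insert b (set xs) \<Longrightarrow> fst s \<le> fst (fold better xs b)"
proof (induction xs arbitrary: b s)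
  case (Cons x xs)
  {
    case 1
    show ?case using Cons.IH(1)[of "better x b"] by (auto simp: better_def split: if_splits)
  next
    case 2
    have "fst b \<le> fst (better x b)" "fst x \<le> fst (better x b)" by (simp_all add: better_def)
    moreover have "fst (better x b) \<le> fst (fold better xs (better x b))"
      by (rule Cons.IH(2)) simp
    moreover have "fst s \<le> fst (fold better xs (better x b))" if "s \<in> set xs"
      by (rule Cons.IH(2)) (simp add: that)
    ultimately show ?case using 2 by (auto intro: order_trans)
  }
qed simp_all

definition solve :: "nat \<Rightarrow> (int \<times> 't opt list) list \<Rightarrow> int list \<Rightarrow> 't opt option list" where
  "solve r its cap = snd (snd (fold better (concat (map (candidates r its cap) (guesses its r))) (0, zero_vec cap, map (\<lambda>_. None) its)))"

section \<open>Guesses and residual capacities\<close>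

lemma set_guesses_Suc:
  "c \<in> set (guesses its (Suc g)) \<longleftrightarrow> c \<in> set (guesses its g) \<or> (\<exists>c' \<in> set (guesses its g).
      \<exists>i < length its. \<exists>a \<in> set (snd (its ! i)). c = c'[i := Some a])"
proof -
  have "set (List.enumerate 0 its) = (\<lambda>i. (i, its ! i)) ` {..<length its}"
    by (auto simp: in_set_enumerate_eq image_iff prod_eq_iff)
  then show ?thesis
    by (auto simp: image_iff simp del: split_paired_Ex split_paired_All)
qed

lemma guesses_admissible: "c \<in> set (guesses its g) \<Longrightarrow> admissible its c"
proof (induction g arbitrary: c)
  case (Suc g)
  from Suc.prems consider "c \<in> set (guesses its g)"
    | c' i a where "c' \<in> set (guesses its g)" "i < length its" "a \<in> set (snd (its ! i))" "c = c'[i := Some a]"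
    unfolding set_guesses_Suc by blast
  then show ?case
  proof cases
    case 2
    then show ?thesis using Suc.IH[OF 2(1)] unfolding admissible_def
      by (metis length_list_update nth_list_update_eq nth_list_update_neq option.inject)
  qed (rule Suc.IH)
qed (auto simp: admissible_def)

lemma guesses_complete:
  assumes "admissible its c" "card {i. i < length its \<and> c ! i \<noteq> None} \<le> g"
  shows "c \<in> set (guesses its g)"
  using assms
proof (induction g arbitrary: c)
  case 0
  then have "{i. i < length its \<and> c ! i \<noteq> None} = {}" by simp
  then have "\<forall>i < length its. c ! i = None" by blast
  then have "c = map (\<lambda>_. None) its"
    using 0 by (intro nth_equalityI) (auto simp: admissible_def)
  then show ?case by simp
next
  case (Suc g)
  let ?S = "\<lambda>c. {i. i < length its \<and> c ! i \<noteq> None}"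
  show ?case
  proof (cases "?S c = {}")
    case True
    then have "card (?S c) \<le> g" by (simp only: card.empty)
    from Suc.IH[OF Suc.prems(1) this] show ?thesis by simp
  next
    case False
    then obtain i a where i: "i < length its" "c ! i = Some a" by auto
    let ?c = "c[i := None]"
    have len: "length c = length its" using Suc.prems by (simp add: admissible_def)
    have S: "?S ?c = ?S c - {i}" using i len by (auto simp: nth_list_update)
    have "card (?S ?c) \<le> g" unfolding S using Suc.prems(2) i by (simp add: card_Diff_singleton)
    moreover have "admissible its ?c"
      using Suc.prems(1) i len by (auto simp: admissible_def nth_list_update split: if_splits)
    ultimately have c: "?c \<in> set (guesses its g)" using Suc.IH by blast
    have "c = ?c[i := Some a]" using i(2) by (metis list_update_id list_update_overwrite)
    moreover have "a \<in> set (snd (its ! i))" using Suc.prems(1) i unfolding admissible_def by blast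
    ultimately show ?thesis using c i(1) unfolding set_guesses_Suc by blast
  qed
qed

lemma residual_nth:
  assumes "\<forall>g \<in> set c. \<forall>a. g = Some a \<longrightarrow> length (snd a) = length cap"
  shows "length (residual cap c) = length cap \<and>
    (\<forall>j < length cap. residual cap c ! j = cap ! j - load c j)"
  using assms
proof (induction c arbitrary: cap)
  case (Cons g c)
  let ?cap = "case g of None \<Rightarrow> cap | Some a \<Rightarrow> map (\<lambda>(x, y). x - y) (zip cap (snd a))"
  have cap: "length ?cap = length cap" "\<And>j. j < length cap \<Longrightarrow> ?cap ! j = cap ! j - contrib j g"
    using Cons.prems by (auto split: option.split)
  have "residual cap (g # c) = residual ?cap c" by (simp add: residual_def)
  moreover have "load (g # c) j = contrib j g + load c j" for j
    by (simp add: load_def sum.lessThan_Suc_shift del: sum.lessThan_Suc)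
  ultimately show ?case
    using Cons.IH[of ?cap] Cons.prems cap by simp
qed (simp add: residual_def load_def)

section \<open>Soundness and approximation guarantee for a well-formed knapsack instance\<close>

context
  fixes its :: "(int \<times> 't opt list) list" and cap :: "int list" and r :: nat
  assumes wf: "wf_items (length cap) its"
begin

lemma grid_nonneg: "0 \<le> grid its r"
  by (simp add: grid_def)

lemma item_wf:
  assumes "i < length its"
  shows "0 \<le> fst (its ! i)" "a \<in> set (snd (its ! i)) \<Longrightarrow> length (snd a) = length cap"
    "a \<in> set (snd (its ! i)) \<Longrightarrow> j < length cap \<Longrightarrow> 0 \<le> snd a ! j"
proof -
  have *: "0 \<le> fst (its ! i) \<and> (\<forall>a \<in> set (snd (its ! i)). length (snd a) = length cap \<and> (\<forall>b \<in> set (snd a). 0 \<le> b))"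
    using wf nth_mem[OF assms] unfolding wf_items_def by (rule bspec)
  then show "0 \<le> fst (its ! i)" ..
  show len: "length (snd a) = length cap" if "a \<in> set (snd (its ! i))" for a
    using * that by blast
  show "0 \<le> snd a ! j" if "a \<in> set (snd (its ! i))" "j < length cap" for a
    using * that len[OF that(1)] nth_mem[of j "snd a"] by simp
qed

lemma residual_admissible:
  assumes "admissible its c"
  shows "length (residual cap c) = length cap"
    "j < length cap \<Longrightarrow> residual cap c ! j = cap ! j - load c j"
proof -
  have "\<forall>g \<in> set c. \<forall>a. g = Some a \<longrightarrow> length (snd a) = length cap"
    using assms item_wf(2) unfolding admissible_def by (metis in_set_conv_nth)
  from residual_nth[OF this] show "length (residual cap c) = length cap"
    "j < length cap \<Longrightarrow> residual cap c ! j = cap ! j - load c j" by auto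
qed

lemma moves_wf:
  assumes "length R = length cap" "x \<in> set (zip its c)" "s \<in> set (moves (grid its r) R x)"
  shows "length (fst (snd s)) = length R \<and> (\<forall>b \<in> set (fst (snd s)). 0 \<le> b)"
proof -
  have x: "fst x \<in> set its" using assms(2) by (metis set_zip_leftD surjective_pairing)
  have "length (vscale (grid its r) R (snd a)) = length R \<and> (\<forall>b \<in> set (vscale (grid its r) R (snd a)). 0 \<le> b)"
    if a: "a \<in> set (snd (fst x))" for a
  proof
    have a': "length (snd a) = length cap" "\<forall>b \<in> set (snd a). 0 \<le> b"
      using wf x a by (auto simp: wf_items_def)
    then show "length (vscale (grid its r) R (snd a)) = length R" using assms(1) by (simp add: vscale_def)
    show "\<forall>b \<in> set (vscale (grid its r) R (snd a)). 0 \<le> b"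
      using a'(2) grid_nonneg
      by (auto simp: vscale_def intro!: scale_nonneg elim!: in_set_zipE)
  qed
  moreover have "length (zero_vec R) = length R \<and> (\<forall>b \<in> set (zero_vec R). 0 \<le> b)"
    by (simp add: zero_vec_def)
  moreover have "fst (snd s) = zero_vec R \<or> (\<exists>a \<in> set (snd (fst x)). fst (snd s) = vscale (grid its r) R (snd a))"
    using assms(3) by (cases "snd x") (force simp: moves_def)+
  ultimately show ?thesis by metis
qed

text \<open>Item by item, \<open>grid\<close> times the true load added to the guess is at most
  \<open>R\<close> times the rounded load. Since the rounded loads sum to at most
  \<open>grid\<close>, the added true load is at most \<open>R\<close>.\<close>

lemma candidates_fitting:
  assumes c: "c \<in> set (guesses its r)" and s: "s \<in> set (candidates r its cap c)"
  shows "fitting its cap (snd (snd s)) \<and> fst s = gain its (snd (snd s))"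
proof -
  note adm = guesses_admissible[OF c]
  define R where "R = residual cap c"
  note res = residual_admissible[OF adm, folded R_def]
  let ?mss = "map (moves (grid its r) R) (zip its c)"
  from s have R: "\<forall>b \<in> set R. 0 \<le> b" and dp: "s \<in> set (dp (grid its r) (zero_vec R) ?mss)"
    by (simp_all add: candidates_def Let_def R_def split: if_splits)
  have z: "\<forall>a \<in> set (zero_vec R). a \<le> (grid its r)" using grid_nonneg by (simp add: zero_vec_def)
  from dp_sound[OF dp z] obtain \<sigma> where \<sigma>: "selection \<sigma> ?mss" "s = (\<Sum>m\<leftarrow>\<sigma>. fst m, vsum (zero_vec R) \<sigma>, map (snd \<circ> snd) \<sigma>)"
      and le: "\<forall>a \<in> set (vsum (zero_vec R) \<sigma>). a \<le> (grid its r)"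
    by (elim conjE exE) simp
  have len: "length c = length its" "length \<sigma> = length its"
    using adm \<sigma>(1) by (auto simp: admissible_def dest: list_all2_lengthD)
  have mv: "\<sigma> ! i \<in> set (moves (grid its r) R (its ! i, c ! i))" if "i < length its" for i
    using list_all2_nthD[OF \<sigma>(1), of i] that len by simp
  have wfm: "\<forall>m \<in> set \<sigma>. length (fst (snd m)) = length R \<and> (\<forall>a \<in> set (fst (snd m)). 0 \<le> a)"
    using selection_member[OF \<sigma>(1)] moves_wf[OF res(1)] by fastforce
  let ?c = "map (snd \<circ> snd) \<sigma>"
  note its = item_wf
  have adm': "admissible its ?c"
    using adm mv len by (fastforce simp: admissible_def moves_def split: option.splits)
  have "load ?c j \<le> cap ! j" if j: "j < length cap" for j
  proof -
    have R0: "0 \<le> R ! j" using R j res(1) by simp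
    have sum: "(\<Sum>i<length its. fst (snd (\<sigma> ! i)) ! j) \<le> (grid its r)"
      using nth_vsum[of \<sigma> "zero_vec R" j] wfm j res(1) le len nth_mem[of j "vsum (zero_vec R) \<sigma>"]
        length_vsum[of \<sigma> "zero_vec R"] by simp
    have nonneg: "0 \<le> fst (snd (\<sigma> ! i)) ! j" if "i < length its" for i
      using wfm len that j res(1) by (metis nth_mem)
    \<comment> \<open>\<open>scale_lower\<close> asks for each rounded size to be within the cap;
      this follows from the bound on their sum because all summands are nonnegative.\<close>
    have comp: "fst (snd (\<sigma> ! i)) ! j \<le> (grid its r)" if "i < length its" for i
    proof -
      have "fst (snd (\<sigma> ! i)) ! j \<le> (\<Sum>i<length its. fst (snd (\<sigma> ! i)) ! j)"
        using nonneg that by (intro member_le_sum) auto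
      with sum show ?thesis by simp
    qed
    \<comment> \<open>For guessed items the left side is 0, since they keep the option that the
      guess gave them.\<close>
    have step: "(grid its r) * (contrib j (snd (snd (\<sigma> ! i))) - contrib j (c ! i)) \<le> R ! j * (fst (snd (\<sigma> ! i)) ! j)"
      if i: "i < length its" for i
    proof (cases "c ! i")
      case (Some a)
      then show ?thesis using mv[OF i] j res(1) by (simp add: moves_def)
    next
      case None
      then consider "\<sigma> ! i = (0, zero_vec R, None)"
        | a where "a \<in> set (snd (its ! i))" "\<sigma> ! i = (fst (its ! i), vscale (grid its r) R (snd a), Some a)"
        using mv[OF i] by (auto simp: moves_def)
      then show ?thesis
      proof cases
        case 1
        then show ?thesis using None j res(1) by simp
      next
        case (2 a)
        have v: "vscale (grid its r) R (snd a) ! j = scale (grid its r) (R ! j) (snd a ! j)"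
          using its(2)[OF i 2(1)] j res(1) by (simp add: vscale_def)
        show ?thesis
          using scale_lower[OF its(3)[OF i 2(1) j] R0] comp[OF i] 2 None by (simp add: v)
      qed
    qed
    have "(grid its r) * (load ?c j - load c j) =
        (\<Sum>i<length its. (grid its r) * (contrib j (snd (snd (\<sigma> ! i))) - contrib j (c ! i)))"
      by (simp add: load_def len sum_subtractf sum_distrib_left[symmetric])
    also have "\<dots> \<le> (\<Sum>i<length its. R ! j * (fst (snd (\<sigma> ! i)) ! j))"
      using step by (intro sum_mono) auto
    also have "\<dots> \<le> R ! j * (grid its r)"
      using sum R0 by (simp add: sum_distrib_left[symmetric] mult_left_mono)
    finally have "(grid its r) * (load ?c j - load c j) \<le> (grid its r) * (R ! j)" by (simp add: mult.commute)
    \<comment> \<open>The division by \<open>grid\<close> fails only if there are no items, and then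
      all loads are 0.\<close>
    moreover have "0 < (grid its r) \<or> length its = 0" by (auto simp: grid_def)
    ultimately show ?thesis
      using res(2)[OF j] R0 by (auto simp: load_def len)
  qed
  moreover have "(\<Sum>m\<leftarrow>\<sigma>. fst m) = gain its ?c"
  proof -
    have "fst (\<sigma> ! i) = (if ?c ! i = None then 0 else fst (its ! i))" if "i < length its" for i
      using mv[OF that] that len by (auto simp: moves_def split: option.splits)
    then show ?thesis
      by (simp add: gain_def sum_list_sum_nth len atLeast0LessThan)
  qed
  ultimately show ?thesis using adm' \<sigma>(2) by (simp add: fitting_def)
qed

context
  assumes cap: "\<forall>b \<in> set cap. 0 \<le> b"
begin

lemma none_fitting: "fitting its cap (map (\<lambda>_. None) its)" "gain its (map (\<lambda>_. None) its) = 0"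
  using cap by (simp_all add: fitting_def admissible_def load_def gain_def)

lemma solve_state:
  "\<exists>s :: 't opt option list state. solve r its cap = snd (snd s) \<and> fitting its cap (snd (snd s)) \<and> fst s = gain its (snd (snd s)) \<and>
    (\<forall>c \<in> set (guesses its r). \<forall>s' \<in> set (candidates r its cap c). fst s' \<le> fst s)"
proof -
  let ?xs = "concat (map (candidates r its cap) (guesses its r))"
  let ?b = "(0, zero_vec cap, map (\<lambda>_. None) its) :: 't opt option list state"
  define s where "s = fold better ?xs ?b"
  have best: "s \<in> insert ?b (set ?xs)" "\<And>s'. s' \<in> set ?xs \<Longrightarrow> fst s' \<le> fst s"
    unfolding s_def by (rule fold_better(1), rule fold_better(2), rule insertI2)
  from best(1) have "fitting its cap (snd (snd s)) \<and> fst s = gain its (snd (snd s))"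
  proof
    assume "s = ?b"
    then show ?thesis using none_fitting by simp
  next
    assume "s \<in> set ?xs"
    then obtain c where "c \<in> set (guesses its r)" "s \<in> set (candidates r its cap c)"
      unfolding set_concat set_map by blast
    then show ?thesis by (rule candidates_fitting)
  qed
  moreover have "fst s' \<le> fst s" if "c \<in> set (guesses its r)" "s' \<in> set (candidates r its cap c)" for c s'
    using that by (intro best(2)) (unfold set_concat set_map, blast)
  moreover have "solve r its cap = snd (snd s)" by (simp add: solve_def s_def)
  ultimately show ?thesis by (intro exI[of _ s] conjI ballI) simp_all
qed

theorem solve_fitting: "fitting its cap (solve r its cap)"
  using solve_state by auto

text \<open>The given \<open>c\<close> produces a competitor inside one of the dynamic programs: its
  expensive items form the guess, and its other items, thinned out by \<open>make_room\<close>,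
  remain within the cap after rounding. The factor \<open>r - length cap\<close> reflects a loss of
  \<open>P / r\<close> per dimension.\<close>

theorem solve_approximates:
  assumes r: "1 \<le> r" and fit: "fitting its cap c"
  shows "(int r - int (length cap)) * gain its c \<le> int r * gain its (solve r its cap)"
proof -
  define n where "n = length its"
  define S where "S = {i. i < n \<and> c ! i \<noteq> None}"
  define p where "p i = fst (its ! i)" for i
  define s where "s j i = contrib j (c ! i)" for j i
  define P where "P = sum p S"
  define G where "G = {i \<in> S. P < int r * p i}"
  have adm: "admissible its c" and lenc: "length c = n"
    using fit by (auto simp: fitting_def admissible_def n_def)
  have admD: "a \<in> set (snd (its ! i))" if "i < n" "c ! i = Some a" for i a
    using adm that unfolding admissible_def n_def by blast
  have finS: "finite S" by (simp add: S_def)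
  have p: "0 \<le> p i" if "i < n" for i
    using wf that by (simp add: wf_items_def n_def p_def)
  have P: "0 \<le> P" unfolding P_def by (rule sum_nonneg) (auto simp: S_def p)
  have gainP: "gain its c = P"
  proof -
    have "gain its c = (\<Sum>i<n. if i \<in> S then p i else 0)"
      unfolding gain_def n_def p_def by (rule sum.cong) (auto simp: S_def n_def)
    also have "\<dots> = P" unfolding P_def by (rule sum_if_member) (auto simp: S_def)
    finally show ?thesis .
  qed
  have sumC: "(\<Sum>i<n. if i \<in> A then s j i else 0) = sum (s j) A" if "A \<subseteq> S" for A j
    by (rule sum_if_member) (use that in \<open>auto simp: S_def\<close>)
  have vec: "length (snd a) = length cap" "j < length cap \<Longrightarrow> 0 \<le> snd a ! j"
    if "i < n" "a \<in> set (snd (its ! i))" for i a j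
    using item_wf that by (auto simp: n_def)
  have s: "0 \<le> s j i" if "i < n" "j < length cap" for i j
    using admD that vec(2) by (cases "c ! i") (auto simp: s_def)
  have cardG: "card G \<le> r"
  proof (cases "G = {}")
    case False
    have finG: "finite G" using finS by (simp add: G_def)
    have "int (card G) * P = (\<Sum>i \<in> G. P)" by simp
    also have "\<dots> < (\<Sum>i \<in> G. int r * p i)"
      using False finG by (intro sum_strict_mono) (auto simp: G_def)
    also have "\<dots> \<le> int r * P"
      unfolding P_def sum_distrib_left[symmetric]
      using finS p by (intro mult_left_mono sum_mono2) (auto simp: G_def S_def)
    finally have "int (card G) < int r" using P by (simp add: mult_less_cancel_right)
    then show ?thesis by simp
  qed simp
  define g where "g = map (\<lambda>i. if i \<in> G then c ! i else None) [0..<n]"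
  have g_nth: "g ! i = (if i \<in> G then c ! i else None)" if "i < n" for i
    using that by (simp add: g_def)
  have leng: "length g = n" by (simp add: g_def)
  have g: "g \<in> set (guesses its r)"
  proof (rule guesses_complete)
    show "admissible its g" using adm leng by (auto simp: admissible_def g_nth n_def split: if_splits)
    have "{i. i < length its \<and> g ! i \<noteq> None} = G"
      by (auto simp: g_nth n_def[symmetric] G_def S_def split: if_splits)
    then show "card {i. i < length its \<and> g ! i \<noteq> None} \<le> r" using cardG by simp
  qed
  define R where "R = residual cap g"
  note res = residual_admissible[OF guesses_admissible[OF g], folded R_def]
  have GS: "G \<subseteq> S" by (auto simp: G_def)
  have loadg: "load g j = sum (s j) G" for j
  proof -
    have "load g j = (\<Sum>i<n. if i \<in> G then s j i else 0)"
      unfolding load_def leng by (rule sum.cong) (auto simp: g_nth s_def)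
    then show ?thesis using sumC[OF GS] by simp
  qed
  have loadc: "load c j = sum (s j) S" for j
  proof -
    have "load c j = (\<Sum>i<n. if i \<in> S then s j i else 0)"
      unfolding load_def lenc by (rule sum.cong) (auto simp: S_def s_def simp del: not_None_eq not_Some_eq)
    then show ?thesis using sumC[OF order_refl] by simp
  qed
  let ?T = "S - G"
  have finT: "finite ?T" using finS by simp
  have diff: "sum f ?T = sum f S - sum f G" for f :: "nat \<Rightarrow> int"
    using finS GS by (simp add: sum_diff)
  have RT: "sum (s j) ?T \<le> R ! j" if "j < length cap" for j
    using fit that res(2)[OF that] by (simp add: diff loadg loadc fitting_def)
  have "\<exists>T' \<subseteq> ?T. (\<forall>j < length cap. (2 * int r + 1) * sum (s j) T' \<le> 2 * int r * R ! j) \<and>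
    int r * sum p ?T \<le> int r * sum p T' + int (length cap) * P"
  proof (rule make_room[OF r finT])
    have "0 \<le> sum p G" by (rule sum_nonneg) (auto simp: G_def S_def p)
    then show "sum p ?T \<le> P" by (simp add: diff P_def)
  qed (use s RT p P in \<open>auto simp: S_def G_def\<close>)
  then obtain T' where T': "T' \<subseteq> ?T"
    "\<And>j. j < length cap \<Longrightarrow> (2 * int r + 1) * sum (s j) T' \<le> 2 * int r * R ! j"
    "int r * sum p ?T \<le> int r * sum p T' + int (length cap) * P" by blast
  have Rnonneg: "0 \<le> R ! j" if "j < length cap" for j
  proof -
    have "0 \<le> sum (s j) ?T" by (rule sum_nonneg) (use s that in \<open>auto simp: S_def\<close>)
    with RT[OF that] show ?thesis by simp
  qed
  then have Rn: "\<forall>b \<in> set R. 0 \<le> b" using res(1) by (auto simp: in_set_conv_nth)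
  \<comment> \<open>The competitor's moves: guessed items at no load, survivors of the thinning at
    rounded load, discarded items left out.\<close>
  define mv where "mv i = (if i \<in> G then (p i, zero_vec R, c ! i)
    else if i \<in> T' then (p i, vscale (grid its r) R (snd (the (c ! i))), c ! i) else (0, zero_vec R, None))" for i
  define \<sigma> where "\<sigma> = map mv [0..<n]"
  let ?mss = "map (moves (grid its r) R) (zip its g)"
  have sel: "selection \<sigma> ?mss"
  proof (rule list_all2_all_nthI)
    show "length \<sigma> = length ?mss" by (simp add: \<sigma>_def n_def leng)
    fix i assume "i < length \<sigma>"
    then have i: "i < n" by (simp add: \<sigma>_def)
    have "mv i \<in> set (moves (grid its r) R (its ! i, g ! i))"
    proof (cases "i \<in> G")
      case True
      then obtain a where "c ! i = Some a" by (auto simp: G_def S_def)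
      then show ?thesis using True i by (simp add: mv_def moves_def g_nth p_def)
    next
      case False
      show ?thesis
      proof (cases "i \<in> T'")
        case True
        then have "c ! i \<noteq> None" using T'(1) by (auto simp: S_def)
        then obtain a where "c ! i = Some a" by blast
        moreover from this have "a \<in> set (snd (its ! i))" using admD i by blast
        ultimately show ?thesis using True False i by (auto simp: mv_def moves_def g_nth p_def)
      qed (use False i in \<open>simp add: mv_def moves_def g_nth\<close>)
    qed
    then show "\<sigma> ! i \<in> set (?mss ! i)" using i leng by (simp add: \<sigma>_def n_def)
  qed
  have wfm: "\<forall>m \<in> set \<sigma>. length (fst (snd m)) = length (zero_vec R) \<and> (\<forall>a \<in> set (fst (snd m)). 0 \<le> a)"
    using selection_member[OF sel] moves_wf[OF res(1)] by fastforce
  have T'n: "T' \<subseteq> {..<n}" using T'(1) by (auto simp: S_def)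
  have le: "\<forall>a \<in> set (vsum (zero_vec R) \<sigma>). a \<le> (grid its r)"
  proof
    fix a assume "a \<in> set (vsum (zero_vec R) \<sigma>)"
    then obtain j where j: "j < length cap" "a = vsum (zero_vec R) \<sigma> ! j"
      using length_vsum[of \<sigma> "zero_vec R"] wfm res(1) by (auto simp: in_set_conv_nth)
    have "fst (snd (mv i)) ! j = (if i \<in> T' then scale (grid its r) (R ! j) (s j i) else 0)" if "i < n" for i
    proof (cases "i \<in> T'")
      case True
      then have "c ! i \<noteq> None" and "i \<notin> G" using T'(1) by (auto simp: S_def)
      then obtain a where a: "c ! i = Some a" by blast
      then have "a \<in> set (snd (its ! i))" using admD that by blast
      then show ?thesis
        using True a vec(1) that j(1) res(1) \<open>i \<notin> G\<close> by (simp add: mv_def vscale_def s_def)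
    qed (use j(1) res(1) in \<open>simp add: mv_def\<close>)
    then have "(\<Sum>i<n. fst (snd (\<sigma> ! i)) ! j) = (\<Sum>i<n. if i \<in> T' then scale (grid its r) (R ! j) (s j i) else 0)"
      by (intro sum.cong) (auto simp: \<sigma>_def)
    also have "\<dots> = (\<Sum>i \<in> T'. scale (grid its r) (R ! j) (s j i))"
      by (rule sum_if_member[OF T'n])
    finally have a: "a = (\<Sum>i \<in> T'. scale (grid its r) (R ! j) (s j i))"
      using nth_vsum[of \<sigma> "zero_vec R" j] wfm j res(1) by (simp add: \<sigma>_def)
    have finT': "finite T'" using T'n finite_subset by blast
    have sR: "s j i \<le> R ! j" if "i \<in> T'" for i
    proof -
      have "s j i \<le> sum (s j) ?T"
        using that T'(1) finT s j(1) by (intro member_le_sum) (auto simp: S_def)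
      with RT[OF j(1)] show ?thesis by simp
    qed
    have s0: "0 \<le> s j i" if "i \<in> T'" for i using that T'n s j(1) by auto
    show "a \<le> (grid its r)"
    proof (cases "R ! j = 0")
      case True
      then have "scale (grid its r) (R ! j) (s j i) = 0" if "i \<in> T'" for i
        using sR[OF that] s0[OF that] by (simp add: scale_def)
      then show ?thesis using a grid_nonneg by simp
    next
      case False
      then have Rpos: "0 < R ! j" using Rnonneg j(1) by force
      have "R ! j * a = (\<Sum>i \<in> T'. R ! j * scale (grid its r) (R ! j) (s j i))"
        by (simp add: a sum_distrib_left)
      also have "\<dots> \<le> (\<Sum>i \<in> T'. s j i * (grid its r) + R ! j)"
        using s0 sR grid_nonneg by (intro sum_mono scale_upper) auto
      also have "\<dots> = int n * ((2 * int r + 1) * sum (s j) T') + int (card T') * R ! j"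
        by (simp add: sum.distrib sum_distrib_right[symmetric] grid_def n_def)
      \<comment> \<open>The first summand is bounded by the guarantee of \<open>make_room\<close>,
        the second is the rounding loss of one unit per item; together they are exactly
        \<open>R ! j * grid its r\<close>.\<close>
      also have "\<dots> \<le> int n * (2 * int r * R ! j) + int n * R ! j"
      proof (intro add_mono mult_left_mono mult_right_mono)
        show "int (card T') \<le> int n" using card_mono[OF _ T'n] by simp
      qed (use T'(2)[OF j(1)] Rpos in auto)
      also have "\<dots> = R ! j * (grid its r)" by (simp add: grid_def n_def algebra_simps)
      finally show ?thesis using Rpos by simp
    qed
  qed
  from dp_complete[OF sel le wfm] obtain t where
    t: "t \<in> set (dp (grid its r) (zero_vec R) ?mss)" "(\<Sum>m\<leftarrow>\<sigma>. fst m) \<le> fst t" by blast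
  have "t \<in> set (candidates r its cap g)"
    using t(1) Rn by (simp add: candidates_def Let_def R_def)
  with solve_state g have "fst t \<le> gain its (solve r its cap)" by auto
  moreover have "(\<Sum>m\<leftarrow>\<sigma>. fst m) = sum p G + sum p T'"
  proof -
    have "(\<Sum>m\<leftarrow>\<sigma>. fst m) = (\<Sum>i<n. fst (mv i))"
      by (simp add: \<sigma>_def sum_list_sum_nth atLeast0LessThan)
    also have "\<dots> = (\<Sum>i<n. if i \<in> G \<union> T' then p i else 0)"
      by (rule sum.cong) (auto simp: mv_def)
    also have "\<dots> = sum p (G \<union> T')" by (rule sum_if_member) (use T'n GS in \<open>auto simp: S_def\<close>)
    also have "sum p (G \<union> T') = sum p G + sum p T'"
      using T' finT finS GS by (intro sum.union_disjoint) (auto dest: finite_subset)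
    finally show ?thesis .
  qed
  ultimately have "sum p G + sum p T' \<le> gain its (solve r its cap)" using t(2) by simp
  then have "int r * (sum p G + sum p T') \<le> int r * gain its (solve r its cap)"
    by (intro mult_left_mono) auto
  with T'(3) show ?thesis
    unfolding gainP by (simp add: diff P_def[symmetric] algebra_simps)
qed

end

end

section \<open>Running time of the vector knapsack algorithm\<close>

text \<open>Functions of several arguments are shown computable on tuples; this rule and its
  variants turn such a fact into an introduction rule for curried applications, with
  \<open>f\<close> instantiated by hand.\<close>

lemma ptime_app2:
  assumes "ptime UNIV (\<lambda>p. f (fst p) (snd p))" "ptime D F" "ptime D G"
  shows "ptime D (\<lambda>x. f (F x) (G x))"
  using ptime_comp[OF assms(1) ptime_pair[OF assms(2,3)]] by simp

lemma ptime_app3: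
  assumes "ptime UNIV (\<lambda>p. f (fst p) (fst (snd p)) (snd (snd p)))" "ptime D F" "ptime D G" "ptime D H"
  shows "ptime D (\<lambda>x. f (F x) (G x) (H x))"
  using ptime_comp[OF assms(1) ptime_pair[OF assms(2) ptime_pair[OF assms(3,4)]]] by simp

lemma ptime_eq_int_list:
  fixes F G :: "'a :: codable \<Rightarrow> int list"
  assumes "ptime D F" "ptime D G" shows "ptime D (\<lambda>x. F x = G x)"
proof (rule ptime_cong)
  show "ptime D (\<lambda>x. length (F x) = length (G x) \<and> (\<forall>p \<in> set (zip (F x) (G x)). fst p = snd p))"
    by (intro ptime_intros ptime_list_intros assms)
  show "(length (F x) = length (G x) \<and> (\<forall>p \<in> set (zip (F x) (G x)). fst p = snd p)) = (F x = G x)" for x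
    by (auto simp: list_eq_iff_zip_eq)
qed

lemma ptime_vadd:
  assumes "ptime D F" "ptime D G" shows "ptime D (\<lambda>x. vadd (F x) (G x))"
  unfolding vadd_def by (intro ptime_intros ptime_list_intros assms)

lemma ptime_insert_state: "ptime UNIV (\<lambda>p. insert_state (fst p) (snd p))"
  unfolding insert_state_def by (intro ptime_intros ptime_list_intros ptime_eq_int_list)

text \<open>All kept states come from the processed prefix and are no more numerous, which gives a
  quadratic size bound.\<close>

lemma ptime_fold_insert_state:
  assumes L: "ptime D L" shows "ptime D (\<lambda>x. fold insert_state (L x) [])"
proof (rule ptime_fold[OF L ptime_const])
  show "poly_bounded D (\<lambda>x. 1 + esize (L x) * (1 + esize (L x)))"
    by (intro poly_bounded_add poly_bounded_mult poly_bounded_const ptime_poly_bounded L)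
  have len: "length (fold insert_state xs ys) \<le> length xs + length ys" for xs ys :: "'b state list"
  proof (induction xs arbitrary: ys)
    case (Cons x xs)
    have "length (insert_state x ys) \<le> Suc (length ys)"
      by (simp add: insert_state_def le_SucI)
    with Cons.IH[of "insert_state x ys"] show ?case by simp
  qed simp
  fix x ys zs assume x: "L x = ys @ zs"
  have "esize (fold insert_state ys []) \<le> 1 + length (fold insert_state ys []) * (1 + esize (L x))"
    using set_fold_insert_state[of ys "[]"] x by (intro esize_list_le esize_member) auto
  also have "\<dots> \<le> 1 + esize (L x) * (1 + esize (L x))"
    using len[of ys "[]"] length_le_esize[of "L x"] x by (intro add_left_mono mult_right_mono) auto
  finally show "esize (fold insert_state ys []) \<le> 1 + esize (L x) * (1 + esize (L x))" .
qed (intro ptime_app2[where f = insert_state, OF ptime_insert_state] ptime_intros)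

lemma ptime_extend_state: "ptime UNIV (\<lambda>p. extend_state (fst p) (snd p))"
  unfolding extend_state_def by (intro ptime_intros ptime_vadd)

lemma ptime_dp_step: "ptime UNIV (\<lambda>p. dp_step (fst p) (fst (snd p)) (snd (snd p)))"
  unfolding dp_step_def
  by (intro ptime_fold_insert_state ptime_list_intros ptime_intros ptime_app2[where f = extend_state, OF ptime_extend_state])

lemma esize_selection: "selection \<sigma> mss \<Longrightarrow> esize \<sigma> \<le> esize mss"
proof (induction rule: list_all2_induct)
  case (Cons m \<sigma> ms mss)
  from esize_member[OF Cons.hyps(1)] Cons.IH show ?case by simp
qed simp

lemma esize_map_le: "(\<And>a. esize (f a) \<le> esize a) \<Longrightarrow> esize (map f xs) \<le> esize xs"
  by (induction xs) (auto intro: add_mono)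

lemma esize_int_le: "0 \<le> a \<Longrightarrow> a \<le> N \<Longrightarrow> esize a \<le> 1 + nat N"
  by (auto intro!: bitlength_le)

text \<open>\<open>length_dp\<close> bounds the number of states. Within a state, the load has few
  entries of value at most \<open>N\<close>, while profit and choices are summed up or picked from
  \<open>mss\<close> and thus no larger than it.\<close>

lemma esize_dp:
  assumes wf: "\<forall>ms \<in> set mss. \<forall>m \<in> set ms. length (fst (snd m)) = length z \<and> (\<forall>a \<in> set (fst (snd m)). 0 \<le> a)"
    and z: "\<forall>a \<in> set z. 0 \<le> a \<and> a \<le> N" "length z \<le> d"
  shows "esize (dp N z mss) \<le> 1 + (nat N + 1) ^ d * (1 + (3 + 2 * esize mss + d * (2 + nat N)))"
proof -
  have len: "length (dp N z mss) \<le> (nat N + 1) ^ d"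
  proof (cases "0 \<le> N")
    case True
    then have "length (dp N z mss) \<le> (nat N + 1) ^ length z"
      using length_dp[OF wf z(1)] by (simp add: nat_add_distrib)
    also have "\<dots> \<le> (nat N + 1) ^ d" using z(2) by (intro power_increasing) auto
    finally show ?thesis .
  next
    case False
    then have "z = []" using z(1) by (cases z) auto
    then show ?thesis using length_dp[OF wf z(1)] by (simp add: order_trans)
  qed
  have "esize s \<le> 3 + 2 * esize mss + d * (2 + nat N)" if s: "s \<in> set (dp N z mss)" for s
  proof -
    from dp_sound[OF s] z(1) obtain \<sigma> where \<sigma>: "selection \<sigma> mss"
      "s = (\<Sum>m\<leftarrow>\<sigma>. fst m, vsum z \<sigma>, map (snd \<circ> snd) \<sigma>)" and N: "\<forall>a \<in> set (vsum z \<sigma>). a \<le> N"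
      by (metis fst_conv snd_conv)
    have wf': "\<forall>m \<in> set \<sigma>. length (fst (snd m)) = length z \<and> (\<forall>a \<in> set (fst (snd m)). 0 \<le> a)"
      using wf selection_member[OF \<sigma>(1)] by blast
    have v: "length (vsum z \<sigma>) \<le> d" "\<forall>a \<in> set (vsum z \<sigma>). 0 \<le> a"
      using length_vsum[of \<sigma> z] vsum_nonneg[OF wf'] wf' z by auto
    have "esize (vsum z \<sigma>) \<le> 1 + length (vsum z \<sigma>) * (1 + (1 + nat N))"
      using N v by (intro esize_list_le esize_int_le) auto
    also have "\<dots> \<le> 1 + d * (1 + (1 + nat N))"
      using v(1) by (intro add_left_mono mult_right_mono) auto
    finally have "esize (vsum z \<sigma>) \<le> 1 + d * (2 + nat N)" by simp
    moreover have "esize (\<Sum>m\<leftarrow>\<sigma>. fst m) \<le> esize mss"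
    proof -
      have "esize (\<Sum>m\<leftarrow>\<sigma>. fst m) \<le> esize (map fst \<sigma>)" by (rule esize_sum_list)
      also have "\<dots> \<le> esize \<sigma>" by (rule esize_map_le) (simp add: esize_pair)
      also have "\<dots> \<le> esize mss" by (rule esize_selection[OF \<sigma>(1)])
      finally show ?thesis .
    qed
    moreover have "esize (map (snd \<circ> snd) \<sigma>) \<le> esize mss"
    proof -
      have "esize (map (snd \<circ> snd) \<sigma>) \<le> esize \<sigma>" by (rule esize_map_le) (simp add: esize_pair)
      also have "\<dots> \<le> esize mss" by (rule esize_selection[OF \<sigma>(1)])
      finally show ?thesis .
    qed
    ultimately show ?thesis unfolding \<sigma>(2) enc_simps(4) val_size.simps by linarith
  qed
  then have "esize (dp N z mss) \<le> 1 + length (dp N z mss) * (1 + (3 + 2 * esize mss + d * (2 + nat N)))"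
    by (rule esize_list_le)
  also have "\<dots> \<le> 1 + (nat N + 1) ^ d * (1 + (3 + 2 * esize mss + d * (2 + nat N)))"
    using len by (intro add_left_mono mult_right_mono) auto
  finally show ?thesis .
qed

text \<open>The algorithm is pseudo-polynomial: the value of \<open>N\<close>, and not just its bit
  length, has to be polynomially bounded. Every intermediate state of the fold is the
  \<open>dp\<close> of a suffix of the list, so \<open>esize_dp\<close> bounds them all.\<close>

lemma ptime_dp:
  assumes N: "ptime D N" and z: "ptime D z" and mss: "ptime D mss"
    and pb: "poly_bounded D (\<lambda>x. nat (N x))"
    and wf: "\<And>x. x \<in> D \<Longrightarrow> \<forall>ms \<in> set (mss x). \<forall>m \<in> set ms. length (fst (snd m)) = length (z x) \<and>
      (\<forall>a \<in> set (fst (snd m)). 0 \<le> a)"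
    and z': "\<And>x. x \<in> D \<Longrightarrow> (\<forall>a \<in> set (z x). 0 \<le> a \<and> a \<le> N x) \<and> length (z x) \<le> d"
  shows "ptime D (\<lambda>x. dp (N x) (z x) (mss x))"
  unfolding dp_def
proof (rule ptime_fold)
  show "poly_bounded D (\<lambda>x. 1 + (nat (N x) + 1) ^ d * (1 + (3 + 2 * esize (mss x) + d * (2 + nat (N x)))))"
    by (intro poly_bounded_add poly_bounded_mult poly_bounded_power poly_bounded_const
        ptime_poly_bounded[OF mss] pb)
  fix x ys zs assume x: "x \<in> D" and ys: "rev (mss x) = ys @ zs"
  then have mss: "mss x = rev zs @ rev ys" by (simp add: rev_swap)
  have "esize (dp (N x) (z x) (rev ys)) \<le>
      1 + (nat (N x) + 1) ^ d * (1 + (3 + 2 * esize (rev ys) + d * (2 + nat (N x))))"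
    using wf[OF x] z'[OF x] unfolding mss by (intro esize_dp) auto
  also have "\<dots> \<le> 1 + (nat (N x) + 1) ^ d * (1 + (3 + 2 * esize (mss x) + d * (2 + nat (N x))))"
    using esize_drop[of "length zs" "mss x"]
    by (intro add_left_mono mult_left_mono add_right_mono) (auto simp: mss)
  finally show "esize (fold (dp_step (N x)) ys [(0, z x, [])]) \<le>
      1 + (nat (N x) + 1) ^ d * (1 + (3 + 2 * esize (mss x) + d * (2 + nat (N x))))"
    by (simp add: dp_def)
qed (intro ptime_app3[where f = dp_step, OF ptime_dp_step] ptime_intros ptime_rev ptime_map_prod_comp N z mss)+

lemma esize_map2_int_le:
  assumes "\<And>a b. esize (f a b :: int) \<le> esize a + esize b"
  shows "esize (map (\<lambda>(a, b). f a b) (zip u v)) \<le> esize (u :: int list) + esize (v :: int list)"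
proof (induction u arbitrary: v)
  case (Cons a u)
  note IH = Cons.IH
  show ?case
  proof (cases v)
    case (Cons b w)
    have "esize (f a b) \<le> esize a + esize b" by (rule assms)
    with IH[of w] show ?thesis by (simp add: Cons)
  qed simp
qed simp

text \<open>Repeated subtraction does not blow up: a difference is no larger than its operands
  together, so every state is bounded by the total size of the input.\<close>

lemma ptime_residual: "ptime UNIV (\<lambda>p. residual (fst p) (snd p))"
  unfolding residual_def
proof (rule ptime_fold)
  let ?s = "\<lambda>(g :: 'a opt option) R. case g of None \<Rightarrow> R | Some a \<Rightarrow> map (\<lambda>(x, y). x - y) (zip R (snd a))"
  show "poly_bounded UNIV (\<lambda>p :: int list \<times> 'a opt option list. esize (fst p) + esize (snd p))"
    by (intro poly_bounded_add ptime_poly_bounded ptime_intros)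
  have step: "esize (?s g R) \<le> esize g + esize R" for g R
  proof (cases g)
    case (Some a)
    have sub: "esize (x - y) \<le> esize x + esize y" for x y :: int
      using bitlength_arith_op[of Sub x y] by simp
    have "esize (map (\<lambda>(x, y). x - y) (zip R (snd a))) \<le> esize R + esize (snd a)"
      by (rule esize_map2_int_le[OF sub])
    then show ?thesis by (simp add: Some esize_pair[of a])
  qed simp
  have "esize (fold ?s ys R) \<le> esize R + esize ys" for ys R
  proof (induction ys arbitrary: R)
    case (Cons g ys)
    from Cons.IH[of "?s g R"] step[where g = g and R = R] show ?case by simp
  qed simp
  then have le: "esize (fold ?s ys R) \<le> esize R + esize ys" for ys R .
  show "esize (fold ?s ys (fst p)) \<le> esize (fst p) + esize (snd p)" if "snd p = ys @ zs" for p ys zs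
    using esize_take[of "length ys" "snd p"] that by (intro order_trans[OF le]) simp
qed (intro ptime_intros ptime_list_intros)+

section \<open>Rounding, guessing and selection in polynomial time\<close>

lemma ptime_zero_vec: "ptime D F \<Longrightarrow> ptime D (\<lambda>x. zero_vec (F x))"
  unfolding zero_vec_def by (intro ptime_intros ptime_list_intros)

lemma ptime_scale: "ptime UNIV (\<lambda>p. scale (fst p) (fst (snd p)) (snd (snd p)))"
  unfolding scale_def by (intro ptime_intros)

lemma ptime_vscale: "ptime UNIV (\<lambda>p. vscale (fst p) (fst (snd p)) (snd (snd p)))"
  unfolding vscale_def by (intro ptime_app3[where f = scale, OF ptime_scale] ptime_intros ptime_list_intros)

lemma ptime_moves: "ptime UNIV (\<lambda>p. moves (fst p) (fst (snd p)) (snd (snd p)))"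
  unfolding moves_def
  by (intro ptime_app3[where f = vscale, OF ptime_vscale] ptime_zero_vec ptime_intros ptime_list_intros)

text \<open>The induction builds a separate program for every \<open>g\<close>, and its polynomial
  may depend on \<open>g\<close>, which is a constant of the scheme.\<close>

lemma ptime_guesses: "ptime UNIV (\<lambda>its. guesses its g)"
proof (induction g)
  case 0
  show ?case unfolding guesses.simps by (intro ptime_intros ptime_list_intros)
next
  case (Suc g)
  show ?case unfolding guesses.simps by (intro ptime_intros ptime_list_intros Suc)
qed

text \<open>The domain requires well-formed items and an admissible guess because the size bound for
  \<open>dp\<close> rests on nonnegative vectors of the right length.\<close>

lemma ptime_candidates:
  "ptime {p. wf_items (length (fst (snd p))) (fst p) \<and> length (fst (snd p)) \<le> m \<and>
      admissible (fst p) (snd (snd p))}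
    (\<lambda>p. candidates r (fst p) (fst (snd p)) (snd (snd p)))"
    (is "ptime ?D _")
proof -
  let ?R = "\<lambda>p :: (int \<times> 'a opt list) list \<times> int list \<times> 'a opt option list. residual (fst (snd p)) (snd (snd p))"
  let ?N = "\<lambda>p :: (int \<times> 'a opt list) list \<times> int list \<times> 'a opt option list. grid (fst p) r"
  have R: "ptime ?D ?R" by (intro ptime_app2[where f = residual, OF ptime_residual] ptime_intros)
  have N: "ptime ?D ?N" unfolding grid_def by (intro ptime_intros ptime_list_intros)
  have mss: "ptime ?D (\<lambda>p. map (moves (?N p) (?R p)) (zip (fst p) (snd (snd p))))"
    by (intro ptime_app3[where f = moves, OF ptime_moves] ptime_intros ptime_list_intros ptime_map_prod_comp R N)
  have "ptime ?D (\<lambda>p. if \<forall>b \<in> set (?R p). 0 \<le> b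
      then dp (?N p) (zero_vec (?R p)) (map (moves (?N p) (?R p)) (zip (fst p) (snd (snd p)))) else [])"
  proof (rule ptime_if[OF _ ptime_dp[where d = m] ptime_const])
    show "ptime ?D (\<lambda>p. \<forall>b \<in> set (?R p). 0 \<le> b)"
      by (intro ptime_intros ptime_list_intros R)
    have "poly_bounded ?D (\<lambda>p. esize (fst p) * (2 * r + 1))"
      by (intro poly_bounded_mult poly_bounded_const ptime_poly_bounded ptime_intros)
    then show "poly_bounded ?D (\<lambda>p. nat (?N p))"
    proof (rule poly_bounded_mono)
      fix p :: "(int \<times> 'a opt list) list \<times> int list \<times> 'a opt option list"
      have "nat (?N p) = length (fst p) * (2 * r + 1)"
        by (simp add: grid_def nat_mult_distrib nat_add_distrib)
      also have "\<dots> \<le> esize (fst p) * (2 * r + 1)"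
        by (intro mult_right_mono length_le_esize) simp
      finally show "nat (?N p) \<le> esize (fst p) * (2 * r + 1)" .
    qed
  next
    fix p assume p: "p \<in> ?D"
    then have wf: "wf_items (length (fst (snd p))) (fst p)" and adm: "admissible (fst p) (snd (snd p))"
      and m: "length (fst (snd p)) \<le> m" by auto
    have len: "length (?R p) = length (fst (snd p))" by (rule residual_admissible(1)[OF wf adm])
    show "\<forall>ms \<in> set (map (moves (?N p) (?R p)) (zip (fst p) (snd (snd p)))). \<forall>s \<in> set ms.
        length (fst (snd s)) = length (zero_vec (?R p)) \<and> (\<forall>a \<in> set (fst (snd s)). 0 \<le> a)"
      using moves_wf[OF wf len, where r = r] unfolding zero_vec_simps(1) set_map by blast
    show "(\<forall>a \<in> set (zero_vec (?R p)). 0 \<le> a \<and> a \<le> ?N p) \<and> length (zero_vec (?R p)) \<le> m"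
      using len m by (simp add: zero_vec_def grid_def)
  qed (intro N mss ptime_zero_vec R)+
  then show ?thesis by (simp add: candidates_def Let_def)
qed

lemma ptime_fold_better:
  assumes L: "ptime D L" and I: "ptime D I" shows "ptime D (\<lambda>x. fold better (L x) (I x))"
proof (rule ptime_fold[OF L I])
  show "poly_bounded D (\<lambda>x. esize (L x) + esize (I x))"
    by (intro poly_bounded_add ptime_poly_bounded L I)
  show "esize (fold better ys (I x)) \<le> esize (L x) + esize (I x)" if "L x = ys @ zs" for x ys zs
  proof -
    have "fold better ys (I x) \<in> insert (I x) (set (L x))"
      using fold_better(1)[of ys "I x"] that by auto
    then show ?thesis using esize_member[of "fold better ys (I x)" "L x"] by auto
  qed
qed (unfold better_def, intro ptime_intros)

lemma ptime_solve:
  "ptime {p. wf_items (length (snd p)) (fst p) \<and> length (snd p) \<le> m} (\<lambda>p. solve r (fst p) (snd p))"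
  (is "ptime ?D _")
proof -
  have g: "ptime ?D (\<lambda>p. guesses (fst p) r)"
    by (rule ptime_comp[OF ptime_guesses]) (intro ptime_intros, simp)
  have c: "ptime ?D (\<lambda>p. map (candidates r (fst p) (snd p)) (guesses (fst p) r))"
  proof (rule ptime_map[OF g])
    show "ptime {y. fst y \<in> ?D \<and> snd y \<in> set (guesses (fst (fst y)) r)}
        (\<lambda>y. candidates r (fst (fst y)) (snd (fst y)) (snd y))" (is "ptime ?E _")
    proof -
      have "ptime ?E (\<lambda>y. (fst (fst y), snd (fst y), snd y))" by (intro ptime_intros)
      note ptime_comp[OF ptime_candidates[of m r] this]
      moreover have "(fst (fst y), snd (fst y), snd y) \<in> {p. wf_items (length (fst (snd p))) (fst p) \<and>
          length (fst (snd p)) \<le> m \<and> admissible (fst p) (snd (snd p))}" if "y \<in> ?E" for y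
        using that by (auto intro: guesses_admissible)
      ultimately have "ptime ?E (\<lambda>y. candidates r (fst (fst (fst y), snd (fst y), snd y))
          (fst (snd (fst (fst y), snd (fst y), snd y))) (snd (snd (fst (fst y), snd (fst y), snd y))))"
        by blast
      then show ?thesis by (simp only: fst_conv snd_conv)
    qed
  qed
  show ?thesis
    unfolding solve_def
    by (intro c ptime_fold_better ptime_zero_vec ptime_intros ptime_list_intros g)
qed

section \<open>Shelf packing\<close>

type_synonym 'k box = "'k \<times> int \<times> int"
type_synonym 'k placed_box = "'k \<times> int \<times> int \<times> int \<times> int"

text \<open>Filters replace recursion, so that the rules for list functions apply; on a sorted list
  both filters cut at the same place.\<close>

definition insert_desc :: "'k box \<Rightarrow> 'k box list \<Rightarrow> 'k box list" where
  "insert_desc a L = filter (\<lambda>b. snd (snd a) < snd (snd b)) L @ a # filter (\<lambda>b. snd (snd b) \<le> snd (snd a)) L"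

definition sort_desc :: "'k box list \<Rightarrow> 'k box list" where
  "sort_desc L = fold insert_desc L []"

lemma mset_insert_desc: "mset (insert_desc a L) = add_mset a (mset L)"
proof -
  have "filter_mset (\<lambda>b. snd (snd b) \<le> snd (snd a)) (mset L) = filter_mset (\<lambda>b. \<not> snd (snd a) < snd (snd b)) (mset L)"
    by (rule filter_mset_cong) auto
  then show ?thesis
    using multiset_partition[of "mset L" "\<lambda>b. snd (snd a) < snd (snd b)"]
    by (simp add: insert_desc_def)
qed

lemma mset_sort_desc: "mset (sort_desc L) = mset L"
proof -
  have "mset (fold insert_desc L K) = mset L + mset K" for K
    by (induction L arbitrary: K) (simp_all add: mset_insert_desc)
  then show ?thesis by (simp add: sort_desc_def)
qed

lemma sorted_sort_desc: "sorted_wrt (\<lambda>a b. snd (snd b) \<le> snd (snd a)) (sort_desc L)"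
proof -
  have ins: "sorted_wrt (\<lambda>a b. snd (snd b) \<le> snd (snd a)) (insert_desc a K)"
    if "sorted_wrt (\<lambda>a b. snd (snd b) \<le> snd (snd a)) K" for a and K :: "'a box list"
    using that by (auto simp: insert_desc_def sorted_wrt_append intro: sorted_wrt_filter)
  have "sorted_wrt (\<lambda>a b. snd (snd b) \<le> snd (snd a)) (fold insert_desc L K)"
    if "sorted_wrt (\<lambda>a b. snd (snd b) \<le> snd (snd a)) K" for K
    using that by (induction L arbitrary: K) (simp_all add: ins)
  then show ?thesis by (simp add: sort_desc_def)
qed

text \<open>Next fit decreasing height: \<open>x\<close> is the used width, \<open>y\<close> the bottom and \<open>h\<close> the height of the
  current shelf.\<close>

fun nfdh :: "int \<Rightarrow> int \<Rightarrow> int \<Rightarrow> int \<Rightarrow> 'k box list \<Rightarrow> 'k placed_box list" where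
  "nfdh W x y h [] = []"
| "nfdh W x y h ((i, w, b) # ls) =
     (if x + w \<le> W then (i, x, y, w, b) # nfdh W (x + w) y h ls
      else (i, 0, y + h, w, b) # nfdh W w (y + h) b ls)"

text \<open>Starting with a full shelf of height \<open>0\<close> makes the first box open the first shelf.\<close>

definition shelf_pack :: "int \<Rightarrow> 'k box list \<Rightarrow> 'k placed_box list" where
  "shelf_pack W L = nfdh W W 0 0 (sort_desc L)"

abbreviation box_of :: "'k placed_box \<Rightarrow> 'k box" where
  "box_of q \<equiv> (fst q, fst (snd (snd (snd q))), snd (snd (snd (snd q))))"

lemma map_box_of_nfdh: "map box_of (nfdh W x y h ls) = ls"
  by (induction W x y h ls rule: nfdh.induct) simp_all

text \<open>Deliberately not symmetric: it relates a box to one placed later, so that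
  \<open>sorted_wrt\<close> can be established along the run of the algorithm.\<close>

definition well_separated :: "'k placed_box \<Rightarrow> 'k placed_box \<Rightarrow> bool" where
  "well_separated p q \<longleftrightarrow> (case p of (i, x, y, w, b) \<Rightarrow> case q of (i', x', y', w', b') \<Rightarrow>
     x + w \<le> x' \<and> y = y' \<or> y + b \<le> y')"

definition positive_boxes :: "'k box list \<Rightarrow> bool" where
  "positive_boxes ls \<longleftrightarrow> (\<forall>(i, w, b) \<in> set ls. 0 < w \<and> 0 < b)"

lemma nfdh_later:
  assumes "positive_boxes ls" "0 \<le> h" "(i, x', y', w, b) \<in> set (nfdh W x y h ls)"
  shows "x \<le> x' \<and> y' = y \<or> y + h \<le> y'"
  using assms
proof (induction W x y h ls rule: nfdh.induct)
  case (2 W x y h i' w' b' ls)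
  show ?case
  proof (cases "x + w' \<le> W")
    case True
    with 2 show ?thesis by (fastforce simp: positive_boxes_def)
  next
    case False
    with 2 show ?thesis by (fastforce simp: positive_boxes_def)
  qed
qed simp

text \<open>The height of a shelf is set by its first box, and by the order no later box is higher;
  hence a new shelf clears everything on the previous one.\<close>

lemma nfdh_separated:
  assumes "positive_boxes ls" "sorted_wrt (\<lambda>a b. snd (snd b) \<le> snd (snd a)) ls"
    "\<forall>(i, w, b) \<in> set ls. b \<le> h" "0 \<le> h"
  shows "sorted_wrt well_separated (nfdh W x y h ls)"
  using assms
proof (induction W x y h ls rule: nfdh.induct)
  case (2 W x y h i w b ls)
  have pos: "positive_boxes ls" "0 < w" "0 < b" using 2(3) by (auto simp: positive_boxes_def)
  show ?case
  proof (cases "x + w \<le> W")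
    case True
    have "well_separated (i, x, y, w, b) q" if "q \<in> set (nfdh W (x + w) y h ls)" for q
      using nfdh_later[OF pos(1), of h] that 2(5,6) by (cases q) (fastforce simp: well_separated_def)
    with True 2 pos show ?thesis by simp
  next
    case False
    have "well_separated (i, 0, y + h, w, b) q" if "q \<in> set (nfdh W w (y + h) b ls)" for q
      using nfdh_later[OF pos(1), of b] that pos by (cases q) (fastforce simp: well_separated_def)
    moreover have "\<forall>(i, w, b') \<in> set ls. b' \<le> b" using 2(4) by auto
    ultimately show ?thesis using False 2(2)[OF False] 2(4) pos by simp
  qed
qed simp

lemma nfdh_horizontal:
  assumes "positive_boxes ls" "0 \<le> x" "(i, x', y', w, b) \<in> set (nfdh W x y h ls)"
  shows "0 \<le> x' \<and> (x' + w \<le> W \<or> x' = 0)"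
  using assms
proof (induction W x y h ls rule: nfdh.induct)
  case (2 W x y h i' w' b' ls)
  then show ?case by (cases "x + w' \<le> W") (auto simp: positive_boxes_def)
qed simp

text \<open>In width 0 no box of positive width fits next to the used part, so every box opens its
  own shelf and the heights add up.\<close>

lemma nfdh_stack:
  assumes "positive_boxes ls" "0 \<le> x" "(i, x', y', w, b) \<in> set (nfdh 0 x y h ls)"
  shows "x' = 0 \<and> y + h \<le> y' \<and> y' + b \<le> y + h + (\<Sum>(i, w, b) \<leftarrow> ls. b)"
  using assms
proof (induction "0 :: int" x y h ls rule: nfdh.induct)
  case (2 x y h i' w' b' ls)
  have pos: "positive_boxes ls" "0 < w'" "0 < b'" using 2(3) by (auto simp: positive_boxes_def)
  have n: "\<not> x + w' \<le> 0" using pos 2(4) by simp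
  have s: "0 \<le> (\<Sum>(i, w, b) \<leftarrow> ls. b)"
    using pos(1) by (intro sum_list_nonneg) (auto simp: positive_boxes_def)
  from 2(5) n consider "x' = 0" "y' = y + h" "b = b'" | "(i, x', y', w, b) \<in> set (nfdh 0 w' (y + h) b' ls)"
    by auto
  then show ?case
  proof cases
    case 2
    from "2.hyps"(2)[OF n pos(1) _ this] pos show ?thesis by simp
  qed (use s in simp)
qed simp

lemma nfdh_row:
  assumes "positive_boxes ls" "x + (\<Sum>(i, w, b) \<leftarrow> ls. w) \<le> W" "(i, x', y', w, b) \<in> set (nfdh W x y h ls)"
  shows "y' = y"
  using assms
proof (induction W x y h ls rule: nfdh.induct)
  case (2 W x y h i' w' b' ls)
  have pos: "positive_boxes ls" using 2(3) by (auto simp: positive_boxes_def)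
  have "0 \<le> (\<Sum>(i, w, b) \<leftarrow> ls. w)"
    using pos by (intro sum_list_nonneg) (auto simp: positive_boxes_def)
  then have "x + w' \<le> W" using 2(4) by simp
  with 2 pos show ?case by (auto simp: algebra_simps)
qed simp

text \<open>The area argument: when a shelf is closed, its used width exceeds \<open>(1 - e / f) W\<close>, and all of
  it is covered up to the height of the next shelf.\<close>

lemma nfdh_area:
  assumes "positive_boxes ls" "sorted_wrt (\<lambda>a b. snd (snd b) \<le> snd (snd a)) ls"
    "\<forall>(i, w, b) \<in> set ls. b \<le> \<beta> \<and> b \<le> h \<and> f * w \<le> e * W" "0 \<le> x" "0 \<le> f" "0 \<le> (f - e) * W"
    "(i, x', y', w, b) \<in> set (nfdh W x y h ls)"
  shows "(y' + b - y - h) * ((f - e) * W) \<le> f * ((\<Sum>(i, w, b) \<leftarrow> ls. w * b) + x * \<beta>)"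
  using assms
\<comment> \<open>The product \<open>x * \<beta>\<close> stands for the area covered on the current
  shelf up to height \<open>\<beta>\<close>. In the recursive calls \<open>\<beta>\<close> becomes
  the height of the box just placed, which bounds all later heights; this covered area is the credit
  for the next shelf.\<close>
proof (induction W x y h ls arbitrary: \<beta> rule: nfdh.induct)
  case (2 W x y h i' w' b' ls)
  have pos: "positive_boxes ls" "0 < w'" "0 < b'" using "2.prems"(1) by (auto simp: positive_boxes_def)
  have srt: "sorted_wrt (\<lambda>a b. snd (snd b) \<le> snd (snd a)) ls" using "2.prems"(2) by simp
  have b': "b' \<le> \<beta>" "b' \<le> h" "f * w' \<le> e * W" using "2.prems"(3) by auto
  have ls: "\<forall>(i, w, b) \<in> set ls. b \<le> b' \<and> b \<le> h \<and> f * w \<le> e * W"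
    "\<forall>(i, w, b) \<in> set ls. b \<le> b' \<and> b \<le> b' \<and> f * w \<le> e * W"
    using "2.prems"(2,3) by auto
  let ?a = "\<Sum>(i, w, b) \<leftarrow> ls. w * b"
  have a: "0 \<le> ?a" using pos(1)
    by (intro sum_list_nonneg) (auto simp: positive_boxes_def mult_nonneg_nonneg less_imp_le)
  have x\<beta>: "x * b' \<le> x * \<beta>" using b'(1) "2.prems"(4) by (intro mult_left_mono)
  have \<beta>0: "0 \<le> x * \<beta>" using "2.prems"(4) b'(1) pos(3) by (intro mult_nonneg_nonneg) auto
  have wb: "0 \<le> w' * b'" using pos by simp
  have rhs: "0 \<le> f * (w' * b' + ?a + x * \<beta>)"
    by (rule mult_nonneg_nonneg) (use "2.prems"(5) a \<beta>0 wb in linarith)+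
  show ?case
  proof (cases "x + w' \<le> W")
    case True
    with "2.prems"(7) consider "y' = y" "b = b'" | "(i, x', y', w, b) \<in> set (nfdh W (x + w') y h ls)" by auto
    then show ?thesis
    proof cases
      case 1
      then have "(y' + b - y - h) * ((f - e) * W) \<le> 0"
        using b'(2) "2.prems"(6) by (intro mult_nonpos_nonneg) auto
      with rhs show ?thesis by simp
    next
      case 2
      have "(y' + b - y - h) * ((f - e) * W) \<le> f * (?a + (x + w') * b')"
        by (rule "2.IH"(1)[OF True pos(1) srt ls(1) _ _ _ 2]) (use "2.prems" pos in auto)
      also have "\<dots> \<le> f * (w' * b' + ?a + x * \<beta>)"
        using x\<beta> "2.prems"(5) by (intro mult_left_mono) (auto simp: algebra_simps)
      finally show ?thesis by simp
    qed
  next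
    case False
    \<comment> \<open>The box did not fit although its width is at most \<open>e / f * W\<close>, so
      the used width \<open>x\<close> exceeds \<open>(1 - e / f) * W\<close>; the strip of height
      \<open>b'\<close> on this shelf pays for the new shelf.\<close>
    have "b' * ((f - e) * W) \<le> f * (x * b')"
    proof -
      have "(f - e) * W \<le> f * (W - w')" using b'(3) by (simp add: algebra_simps)
      also have "\<dots> \<le> f * x" using False "2.prems"(5) by (intro mult_left_mono) auto
      finally have "b' * ((f - e) * W) \<le> b' * (f * x)" using pos(3) by (intro mult_left_mono) auto
      then show ?thesis by (simp add: algebra_simps)
    qed
    also have "\<dots> \<le> f * (x * \<beta>)" using x\<beta> "2.prems"(5) by (rule mult_left_mono)
    finally have shelf: "b' * ((f - e) * W) \<le> f * (x * \<beta>)" .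
    from False "2.prems"(7) consider "y' = y + h" "b = b'" | "(i, x', y', w, b) \<in> set (nfdh W w' (y + h) b' ls)" by auto
    then show ?thesis
    proof cases
      case 1
      have "0 \<le> f * (w' * b' + ?a)"
        by (rule mult_nonneg_nonneg) (use "2.prems"(5) a wb in linarith)+
      with 1 shelf show ?thesis by (simp add: distrib_left)
    next
      case 2
      have "(y' + b - (y + h) - b') * ((f - e) * W) \<le> f * (?a + w' * b')"
        by (rule "2.IH"(2)[OF False pos(1) srt ls(2) _ _ _ 2]) (use "2.prems" pos in auto)
      moreover have "(y' + b - y - h) * ((f - e) * W) =
          (y' + b - (y + h) - b') * ((f - e) * W) + b' * ((f - e) * W)"
        by (simp add: algebra_simps)
      ultimately show ?thesis using shelf by (simp add: distrib_left)
    qed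
  qed
qed simp

section \<open>Guarantees for the complete shelf packing\<close>

lemma positive_boxes_sort_desc: "positive_boxes (sort_desc L) = positive_boxes L"
  using mset_eq_setD[OF mset_sort_desc[of L]] by (simp add: positive_boxes_def)

lemma sum_list_sort_desc: "(\<Sum>p \<leftarrow> sort_desc L. g p) = (\<Sum>p \<leftarrow> L. (g p :: int))"
proof -
  have "mset (map g (sort_desc L)) = mset (map g L)" by (simp add: mset_sort_desc)
  then show ?thesis by (metis sum_mset_sum_list)
qed

lemma set_box_of_shelf_pack: "box_of ` set (shelf_pack W L) = set L"
  using mset_eq_setD[OF mset_sort_desc[of L]] map_box_of_nfdh[of W W 0 0 "sort_desc L"]
  unfolding shelf_pack_def by (metis list.set_map)

lemma shelf_pack_unfold:
  assumes "positive_boxes L"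
  shows "shelf_pack W L = [] \<or> (\<exists>i w b ls. sort_desc L = (i, w, b) # ls \<and>
    shelf_pack W L = (i, 0, 0, w, b) # nfdh W w 0 b ls)"
proof (cases "sort_desc L")
  case (Cons p ls)
  obtain i w b where p: "p = (i, w, b)" by (cases p)
  have "0 < w" using assms positive_boxes_sort_desc[of L] by (simp add: Cons p positive_boxes_def)
  then show ?thesis using Cons p by (simp add: shelf_pack_def)
qed (simp add: shelf_pack_def)

lemma shelf_pack_separated:
  assumes "positive_boxes L"
  shows "sorted_wrt well_separated (shelf_pack W L)"
  using shelf_pack_unfold[OF assms, of W]
proof (elim disjE exE conjE)
  fix i w b ls assume L: "sort_desc L = (i, w, b) # ls" and S: "shelf_pack W L = (i, 0, 0, w, b) # nfdh W w 0 b ls"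
  have pos: "positive_boxes ls" "0 < w" "0 < b"
    using assms positive_boxes_sort_desc[of L] by (auto simp: L positive_boxes_def)
  have srt: "sorted_wrt (\<lambda>a b. snd (snd b) \<le> snd (snd a)) ls" "\<forall>(i, w, b') \<in> set ls. b' \<le> b"
    using sorted_sort_desc[of L] by (auto simp: L)
  have "well_separated (i, 0, 0, w, b) q" if "q \<in> set (nfdh W w 0 b ls)" for q
    using nfdh_later[OF pos(1), of b] that pos by (cases q) (fastforce simp: well_separated_def)
  with nfdh_separated[OF pos(1) srt] pos show ?thesis by (simp add: S)
qed simp

lemma shelf_pack_stack:
  assumes "positive_boxes L" "(i, x, y, w, b) \<in> set (shelf_pack 0 L)"
  shows "x = 0 \<and> 0 \<le> y \<and> y + b \<le> (\<Sum>(i, w, b) \<leftarrow> L. b)"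
  using nfdh_stack[of "sort_desc L" 0 i x y w b 0 0] assms
  by (simp add: shelf_pack_def positive_boxes_sort_desc sum_list_sort_desc)

lemma shelf_pack_horizontal:
  assumes "positive_boxes L" "0 \<le> W" "(i, x, y, w, b) \<in> set (shelf_pack W L)"
  shows "0 \<le> x \<and> 0 \<le> y \<and> (x + w \<le> W \<or> x = 0)"
  using nfdh_horizontal[of "sort_desc L" W i x y w b W 0 0] nfdh_later[of "sort_desc L" 0 i x y w b W W 0] assms
  by (auto simp: shelf_pack_def positive_boxes_sort_desc)

lemma shelf_pack_row:
  assumes "positive_boxes L" "(\<Sum>(i, w, b) \<leftarrow> L. w) \<le> W" "(i, x, y, w, b) \<in> set (shelf_pack W L)"
  shows "y = 0"
  using shelf_pack_unfold[OF assms(1), of W]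
proof (elim disjE exE conjE)
  fix i' w' b' ls assume L: "sort_desc L = (i', w', b') # ls"
    and S: "shelf_pack W L = (i', 0, 0, w', b') # nfdh W w' 0 b' ls"
  have "positive_boxes ls"
    using assms(1) positive_boxes_sort_desc[of L] by (auto simp: L positive_boxes_def)
  moreover have "w' + (\<Sum>(i, w, b) \<leftarrow> ls. w) \<le> W"
    using assms(2) sum_list_sort_desc[of "\<lambda>(i, w, b). w" L] by (simp add: L)
  ultimately show ?thesis using nfdh_row[of ls w' W i x y w b 0 b'] assms(3) by (auto simp: S)
qed (use assms in simp)

text \<open>The first shelf has height at most \<open>e / f * H\<close>, since every box is that
  low. The further shelves are paid for by the area and reach at most \<open>(1 - e / f) * H\<close>
  more. Of the two factors \<open>1 - e / f\<close> in the area bound, one covers the wasted width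
  and the other the first shelf.\<close>

lemma shelf_pack_area:
  assumes "positive_boxes L" "\<forall>(i, w, b) \<in> set L. f * w \<le> e * W \<and> f * b \<le> e * H"
    "0 < f" "e < f" "0 < W" "f * f * (\<Sum>(i, w, b) \<leftarrow> L. w * b) \<le> (f - e) * (f - e) * W * H"
    "(i, x, y, w, b) \<in> set (shelf_pack W L)"
  shows "y + b \<le> H"
  using shelf_pack_unfold[OF assms(1), of W]
proof (elim disjE exE conjE)
  fix i' w' b' ls assume L: "sort_desc L = (i', w', b') # ls"
    and S: "shelf_pack W L = (i', 0, 0, w', b') # nfdh W w' 0 b' ls"
  have pos: "positive_boxes ls" "0 < w'" "0 < b'"
    using assms(1) positive_boxes_sort_desc[of L] by (auto simp: L positive_boxes_def)
  have set: "set L = insert (i', w', b') (set ls)"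
    using mset_eq_setD[OF mset_sort_desc[of L]] by (simp add: L)
  have srt: "sorted_wrt (\<lambda>a b. snd (snd b) \<le> snd (snd a)) ls"
    "\<forall>(i, w, b) \<in> set ls. b \<le> b' \<and> b \<le> b' \<and> f * w \<le> e * W"
    using sorted_sort_desc[of L] assms(2) by (auto simp: L set)
  have b': "f * b' \<le> e * H" using assms(2) by (auto simp: set)
  let ?a = "\<Sum>(i, w, b) \<leftarrow> L. w * b"
  have a: "?a = w' * b' + (\<Sum>(i, w, b) \<leftarrow> ls. w * b)"
    using sum_list_sort_desc[of "\<lambda>(i, w, b). w * b" L] by (simp add: L)
  have a0: "0 \<le> ?a" using assms(1)
    by (intro sum_list_nonneg) (auto simp: positive_boxes_def less_imp_le)
  have p: "0 < (f - e) * W" using assms by simp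
  have "(y + b - b') * ((f - e) * W) \<le> f * ?a"
  proof (cases "(i, x, y, w, b) \<in> set (nfdh W w' 0 b' ls)")
    case True
    have "(y + b - 0 - b') * ((f - e) * W) \<le> f * ((\<Sum>(i, w, b) \<leftarrow> ls. w * b) + w' * b')"
      by (rule nfdh_area[OF pos(1) srt _ _ _ True]) (use pos assms p in auto)
    then show ?thesis by (simp add: a algebra_simps)
  next
    case False
    then have "y + b - b' = 0" using assms(7) by (simp add: S)
    then show ?thesis using a0 assms(3) by simp
  qed
  then have "f * ((y + b - b') * ((f - e) * W)) \<le> f * (f * ?a)"
    using assms(3) by (intro mult_left_mono) auto
  also have "\<dots> \<le> (f - e) * (f - e) * W * H"
    using assms(6) by (simp add: algebra_simps)
  finally have "(f * (y + b - b')) * ((f - e) * W) \<le> ((f - e) * H) * ((f - e) * W)"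
    by (simp add: ac_simps)
  then have "f * (y + b - b') \<le> (f - e) * H" using p by (simp add: mult_le_cancel_right)
  then have "f * (y + b) \<le> f * H" using b' by (simp add: algebra_simps)
  then show ?thesis using assms(3) by simp
qed (use assms in simp)

text \<open>Remove the interval with the largest lower end \<open>lo m\<close>: as lengths are
  positive, all others must end by \<open>lo m\<close>, and the induction hypothesis applies with
  \<open>lo m\<close> in place of \<open>H\<close>.\<close>

lemma stacked_intervals:
  fixes lo :: "'i \<Rightarrow> real"
  assumes "finite A" "\<And>i. i \<in> A \<Longrightarrow> 0 \<le> lo i \<and> lo i + len i \<le> H \<and> 0 < len i"
    "\<And>i j. i \<in> A \<Longrightarrow> j \<in> A \<Longrightarrow> i \<noteq> j \<Longrightarrow> lo i + len i \<le> lo j \<or> lo j + len j \<le> lo i" "0 \<le> H"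
  shows "sum len A \<le> H"
  using assms
proof (induction "card A" arbitrary: A H)
  case (Suc n)
  then have "A \<noteq> {}" by auto
  then have "Max (lo ` A) \<in> lo ` A" using Suc.prems(1) by (intro Max_in) auto
  then obtain m where "m \<in> A" "Max (lo ` A) = lo m" by blast
  then have m: "m \<in> A" "\<And>i. i \<in> A \<Longrightarrow> lo i \<le> lo m"
    using Suc.prems(1) by (simp, metis Max_ge finite_imageI imageI)
  have "sum len (A - {m}) \<le> lo m"
  proof (rule Suc.hyps(1))
    show "n = card (A - {m})" using Suc.hyps(2) m(1) Suc.prems(1) by simp
    show "0 \<le> lo i \<and> lo i + len i \<le> lo m \<and> 0 < len i" if "i \<in> A - {m}" for i
    proof -
      have i: "i \<in> A" "i \<noteq> m" using that by auto
      have "lo i + len i \<le> lo m \<or> lo m + len m \<le> lo i" using Suc.prems(3)[OF i(1) m(1) i(2)] .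
      moreover have "\<not> lo m + len m \<le> lo i" using m(2)[OF i(1)] Suc.prems(2)[OF m(1)] by linarith
      ultimately show ?thesis using Suc.prems(2)[OF i(1)] by blast
    qed
    show "0 \<le> lo m" using Suc.prems(2)[OF m(1)] by blast
  qed (use Suc.prems in auto)
  moreover have "sum len A = len m + sum len (A - {m})"
    using Suc.prems(1) m(1) by (simp add: sum.remove)
  ultimately show ?case using Suc.prems(2)[OF m(1)] by linarith
qed auto

section \<open>Integral form of the container packing problem\<close>

definition to_int :: "int \<Rightarrow> rat \<Rightarrow> int" where
  "to_int Q r = fst (quotient_of r) * (Q div snd (quotient_of r))"

lemma real_to_int:
  assumes "snd (quotient_of r) dvd Q"
  shows "real_of_int (to_int Q r) = of_rat r * real_of_int Q"
proof -
  obtain a b where ab: "quotient_of r = (a, b)" by fastforce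
  have b: "b > 0" by (rule quotient_of_denom_pos[OF ab])
  have r: "real_of_rat r = real_of_int a / real_of_int b"
    using quotient_of_div[OF ab] by (simp add: of_rat_divide)
  from assms obtain q where Q: "Q = b * q" by (auto simp: ab)
  show ?thesis using b by (simp add: to_int_def ab Q r)
qed

text \<open>Records are encoded as lists, which end in \<open>IntV 0\<close>. The last component,
  always 0, supplies this terminator, so that a plain tuple has the same encoding as the
  record.\<close>

type_synonym raw_item = "rat \<times> rat \<times> rat \<times> rat list \<times> int"
type_synonym raw_container = "rat \<times> rat \<times> int \<times> int"
type_synonym raw_instance = "raw_item list \<times> raw_container list \<times> rat \<times> int"
type_synonym int_item = "int \<times> int \<times> int \<times> int list"
type_synonym int_container = "int \<times> int \<times> int"

definition raw_item :: "item \<Rightarrow> raw_item" where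
  "raw_item a = (width a, height a, profit a, weights a, 0)"

fun label_code :: "label \<Rightarrow> int" where
  "label_code Large = 0"
| "label_code Wide = 1"
| "label_code Tall = 2"
| "label_code Area = 3"

definition raw_container :: "container \<Rightarrow> raw_container" where
  "raw_container c = (cwidth c, cheight c, label_code (clabel c), 0)"

definition raw_instance :: "cp_instance \<Rightarrow> raw_instance" where
  "raw_instance I = (map raw_item (items I), map raw_container (containers I), eps' I, 0)"

lemma enc_raw_instance: "enc (raw_instance I) = enc_instance I"
proof -
  have r: "(enc :: rat \<Rightarrow> val) = enc_rat" by (rule ext) (rule enc_rat_inst)
  have "enc (label_code l) = enc_label l" for l by (cases l) simp_all
  then have "enc (raw_container c) = enc_container c" for c
    by (simp add: raw_container_def enc_container_def r)
  moreover have "enc (raw_item a) = enc_item a" for a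
    by (simp add: raw_item_def enc_item_def r enc_list_inst)
  ultimately show ?thesis
    by (simp add: raw_instance_def enc_instance_def r enc_list_inst comp_def)
qed

definition denominators :: "raw_instance \<Rightarrow> int list" where
  "denominators x = concat (map (\<lambda>(w, h, p, ws, _). map (\<lambda>r. snd (quotient_of r)) (w # h # p # ws)) (fst x)) @
     concat (map (\<lambda>(w, h, _). map (\<lambda>r. snd (quotient_of r)) [w, h]) (fst (snd x)))"

definition int_item :: "int \<Rightarrow> raw_item \<Rightarrow> int_item" where
  "int_item Q x = (case x of (w, h, p, ws, _) \<Rightarrow> (to_int Q w, to_int Q h, to_int Q p, map (to_int Q) ws))"

definition int_container :: "int \<Rightarrow> raw_container \<Rightarrow> int_container" where
  "int_container Q x = (case x of (w, h, l, _) \<Rightarrow> (to_int Q w, to_int Q h, l))"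

definition oriented :: "bool \<Rightarrow> int_item \<Rightarrow> int \<times> int" where
  "oriented rot it = (case it of (w, h, _) \<Rightarrow> if rot then (h, w) else (w, h))"

text \<open>Here \<open>\<epsilon>' = e / f\<close>; the bounds for an area container are multiplied by powers of \<open>f\<close>.\<close>

definition fits :: "int \<Rightarrow> int \<Rightarrow> int_container \<Rightarrow> int \<times> int \<Rightarrow> bool" where
  "fits e f C b = (case C of (W, H, l) \<Rightarrow> case b of (w, h) \<Rightarrow>
     w \<le> W \<and> h \<le> H \<and> (l = 3 \<longrightarrow> f * w \<le> e * W \<and> f * h \<le> e * H))"

definition usage :: "int \<Rightarrow> int \<Rightarrow> int \<times> int \<Rightarrow> int" where
  "usage f l b = (case b of (w, h) \<Rightarrow>
     if l = 0 then 1 else if l = 1 then h else if l = 2 then w else f * f * (w * h))"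

definition capacity :: "int \<Rightarrow> int \<Rightarrow> int_container \<Rightarrow> int" where
  "capacity e f C = (case C of (W, H, l) \<Rightarrow>
     if l = 0 then 1 else if l = 1 then H else if l = 2 then W else (f - e) * (f - e) * W * H)"

definition usage_vec :: "int \<Rightarrow> int_container list \<Rightarrow> nat \<Rightarrow> int \<times> int \<Rightarrow> int list \<Rightarrow> int list" where
  "usage_vec f cs c b ws =
     map (\<lambda>(j, _, _, l). if j = c then usage f l b else 0) (List.enumerate 0 cs) @ ws"

definition placements :: "bool list \<Rightarrow> int \<Rightarrow> int \<Rightarrow> int_container list \<Rightarrow> int_item \<Rightarrow> (nat \<times> bool) opt list" where
  "placements rots e f cs it = concat (map (\<lambda>(j, C). concat (map (\<lambda>rot.
     if fits e f C (oriented rot it)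
     then [((j, rot), usage_vec f cs j (oriented rot it) (snd (snd (snd it))))] else []) rots))
     (List.enumerate 0 cs))"

definition knapsack_items :: "bool list \<Rightarrow> int \<Rightarrow> int \<Rightarrow> int_container list \<Rightarrow> int_item list \<Rightarrow>
    (int \<times> (nat \<times> bool) opt list) list" where
  "knapsack_items rots e f cs its = map (\<lambda>it. (fst (snd (snd it)), placements rots e f cs it)) its"

text \<open>The weight bound 1 becomes \<open>Q\<close> because weights are scaled by
  \<open>Q\<close>. Lengths are scaled by \<open>Q\<close> and areas by its square, on both sides of
  their constraints.\<close>

definition capacities :: "nat \<Rightarrow> int \<Rightarrow> int \<Rightarrow> int \<Rightarrow> int_container list \<Rightarrow> int list" where
  "capacities d Q e f cs = map (capacity e f) cs @ map (\<lambda>_. Q) [0..<d]"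

definition boxes :: "int_item list \<Rightarrow> (nat \<times> bool) opt option list \<Rightarrow> (nat \<times> nat box) list" where
  "boxes its c = concat (map (\<lambda>(i, it, g). case g of None \<Rightarrow> []
     | Some a \<Rightarrow> [(fst (fst a), i, oriented (snd (fst a)) it)]) (List.enumerate 0 (zip its c)))"

definition boxes_in :: "int_item list \<Rightarrow> (nat \<times> bool) opt option list \<Rightarrow> nat \<Rightarrow> nat box list" where
  "boxes_in its c j = map snd (filter (\<lambda>p. fst p = j) (boxes its c))"

text \<open>Shelves of width \<open>0\<close> hold one box each, so that wide containers are stacked; in tall and large
  containers everything goes to the first shelf.\<close>

definition container_positions :: "int_item list \<Rightarrow> (nat \<times> bool) opt option list \<Rightarrow> nat \<Rightarrow> int_container \<Rightarrow>
    nat placed_box list" where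
  "container_positions its c j C =
     (case C of (W, H, l) \<Rightarrow> shelf_pack (if l = 1 then 0 else W) (boxes_in its c j))"

definition positions :: "int_item list \<Rightarrow> int_container list \<Rightarrow> (nat \<times> bool) opt option list \<Rightarrow> nat placed_box list" where
  "positions its cs c = concat (map (\<lambda>(j, C). container_positions its c j C) (List.enumerate 0 cs))"

section \<open>Boxes and options that arise from a choice\<close>

lemma set_boxes_in:
  assumes "length c = length its"
  shows "(i, b) \<in> set (boxes_in its c j) \<longleftrightarrow>
    i < length its \<and> (\<exists>rot v. c ! i = Some ((j, rot), v) \<and> b = oriented rot (its ! i))"
proof -
  have "(i, b) \<in> set (boxes_in its c j) \<longleftrightarrow> (j, i, b) \<in> set (boxes its c)"
    by (force simp: boxes_in_def)
  also have "\<dots> \<longleftrightarrow> (\<exists>p \<in> set (List.enumerate 0 (zip its c)). \<exists>a. snd (snd p) = Some a \<and>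
      (j, i, b) = (fst (fst a), fst p, oriented (snd (fst a)) (fst (snd p))))"
  proof -
    have "(j, i, b) \<in> set (case p of (i, it, g) \<Rightarrow> case g of None \<Rightarrow> []
        | Some a \<Rightarrow> [(fst (fst a), i, oriented (snd (fst a)) it)]) \<longleftrightarrow>
      (\<exists>a. snd (snd p) = Some a \<and> (j, i, b) = (fst (fst a), fst p, oriented (snd (fst a)) (fst (snd p))))"
      for p :: "nat \<times> int_item \<times> (nat \<times> bool) opt option"
      by (cases p) (auto split: option.split)
    then show ?thesis
      by (simp only: boxes_def set_concat set_map UN_iff bex_simps)
  qed
  also have "\<dots> \<longleftrightarrow> (\<exists>i' < length its. \<exists>a. c ! i' = Some a \<and>
      (j, i, b) = (fst (fst a), i', oriented (snd (fst a)) (its ! i')))"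
  proof -
    have "set (List.enumerate 0 (zip its c)) = (\<lambda>i. (i, its ! i, c ! i)) ` {..<length its}"
      using assms by (auto simp: in_set_enumerate_eq image_iff prod_eq_iff)
    then show ?thesis by simp blast
  qed
  also have "\<dots> \<longleftrightarrow> i < length its \<and> (\<exists>rot v. c ! i = Some ((j, rot), v) \<and> b = oriented rot (its ! i))"
    by auto
  finally show ?thesis .
qed

lemma distinct_boxes_in: "distinct (boxes_in its c j)"
proof -
  \<comment> \<open>The tags are positions in an enumeration; the second conjunct records that they
    start at \<open>n\<close>, which separates the head from the rest.\<close>
  have gen: "distinct (map fst (concat (map (\<lambda>(i, x). if P i x then [(i, g i x)] else []) (List.enumerate n xs)))) \<and>
      (\<forall>i \<in> fst ` set (concat (map (\<lambda>(i, x). if P i x then [(i, g i x)] else []) (List.enumerate n xs))). n \<le> i)"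
    for P and g :: "nat \<Rightarrow> 'a \<Rightarrow> 'b" and n xs
  proof (induction xs arbitrary: n)
    case (Cons x xs)
    from Cons.IH[of "Suc n"] show ?case by force
  qed simp
  have "boxes_in its c j = concat (map (\<lambda>(i, x). if (case snd x of None \<Rightarrow> False | Some a \<Rightarrow> fst (fst a) = j)
      then [(i, oriented (snd (fst (the (snd x)))) (fst x))] else []) (List.enumerate 0 (zip its c)))"
    (is "_ = concat (map ?h _)")
  proof -
    have "map snd (filter (\<lambda>p. fst p = j) (concat (map (\<lambda>(i, it, g). case g of None \<Rightarrow> []
       | Some a \<Rightarrow> [(fst (fst a), i, oriented (snd (fst a)) it)]) ys))) = concat (map ?h ys)" for ys
      by (induction ys) (auto split: option.split)
    then show ?thesis by (simp add: boxes_in_def boxes_def)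
  qed
  with gen[of "\<lambda>i x. case snd x of None \<Rightarrow> False | Some a \<Rightarrow> fst (fst a) = j"
      "\<lambda>i x. oriented (snd (fst (the (snd x)))) (fst x)" 0 "zip its c"]
  show ?thesis by (metis (no_types, lifting) distinct_map)
qed

lemma placements_iff:
  "a \<in> set (placements rots e f cs it) \<longleftrightarrow> (\<exists>j < length cs. \<exists>rot \<in> set rots.
     fits e f (cs ! j) (oriented rot it) \<and> a = ((j, rot), usage_vec f cs j (oriented rot it) (snd (snd (snd it)))))"
proof -
  have "set (List.enumerate 0 cs) = (\<lambda>j. (j, cs ! j)) ` {..<length cs}"
    by (auto simp: in_set_enumerate_eq image_iff prod_eq_iff)
  then show ?thesis
    by (simp add: placements_def case_prod_beta del: split_paired_Ex) (auto split: if_splits)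
qed

lemma length_usage_vec [simp]: "length (usage_vec f cs c b ws) = length cs + length ws"
  by (simp add: usage_vec_def)

lemma nth_usage_vec:
  "j < length cs \<Longrightarrow> usage_vec f cs c b ws ! j = (if j = c then usage f (snd (snd (cs ! j))) b else 0)"
  "usage_vec f cs c b ws ! (length cs + t) = ws ! t"
  by (simp_all add: usage_vec_def nth_append nth_enumerate_eq case_prod_beta)

lemma sorted_wrt_two:
  assumes "sorted_wrt R xs" "p \<in> set xs" "q \<in> set xs" "p \<noteq> q"
  shows "R p q \<or> R q p"
  using assms by (induction xs) auto

text \<open>The knapsack constraint is turned into coordinates: a stack reaches the total height, a
  row takes the total width, a large container has a row with at most one box, and
  \<open>shelf_pack_area\<close> handles area containers.\<close>

lemma container_positions_correct:
  assumes L: "positive_boxes L" "\<forall>(i, b) \<in> set L. fits e f (W, H, l) b"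
    and cap: "(\<Sum>(i, b) \<leftarrow> L. usage f l b) \<le> capacity e f (W, H, l)"
    and ef: "0 < f" "e < f" and WH: "0 < W" "0 < H" and l: "l \<in> {0, 1, 2, 3}"
    and p: "(i, x, y, w, b) \<in> set (shelf_pack (if l = 1 then 0 else W) L)"
  shows "0 \<le> x \<and> x + w \<le> W \<and> 0 \<le> y \<and> y + b \<le> H \<and> (l \<in> {0, 2} \<longrightarrow> y = 0) \<and> (l = 1 \<longrightarrow> x = 0)"
proof -
  have "(\<lambda>(i, b). usage f l b) = (\<lambda>(i :: 'a, w, h). usage f l (w, h))" by (auto simp: fun_eq_iff)
  then have cap: "(\<Sum>(i, w, h) \<leftarrow> L. usage f l (w, h)) \<le> capacity e f (W, H, l)" using cap by simp
  have "(i, w, b) \<in> set L" using set_box_of_shelf_pack[of _ L] p by force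
  then have wb: "0 < w" "0 < b" "fits e f (W, H, l) (w, b)"
    using L by (auto simp: positive_boxes_def)
  then have wb': "w \<le> W" "b \<le> H" by (auto simp: fits_def)
  show ?thesis
  proof (cases "l = 1")
    case True
    then show ?thesis
      using shelf_pack_stack[OF L(1), of i x y w b] p wb wb' cap
      by (auto simp: usage_def capacity_def)
  next
    case False
    then have p: "(i, x, y, w, b) \<in> set (shelf_pack W L)" using p by simp
    have h: "0 \<le> x" "0 \<le> y" "x + w \<le> W"
      using shelf_pack_horizontal[OF L(1) _ p] WH wb' by auto
    have y: "y = 0" if "l = 0 \<or> l = 2"
    proof (rule shelf_pack_row[OF L(1) _ p])
      show "(\<Sum>(i, w, b) \<leftarrow> L. w) \<le> W"
      proof (cases "l = 2")
        case True
        then show ?thesis using cap by (simp add: usage_def capacity_def)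
      next
        case False
        with that have "(\<Sum>(i, w, h) \<leftarrow> L. 1 :: int) \<le> 1" using cap by (simp add: usage_def capacity_def)
        moreover have "(\<Sum>(i, w, h) \<leftarrow> L. 1 :: int) = int (length L)" by (induction L) auto
        ultimately have "length L \<le> 1" by simp
        with \<open>(i, w, b) \<in> set L\<close> have "L = [(i, w, b)]" by (cases L) auto
        then show ?thesis using wb' by simp
      qed
    qed
    show ?thesis
    proof (cases "l = 3")
      case True
      have "\<forall>(i, w, b) \<in> set L. f * w \<le> e * W \<and> f * b \<le> e * H"
        using L(2) True by (auto simp: fits_def)
      moreover have "f * f * (\<Sum>(i, w, b) \<leftarrow> L. w * b) \<le> (f - e) * (f - e) * W * H"
      proof -
        have "(\<Sum>(i, w, h) \<leftarrow> K. f * f * (w * h)) = f * f * (\<Sum>(i, w, b) \<leftarrow> K. w * b)" for K :: "'a box list"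
          by (induction K) (auto simp: distrib_left)
        then show ?thesis using cap True by (simp add: usage_def capacity_def)
      qed
      ultimately have "y + b \<le> H" using shelf_pack_area[OF L(1) _ ef WH(1) _ p] by blast
      then show ?thesis using h True by simp
    next
      case False
      with \<open>l \<noteq> 1\<close> l have "l = 0 \<or> l = 2" by auto
      with y h wb' wb show ?thesis by auto
    qed
  qed
qed

section \<open>Translation of instances and of choices\<close>

lemma member_dvd_prod_list: "(a :: int) \<in> set xs \<Longrightarrow> a dvd prod_list xs"
  by (induction xs) auto

text \<open>The product takes the place of a least common multiple: no greatest common divisors have
  to be computed, and its bit length is still at most about the total size of the factors.\<close>

definition common_den :: "raw_instance \<Rightarrow> int" where
  "common_den x = prod_list (denominators x)"

definition den_of :: "cp_instance \<Rightarrow> int" where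
  "den_of I = common_den (raw_instance I)"

definition items_of :: "cp_instance \<Rightarrow> int_item list" where
  "items_of I = map (int_item (den_of I) \<circ> raw_item) (items I)"

definition containers_of :: "cp_instance \<Rightarrow> int_container list" where
  "containers_of I = map (int_container (den_of I) \<circ> raw_container) (containers I)"

definition eps_num :: "cp_instance \<Rightarrow> int" where
  "eps_num I = fst (quotient_of (eps' I))"

definition eps_den :: "cp_instance \<Rightarrow> int" where
  "eps_den I = snd (quotient_of (eps' I))"

definition rots :: "bool \<Rightarrow> bool list" where
  "rots rotation = (if rotation then [False, True] else [False])"

definition kitems :: "bool \<Rightarrow> cp_instance \<Rightarrow> (int \<times> (nat \<times> bool) opt list) list" where
  "kitems rotation I =
     knapsack_items (rots rotation) (eps_num I) (eps_den I) (containers_of I) (items_of I)"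

definition kcaps :: "nat \<Rightarrow> cp_instance \<Rightarrow> int list" where
  "kcaps d I = capacities d (den_of I) (eps_num I) (eps_den I) (containers_of I)"

text \<open>The inner \<open>None\<close> case is only a default: for an admissible choice every
  chosen item occurs in \<open>positions\<close>. All coordinates are written over the denominator
  \<open>Q\<close>, and the final 0 closes the list of the entry.\<close>

definition encode_choice :: "int \<Rightarrow> int_item list \<Rightarrow> int_container list \<Rightarrow> (nat \<times> bool) opt option list \<Rightarrow> val list" where
  "encode_choice Q its cs c = (let ps = positions its cs c in
     map (\<lambda>(i, g). case g of None \<Rightarrow> IntV 0 | Some a \<Rightarrow>
       (case map_of ps i of None \<Rightarrow> IntV 0
        | Some q \<Rightarrow> enc (fst (fst a), snd (fst a), (fst q, Q), (fst (snd q), Q), 0 :: int)))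
     (List.enumerate 0 c))"

text \<open>Mirrors \<open>encode_choice\<close> entry by entry, so that the representation relation
  can be checked pointwise.\<close>

definition solution_of :: "int \<Rightarrow> int_item list \<Rightarrow> int_container list \<Rightarrow> (nat \<times> bool) opt option list \<Rightarrow> solution" where
  "solution_of Q its cs c =
     map (\<lambda>(i, g). case g of None \<Rightarrow> None | Some a \<Rightarrow>
       (case map_of (positions its cs c) i of None \<Rightarrow> None
        | Some q \<Rightarrow> Some \<lparr>cont = fst (fst a), rotated = snd (fst a),
            xpos = real_of_int (fst q) / real_of_int Q, ypos = real_of_int (fst (snd q)) / real_of_int Q\<rparr>))
     (List.enumerate 0 c)"

lemma repr_encode_choice:
  assumes "Q \<noteq> 0"
  shows "repr_solution (enc (encode_choice Q its cs c)) (solution_of Q its cs c)"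
proof -
  have "list_all2 repr_entry (encode_choice Q its cs c) (solution_of Q its cs c)"
    unfolding encode_choice_def solution_of_def Let_def list_all2_map1 list_all2_map2
    by (rule list_all2_refl)
      (use assms in \<open>auto simp: repr_coord_def split: option.split\<close>)
  moreover have "enc (encode_choice Q its cs c) = enc_list (encode_choice Q its cs c)"
    by (simp add: enc_list_inst enc_val_def[abs_def])
  ultimately show ?thesis unfolding repr_solution_def by blast
qed

text \<open>Positive dimensions make the rectangle nonempty, so its lower left and upper right
  corners witness the bounds; an empty rectangle would lie inside anything.\<close>

lemma rect_subset_iff:
  assumes "0 < pwidth I S i" "0 < pheight I S i"
  shows "rect I S i \<subseteq> {0..W} \<times> {0..H} \<longleftrightarrow>
    0 \<le> left_edge S i \<and> right_edge I S i \<le> W \<and> 0 \<le> bottom_edge S i \<and> top_edge I S i \<le> H"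
proof
  assume sub: "rect I S i \<subseteq> {0..W} \<times> {0..H}"
  have "(left_edge S i, bottom_edge S i) \<in> rect I S i" "(right_edge I S i, top_edge I S i) \<in> rect I S i"
    using assms by (simp_all add: rect_def right_edge_def top_edge_def)
  with sub show "0 \<le> left_edge S i \<and> right_edge I S i \<le> W \<and> 0 \<le> bottom_edge S i \<and> top_edge I S i \<le> H"
    by auto
qed (auto simp: rect_def)

section \<open>Packings correspond to fitting choices of equal profit\<close>

context
  fixes I :: cp_instance and d k :: nat and rotation :: bool
  assumes valid: "valid_instance d k I"
begin

lemma den_pos: "0 < den_of I"
proof -
  have "\<forall>a \<in> set (denominators (raw_instance I)). 0 < a"
    by (auto simp: denominators_def quotient_of_denom_pos')
  moreover have "0 < prod_list xs" if "\<forall>a \<in> set xs. 0 < a" for xs :: "int list"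
    using that by (induction xs) auto
  ultimately show ?thesis by (simp add: den_of_def common_den_def)
qed

lemma to_int_facts:
  assumes "snd (quotient_of r) \<in> set (denominators (raw_instance I))"
  shows "real_of_int (to_int (den_of I) r) = of_rat r * real_of_int (den_of I)"
    "0 < to_int (den_of I) r \<longleftrightarrow> 0 < r" "0 \<le> to_int (den_of I) r \<longleftrightarrow> 0 \<le> r"
proof -
  have "snd (quotient_of r) dvd den_of I"
    using assms unfolding den_of_def common_den_def by (rule member_dvd_prod_list)
  then show *: "real_of_int (to_int (den_of I) r) = of_rat r * real_of_int (den_of I)"
    by (rule real_to_int)
  have "0 < real_of_int (to_int (den_of I) r) \<longleftrightarrow> 0 < r" "0 \<le> real_of_int (to_int (den_of I) r) \<longleftrightarrow> 0 \<le> r"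
    unfolding * using den_pos by (simp_all add: zero_less_mult_iff zero_le_mult_iff)
  then show "0 < to_int (den_of I) r \<longleftrightarrow> 0 < r" "0 \<le> to_int (den_of I) r \<longleftrightarrow> 0 \<le> r"
    by simp_all
qed

lemma eps_facts: "0 < eps_num I" "eps_num I < eps_den I" "0 < eps_den I"
  "real_of_rat (eps' I) = real_of_int (eps_num I) / real_of_int (eps_den I)"
proof -
  obtain a b where ab: "quotient_of (eps' I) = (a, b)" by fastforce
  have b: "0 < b" by (rule quotient_of_denom_pos[OF ab])
  have e: "eps' I = of_int a / of_int b" by (rule quotient_of_div[OF ab])
  have "0 < eps' I" "eps' I < 1" using valid by (auto simp: valid_instance_def)
  then have "0 < a" "a < b"
    using b by (simp_all add: e zero_less_divide_iff divide_less_eq)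
  moreover have n: "eps_num I = a" "eps_den I = b" by (simp_all add: eps_num_def eps_den_def ab)
  ultimately show "0 < eps_num I" "eps_num I < eps_den I" "0 < eps_den I" using b by simp_all
  show "real_of_rat (eps' I) = real_of_int (eps_num I) / real_of_int (eps_den I)"
    unfolding n by (simp add: e of_rat_divide)
qed

lemma item_ints:
  assumes "i < length (items I)"
  defines "a \<equiv> items I ! i"
  shows "\<exists>w h p ws. items_of I ! i = (w, h, p, ws) \<and>
    real_of_int w = of_rat (width a) * real_of_int (den_of I) \<and>
    real_of_int h = of_rat (height a) * real_of_int (den_of I) \<and>
    real_of_int p = of_rat (profit a) * real_of_int (den_of I) \<and> length ws = d \<and>
    (\<forall>t < d. real_of_int (ws ! t) = of_rat (weights a ! t) * real_of_int (den_of I)) \<and>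
    0 < w \<and> 0 < h \<and> 0 \<le> p \<and> (\<forall>t < d. 0 \<le> ws ! t)"
proof -
  have a: "a \<in> set (items I)" using assms by simp
  then have v: "0 < width a" "0 < height a" "0 \<le> profit a" "length (weights a) = d"
    "\<And>t. t < d \<Longrightarrow> 0 \<le> weights a ! t"
    using valid by (auto simp: valid_instance_def)
  have "snd (quotient_of r) \<in> set (denominators (raw_instance I))"
    if "r \<in> set (width a # height a # profit a # weights a)" for r
    using a that by (auto simp: denominators_def raw_instance_def raw_item_def)
  note r = to_int_facts[OF this]
  show ?thesis
    using assms v r
    by (intro exI[of _ "to_int (den_of I) (width a)"] exI[of _ "to_int (den_of I) (height a)"]
        exI[of _ "to_int (den_of I) (profit a)"] exI[of _ "map (to_int (den_of I)) (weights a)"])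
      (auto simp: items_of_def int_item_def raw_item_def)
qed

lemma container_ints:
  assumes "j < length (containers I)"
  defines "C \<equiv> containers I ! j"
  shows "\<exists>W H. containers_of I ! j = (W, H, label_code (clabel C)) \<and>
    real_of_int W = of_rat (cwidth C) * real_of_int (den_of I) \<and>
    real_of_int H = of_rat (cheight C) * real_of_int (den_of I) \<and> 0 < W \<and> 0 < H"
proof -
  have C: "C \<in> set (containers I)" using assms by simp
  then have v: "0 < cwidth C" "0 < cheight C"
    using valid by (auto simp: valid_instance_def)
  have "snd (quotient_of r) \<in> set (denominators (raw_instance I))" if "r \<in> {cwidth C, cheight C}" for r
    using C that by (auto simp: denominators_def raw_instance_def raw_container_def)
  note r = to_int_facts[OF this]
  show ?thesis
    using assms v r
    by (intro exI[of _ "to_int (den_of I) (cwidth C)"] exI[of _ "to_int (den_of I) (cheight C)"])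
      (auto simp: containers_of_def int_container_def raw_container_def)
qed

lemma lengths [simp]: "length (items_of I) = length (items I)"
  "length (containers_of I) = length (containers I)" "length (kitems rotation I) = length (items I)"
  "length (kcaps d I) = length (containers I) + d"
  by (simp_all add: items_of_def containers_of_def kitems_def knapsack_items_def kcaps_def capacities_def)

lemma kcaps_nth:
  "j < length (containers I) \<Longrightarrow> kcaps d I ! j = capacity (eps_num I) (eps_den I) (containers_of I ! j)"
  "t < d \<Longrightarrow> kcaps d I ! (length (containers I) + t) = den_of I"
  using lengths(2) by (simp_all add: kcaps_def capacities_def nth_append)

lemma kitems_nth:
  "i < length (items I) \<Longrightarrow> kitems rotation I ! i = (fst (snd (snd (items_of I ! i))),
    placements (rots rotation) (eps_num I) (eps_den I) (containers_of I) (items_of I ! i))"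
  by (simp add: kitems_def knapsack_items_def)

lemma oriented_ints:
  assumes "i < length (items I)"
  shows "0 < fst (oriented rot (items_of I ! i))" "0 < snd (oriented rot (items_of I ! i))"
    "real_of_int (fst (oriented rot (items_of I ! i))) =
      of_rat (if rot then height (items I ! i) else width (items I ! i)) * real_of_int (den_of I)"
    "real_of_int (snd (oriented rot (items_of I ! i))) =
      of_rat (if rot then width (items I ! i) else height (items I ! i)) * real_of_int (den_of I)"
  using item_ints[OF assms] by (auto simp: oriented_def)

lemma usage_nonneg: "i < length (items I) \<Longrightarrow> 0 \<le> usage (eps_den I) l (oriented rot (items_of I ! i))"
  using oriented_ints(1,2)[of i rot] by (auto simp: usage_def case_prod_beta)

lemma capacity_nonneg:
  assumes "j < length (containers I)"
  shows "0 \<le> capacity (eps_num I) (eps_den I) (containers_of I ! j)"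
proof -
  obtain W H where C: "containers_of I ! j = (W, H, label_code (clabel (containers I ! j)))" "0 < W" "0 < H"
    using container_ints[OF assms] by blast
  then show ?thesis using eps_facts by (auto simp: capacity_def)
qed

lemma kcaps_nonneg: "\<forall>b \<in> set (kcaps d I). 0 \<le> b"
proof
  fix b assume "b \<in> set (kcaps d I)"
  then obtain j where j: "j < length (containers I) + d" "b = kcaps d I ! j"
    by (auto simp: in_set_conv_nth)
  show "0 \<le> b"
  proof (cases "j < length (containers I)")
    case True
    then show ?thesis using capacity_nonneg j kcaps_nth(1) by simp
  next
    case False
    then obtain t where "j = length (containers I) + t" "t < d" using j by (metis add_less_cancel_left le_Suc_ex not_less)
    then show ?thesis using kcaps_nth(2)[of t] j den_pos by simp
  qed
qed

lemma wf_kitems: "wf_items (length (kcaps d I)) (kitems rotation I)"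
  unfolding wf_items_def
proof (intro ballI conjI)
  fix it assume "it \<in> set (kitems rotation I)"
  then obtain i where i: "i < length (items I)" "it = kitems rotation I ! i"
    by (auto simp: in_set_conv_nth)
  obtain w h p ws where it: "items_of I ! i = (w, h, p, ws)" "0 \<le> p" "length ws = d" "\<forall>t < d. 0 \<le> ws ! t"
    using item_ints[OF i(1)] by blast
  show "0 \<le> fst it" using it i by (simp add: kitems_nth)
  fix a assume "a \<in> set (snd it)"
  then obtain j rot where j: "j < length (containers I)"
    "a = ((j, rot), usage_vec (eps_den I) (containers_of I) j (oriented rot (items_of I ! i)) ws)"
    using i it by (auto simp: kitems_nth placements_iff)
  show "length (snd a) = length (kcaps d I)" using j it by simp
  fix b assume "b \<in> set (snd a)"
  then show "0 \<le> b" using j it usage_nonneg[OF i(1), of _ rot]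
    by (auto simp: usage_vec_def in_set_conv_nth nth_enumerate_eq case_prod_beta)
qed

definition chosen :: "(nat \<times> bool) opt option list \<Rightarrow> nat \<Rightarrow> nat set" where
  "chosen c j = {i. i < length (items I) \<and> (\<exists>rot v. c ! i = Some ((j, rot), v))}"

lemma admissible_choice:
  assumes "admissible (kitems rotation I) c" "i < length (items I)" "c ! i = Some ((j, rot), v)"
  shows "j < length (containers I)" "rot \<longrightarrow> rotation"
    "fits (eps_num I) (eps_den I) (containers_of I ! j) (oriented rot (items_of I ! i))"
    "v = usage_vec (eps_den I) (containers_of I) j (oriented rot (items_of I ! i)) (snd (snd (snd (items_of I ! i))))"
proof -
  have "((j, rot), v) \<in> set (snd (kitems rotation I ! i))"
    using assms by (simp add: admissible_def)
  then show "j < length (containers I)" "rot \<longrightarrow> rotation"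
    "fits (eps_num I) (eps_den I) (containers_of I ! j) (oriented rot (items_of I ! i))"
    "v = usage_vec (eps_den I) (containers_of I) j (oriented rot (items_of I ! i)) (snd (snd (snd (items_of I ! i))))"
    using assms(2) by (auto simp: kitems_nth placements_iff rots_def split: if_splits)
qed

lemma load_container:
  assumes adm: "admissible (kitems rotation I) c" and j: "j < length (containers I)"
  shows "load c j = (\<Sum>i \<in> chosen c j. usage (eps_den I) (snd (snd (containers_of I ! j)))
    (oriented (snd (fst (the (c ! i)))) (items_of I ! i)))"
proof -
  let ?u = "\<lambda>i. usage (eps_den I) (snd (snd (containers_of I ! j))) (oriented (snd (fst (the (c ! i)))) (items_of I ! i))"
  have "load c j = (\<Sum>i<length (items I). contrib j (c ! i))"
    using adm by (simp add: load_def admissible_def)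
  also have "\<dots> = (\<Sum>i<length (items I). if i \<in> chosen c j then ?u i else 0)"
  proof (rule sum.cong)
    fix i assume "i \<in> {..<length (items I)}"
    then have i: "i < length (items I)" by simp
    show "contrib j (c ! i) = (if i \<in> chosen c j then ?u i else 0)"
    proof (cases "c ! i")
      case (Some a)
      obtain j' rot v where a: "a = ((j', rot), v)" by (metis surj_pair)
      from admissible_choice(4)[OF adm i, of j' rot v] Some a j i show ?thesis
        by (auto simp: chosen_def nth_usage_vec)
    qed (simp add: chosen_def)
  qed simp
  also have "\<dots> = sum ?u (chosen c j)" by (rule sum_if_member) (auto simp: chosen_def)
  finally show ?thesis .
qed

lemma load_weight:
  assumes adm: "admissible (kitems rotation I) c" and t: "t < d"
  shows "real_of_int (load c (length (containers I) + t)) =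
    (\<Sum>i | i < length (items I) \<and> c ! i \<noteq> None. of_rat (weights (items I ! i) ! t)) * real_of_int (den_of I)"
proof -
  let ?A = "{i. i < length (items I) \<and> c ! i \<noteq> None}"
  let ?u = "\<lambda>i. of_rat (weights (items I ! i) ! t) * real_of_int (den_of I)"
  have "real_of_int (load c (length (containers I) + t)) =
      (\<Sum>i<length (items I). real_of_int (contrib (length (containers I) + t) (c ! i)))"
    using adm by (simp add: load_def admissible_def)
  also have "\<dots> = (\<Sum>i<length (items I). if i \<in> ?A then ?u i else 0)"
  proof (rule sum.cong)
    fix i assume "i \<in> {..<length (items I)}"
    then have i: "i < length (items I)" by simp
    show "real_of_int (contrib (length (containers I) + t) (c ! i)) = (if i \<in> ?A then ?u i else 0)"
    proof (cases "c ! i")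
      case (Some a)
      obtain j' rot v where a: "a = ((j', rot), v)" by (metis surj_pair)
      from admissible_choice(4)[OF adm i, of j' rot v] Some a i item_ints[OF i] t
        nth_usage_vec(2)[of _ "containers_of I"] show ?thesis
        by auto
    qed simp
  qed simp
  also have "\<dots> = sum ?u ?A" by (rule sum_if_member) auto
  finally show ?thesis by (simp add: sum_distrib_right)
qed

lemma gain_profit:
  "real_of_int (gain (kitems rotation I) c) =
    (\<Sum>i | i < length (items I) \<and> c ! i \<noteq> None. of_rat (profit (items I ! i))) * real_of_int (den_of I)"
proof -
  let ?A = "{i. i < length (items I) \<and> c ! i \<noteq> None}"
  let ?u = "\<lambda>i. of_rat (profit (items I ! i)) * real_of_int (den_of I)"
  have "real_of_int (gain (kitems rotation I) c) =
      (\<Sum>i<length (items I). real_of_int (if c ! i = None then 0 else fst (kitems rotation I ! i)))"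
    by (simp add: gain_def)
  also have "\<dots> = (\<Sum>i<length (items I). if i \<in> ?A then ?u i else 0)"
  proof (rule sum.cong)
    fix i assume "i \<in> {..<length (items I)}"
    then have i: "i < length (items I)" by simp
    show "real_of_int (if c ! i = None then 0 else fst (kitems rotation I ! i)) = (if i \<in> ?A then ?u i else 0)"
      using i item_ints[OF i] by (auto simp: kitems_nth)
  qed simp
  also have "\<dots> = sum ?u ?A" by (rule sum_if_member) auto
  finally show ?thesis by (simp add: sum_distrib_right)
qed

text \<open>Coordinates are forgotten; what remains of the packing conditions are bounds on sums. In
  wide and tall containers these follow from disjoint intervals along one axis. Together with the
  converse below, no profit is gained or lost by passing to the knapsack problem.\<close>

lemma packing_to_choice:
  assumes S: "feasible_packing rotation d I S"
  shows "\<exists>c. fitting (kitems rotation I) (kcaps d I) c \<and>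
    real_of_int (gain (kitems rotation I) c) = total_profit I S * real_of_int (den_of I)"
proof -
  let ?n = "length (items I)" and ?its = "items_of I" and ?cs = "containers_of I"
  let ?Q = "real_of_int (den_of I)" and ?e = "eps_num I" and ?f = "eps_den I"
  have lenS: "length S = ?n" using S by (simp add: feasible_packing_def)
  define ch where "ch i = (case S ! i of None \<Rightarrow> None | Some p \<Rightarrow> Some ((cont p, rotated p),
    usage_vec ?f ?cs (cont p) (oriented (rotated p) (?its ! i)) (snd (snd (snd (?its ! i))))))" for i
  define c where "c = map ch [0..<?n]"
  have c: "length c = ?n" "\<And>i. i < ?n \<Longrightarrow> c ! i = ch i" by (simp_all add: c_def)
  have packed: "packed S = {i. i < ?n \<and> c ! i \<noteq> None}"
    using c by (auto simp: packed_def lenS ch_def split: option.splits)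
  have dims: "real_of_int (fst (oriented (rotated p) (?its ! i))) = pwidth I S i * ?Q"
      "real_of_int (snd (oriented (rotated p) (?its ! i))) = pheight I S i * ?Q"
      "0 < pwidth I S i" "0 < pheight I S i"
    if "i < ?n" "S ! i = Some p" for i p
  proof -
    show *: "real_of_int (fst (oriented (rotated p) (?its ! i))) = pwidth I S i * ?Q"
      "real_of_int (snd (oriented (rotated p) (?its ! i))) = pheight I S i * ?Q"
      using oriented_ints(3,4)[OF that(1)] that(2) by (simp_all add: pwidth_def pheight_def)
    have "0 < pwidth I S i * ?Q" "0 < pheight I S i * ?Q"
      using oriented_ints(1,2)[OF that(1), of "rotated p"] unfolding *[symmetric] by simp_all
    then show "0 < pwidth I S i" "0 < pheight I S i"
      using den_pos by (simp_all add: zero_less_mult_iff)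
  qed
  have ok: "container_ok I S j" if "j < length (containers I)" for j
    using S that by (simp add: feasible_packing_def)
  have pin: "i \<in> packed_in S j \<longleftrightarrow> i < ?n \<and> (\<exists>p. S ! i = Some p \<and> cont p = j)" for i j
    by (auto simp: packed_in_def packed_def lenS)
  have inside: "0 \<le> left_edge S i \<and> right_edge I S i \<le> of_rat (cwidth (containers I ! j)) \<and>
      0 \<le> bottom_edge S i \<and> top_edge I S i \<le> of_rat (cheight (containers I ! j))"
    if jm: "j < length (containers I)" and ij: "i \<in> packed_in S j" for i j
  proof -
    obtain p where p: "i < ?n" "S ! i = Some p" using ij pin by blast
    have "rect I S i \<subseteq> {0..of_rat (cwidth (containers I ! j))} \<times> {0..of_rat (cheight (containers I ! j))}"
      using ok[OF jm] ij by (simp add: container_ok_def Let_def)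
    then show ?thesis by (simp only: rect_subset_iff[OF dims(3,4)[OF p]])
  qed
  have adm: "admissible (kitems rotation I) c"
    unfolding admissible_def
  proof (intro conjI allI impI)
    show "length c = length (kitems rotation I)" using c(1) by simp
    fix i a assume "i < length (kitems rotation I)" and a: "c ! i = Some a"
    then have i: "i < ?n" by simp
    with a c obtain p where p: "S ! i = Some p" and a: "a = ((cont p, rotated p),
        usage_vec ?f ?cs (cont p) (oriented (rotated p) (?its ! i)) (snd (snd (snd (?its ! i)))))"
      by (auto simp: ch_def split: option.splits)
    have "i \<in> packed S" using i p lenS by (simp add: packed_def)
    then have j: "cont p < length (containers I)" and rot: "rotated p \<longrightarrow> rotation"
      using S p unfolding feasible_packing_def by (metis option.sel, metis option.sel)
    have iin: "i \<in> packed_in S (cont p)" using i p pin by blast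
    obtain W H where C: "?cs ! cont p = (W, H, label_code (clabel (containers I ! cont p)))"
      "real_of_int W = of_rat (cwidth (containers I ! cont p)) * ?Q"
      "real_of_int H = of_rat (cheight (containers I ! cont p)) * ?Q"
      using container_ints[OF j] by blast
    let ?w = "fst (oriented (rotated p) (?its ! i))" and ?h = "snd (oriented (rotated p) (?its ! i))"
    note wh = dims[OF i p]
    have "pwidth I S i \<le> of_rat (cwidth (containers I ! cont p))" "pheight I S i \<le> of_rat (cheight (containers I ! cont p))"
      using inside[OF j iin] by (auto simp: right_edge_def top_edge_def)
    then have "real_of_int ?w \<le> real_of_int W" "real_of_int ?h \<le> real_of_int H"
      unfolding wh C using den_pos by (simp_all add: mult_right_mono)
    then have le: "?w \<le> W" "?h \<le> H" by simp_all
    have area: "?f * ?w \<le> ?e * W \<and> ?f * ?h \<le> ?e * H" if "clabel (containers I ! cont p) = Area"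
    proof -
      have "pwidth I S i \<le> of_rat (eps' I) * of_rat (cwidth (containers I ! cont p))"
        "pheight I S i \<le> of_rat (eps' I) * of_rat (cheight (containers I ! cont p))"
        using ok[OF j] iin that by (simp_all add: container_ok_def Let_def)
      then have "real_of_int ?f * pwidth I S i \<le> real_of_int ?e * of_rat (cwidth (containers I ! cont p))"
        "real_of_int ?f * pheight I S i \<le> real_of_int ?e * of_rat (cheight (containers I ! cont p))"
        using eps_facts by (simp_all add: field_simps)
      then have "real_of_int ?f * pwidth I S i * ?Q \<le> real_of_int ?e * of_rat (cwidth (containers I ! cont p)) * ?Q"
        "real_of_int ?f * pheight I S i * ?Q \<le> real_of_int ?e * of_rat (cheight (containers I ! cont p)) * ?Q"
        using den_pos by (simp_all add: mult_right_mono)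
      then have "real_of_int (?f * ?w) \<le> real_of_int (?e * W)" "real_of_int (?f * ?h) \<le> real_of_int (?e * H)"
        unfolding of_int_mult wh C by (simp_all add: ac_simps)
      then show ?thesis unfolding of_int_le_iff by blast
    qed
    have l3: "label_code l = 3 \<longleftrightarrow> l = Area" for l by (cases l) auto
    have "fits ?e ?f (?cs ! cont p) (oriented (rotated p) (?its ! i))"
      using le area unfolding C by (simp add: fits_def case_prod_beta l3)
    moreover have "rotated p \<in> set (rots rotation)" using rot by (auto simp: rots_def)
    ultimately show "a \<in> set (snd (kitems rotation I ! i))"
      using j i unfolding kitems_nth[OF i] a by (auto simp: placements_iff)
  qed
  have chosen: "chosen c j = packed_in S j" for j
    using c by (auto simp: chosen_def pin ch_def split: option.splits)
  have rot: "snd (fst (the (c ! i))) = rotated p" if "i < ?n" "S ! i = Some p" for i p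
    using c that by (simp add: ch_def)
  have "load c j \<le> kcaps d I ! j" if j: "j < length (containers I)" for j
  proof -
    let ?A = "packed_in S j" and ?l = "clabel (containers I ! j)"
    define w where "w i = fst (oriented (snd (fst (the (c ! i)))) (?its ! i))" for i
    define h where "h i = snd (oriented (snd (fst (the (c ! i)))) (?its ! i))" for i
    define W' where "W' = real_of_rat (cwidth (containers I ! j))"
    define H' where "H' = real_of_rat (cheight (containers I ! j))"
    obtain W H where C: "?cs ! j = (W, H, label_code ?l)" "real_of_int W = W' * ?Q" "real_of_int H = H' * ?Q"
      "0 < W" "0 < H"
      using container_ints[OF j] unfolding W'_def H'_def by blast
    have fin: "finite ?A" by (simp add: packed_in_def packed_def)
    have wh: "real_of_int (w i) = pwidth I S i * ?Q" "real_of_int (h i) = pheight I S i * ?Q"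
      "0 < pwidth I S i" "0 < pheight I S i" if iA: "i \<in> ?A" for i
    proof -
      obtain p where p: "i < ?n" "S ! i = Some p" using iA pin by blast
      from dims[OF p] show "real_of_int (w i) = pwidth I S i * ?Q" "real_of_int (h i) = pheight I S i * ?Q"
        "0 < pwidth I S i" "0 < pheight I S i"
        by (simp_all add: w_def h_def rot[OF p])
    qed
    have WH: "0 \<le> W'" "0 \<le> H'"
    proof -
      have "0 < W' * ?Q" "0 < H' * ?Q" using C by (metis of_int_0_less_iff)+
      then show "0 \<le> W'" "0 \<le> H'" using den_pos by (simp_all add: zero_less_mult_iff)
    qed
    have load: "load c j = (\<Sum>i \<in> ?A. usage ?f (label_code ?l) (w i, h i))"
      unfolding load_container[OF adm j] chosen by (simp add: C w_def h_def)
    have "load c j \<le> capacity ?e ?f (?cs ! j)"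
    proof (cases ?l)
      case Large
      then have "card ?A \<le> 1" using ok[OF j] by (simp add: container_ok_def Let_def)
      then show ?thesis unfolding load C by (simp add: Large usage_def capacity_def)
    next
      case Wide
      have "sum (pheight I S) ?A \<le> H'"
      proof (rule stacked_intervals[OF fin, where lo = "bottom_edge S"])
        show "0 \<le> bottom_edge S i \<and> bottom_edge S i + pheight I S i \<le> H' \<and> 0 < pheight I S i" if "i \<in> ?A" for i
          using inside[OF j that] wh(4)[OF that] by (simp add: top_edge_def H'_def)
        show "bottom_edge S i + pheight I S i \<le> bottom_edge S i' \<or> bottom_edge S i' + pheight I S i' \<le> bottom_edge S i"
          if "i \<in> ?A" "i' \<in> ?A" "i \<noteq> i'" for i i'
          using ok[OF j] that Wide by (simp add: container_ok_def Let_def top_edge_def)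
      qed (rule WH)
      then have "sum (pheight I S) ?A * ?Q \<le> H' * ?Q" using den_pos by (simp add: mult_right_mono)
      moreover have "real_of_int (sum h ?A) = sum (pheight I S) ?A * ?Q"
        using wh(2) by (simp add: sum_distrib_right)
      ultimately have "sum h ?A \<le> H" unfolding C(3)[symmetric] by linarith
      then show ?thesis unfolding load C by (simp add: Wide usage_def capacity_def)
    next
      case Tall
      have "sum (pwidth I S) ?A \<le> W'"
      proof (rule stacked_intervals[OF fin, where lo = "left_edge S"])
        show "0 \<le> left_edge S i \<and> left_edge S i + pwidth I S i \<le> W' \<and> 0 < pwidth I S i" if "i \<in> ?A" for i
          using inside[OF j that] wh(3)[OF that] by (simp add: right_edge_def W'_def)
        show "left_edge S i + pwidth I S i \<le> left_edge S i' \<or> left_edge S i' + pwidth I S i' \<le> left_edge S i"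
          if "i \<in> ?A" "i' \<in> ?A" "i \<noteq> i'" for i i'
          using ok[OF j] that Tall by (simp add: container_ok_def Let_def right_edge_def)
      qed (rule WH)
      then have "sum (pwidth I S) ?A * ?Q \<le> W' * ?Q" using den_pos by (simp add: mult_right_mono)
      moreover have "real_of_int (sum w ?A) = sum (pwidth I S) ?A * ?Q"
        using wh(1) by (simp add: sum_distrib_right)
      ultimately have "sum w ?A \<le> W" unfolding C(2)[symmetric] by linarith
      then show ?thesis unfolding load C by (simp add: Tall usage_def capacity_def)
    next
      case Area
      let ?F = "real_of_int ?f" and ?E = "real_of_int ?e"
      have "(\<Sum>i \<in> ?A. pwidth I S i * pheight I S i) \<le> (1 - ?E / ?F)\<^sup>2 * W' * H'"
        using ok[OF j] Area by (simp add: container_ok_def Let_def eps_facts W'_def H'_def)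
      \<comment> \<open>The factors \<open>?F\<close> clear the denominator of \<open>eps'\<close>,
        the factors \<open>?Q\<close> those of the side lengths, so that both sides become
        integers.\<close>
      then have "?F * ?F * ?Q * ?Q * (\<Sum>i \<in> ?A. pwidth I S i * pheight I S i) \<le>
          ?F * ?F * ?Q * ?Q * ((1 - ?E / ?F)\<^sup>2 * W' * H')"
        using eps_facts den_pos by (intro mult_left_mono) auto
      also have "\<dots> = (?F * (1 - ?E / ?F)) * (?F * (1 - ?E / ?F)) * (W' * ?Q) * (H' * ?Q)"
        by (simp add: power2_eq_square ac_simps)
      also have "?F * (1 - ?E / ?F) = ?F - ?E" using eps_facts by (simp add: right_diff_distrib)
      also have "?F * ?F * ?Q * ?Q * (\<Sum>i \<in> ?A. pwidth I S i * pheight I S i) =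
          real_of_int (?f * ?f * (\<Sum>i \<in> ?A. w i * h i))"
        using wh(1,2) by (simp add: sum_distrib_left ac_simps)
      also have "(?F - ?E) * (?F - ?E) * (W' * ?Q) * (H' * ?Q) = real_of_int ((?f - ?e) * (?f - ?e) * W * H)"
        by (simp add: C)
      finally have "?f * ?f * (\<Sum>i \<in> ?A. w i * h i) \<le> (?f - ?e) * (?f - ?e) * W * H"
        by (simp only: of_int_le_iff)
      then show ?thesis unfolding load C by (simp add: Area usage_def capacity_def sum_distrib_left)
    qed
    then show ?thesis by (simp add: kcaps_nth j)
  qed
  moreover have "load c (length (containers I) + t) \<le> kcaps d I ! (length (containers I) + t)" if t: "t < d" for t
  proof -
    have "(\<Sum>i \<in> packed S. weights (items I ! i) ! t) \<le> 1" using S t by (simp add: feasible_packing_def)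
    then have "real_of_rat (\<Sum>i \<in> packed S. weights (items I ! i) ! t) \<le> 1"
      by (metis of_rat_1 of_rat_less_eq)
    then have "(\<Sum>i \<in> packed S. real_of_rat (weights (items I ! i) ! t)) \<le> 1" by (simp add: of_rat_sum)
    then have "(\<Sum>i \<in> packed S. real_of_rat (weights (items I ! i) ! t)) * ?Q \<le> 1 * ?Q"
      using den_pos by (intro mult_right_mono) auto
    then have "real_of_int (load c (length (containers I) + t)) \<le> ?Q"
      unfolding load_weight[OF adm t] packed by simp
    then show ?thesis by (simp add: kcaps_nth t)
  qed
  ultimately have "load c j \<le> kcaps d I ! j" if "j < length (containers I) + d" for j
    using that by (metis add_less_cancel_left le_Suc_ex not_less)
  then have "fitting (kitems rotation I) (kcaps d I) c"
    using adm by (simp add: fitting_def)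
  moreover have "real_of_int (gain (kitems rotation I) c) = total_profit I S * ?Q"
    unfolding gain_profit total_profit_def packed ..
  ultimately show ?thesis by blast
qed

text \<open>The capacities alone guarantee that shelf packing succeeds in every container, so any
  fitting choice can be realized geometrically with the same profit.\<close>

lemma choice_to_packing:
  assumes fit: "fitting (kitems rotation I) (kcaps d I) c"
  defines "S \<equiv> solution_of (den_of I) (items_of I) (containers_of I) c"
  shows "feasible_packing rotation d I S"
    "real_of_int (gain (kitems rotation I) c) = total_profit I S * real_of_int (den_of I)"
proof -
  let ?n = "length (items I)" and ?m = "length (containers I)" and ?its = "items_of I" and ?cs = "containers_of I"
  let ?Q = "real_of_int (den_of I)" and ?e = "eps_num I" and ?f = "eps_den I"
  let ?cp = "\<lambda>j. container_positions ?its c j (?cs ! j)"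
  have Q: "0 < ?Q" using den_pos by simp
  have adm: "admissible (kitems rotation I) c" and lenc: "length c = ?n"
    using fit by (auto simp: fitting_def admissible_def)
  have boxes: "box_of ` set (?cp j) = set (boxes_in ?its c j)" for j
    by (cases "?cs ! j") (simp only: container_positions_def prod.case set_box_of_shelf_pack)
  have setpos: "q \<in> set (positions ?its ?cs c) \<longleftrightarrow> (\<exists>j < ?m. q \<in> set (?cp j))" for q
  proof -
    have "set (List.enumerate 0 ?cs) = (\<lambda>j. (j, ?cs ! j)) ` {..<?m}"
      by (auto simp: in_set_enumerate_eq image_iff prod_eq_iff)
    then show ?thesis by (simp add: positions_def case_prod_beta Bex_def del: split_paired_Ex)
  qed
  have pos: "\<exists>x y w b. map_of (positions ?its ?cs c) i = Some (x, y, w, b) \<and>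
      (i, x, y, w, b) \<in> set (?cp j) \<and> (w, b) = oriented rot (?its ! i)"
    if i: "i < ?n" and ci: "c ! i = Some ((j, rot), v)" for i j rot v
  proof -
    have j: "j < ?m" by (rule admissible_choice(1)[OF adm i ci])
    have "(i, oriented rot (?its ! i)) \<in> set (boxes_in ?its c j)"
      using set_boxes_in[of c ?its i _ j] lenc i ci by simp
    then obtain q where q: "q \<in> set (?cp j)" "fst q = i" unfolding boxes[symmetric] by fastforce
    then have "q \<in> set (positions ?its ?cs c)" unfolding setpos using j by blast
    with q(2) have "map_of (positions ?its ?cs c) i \<noteq> None" by (auto simp: map_of_eq_None_iff)
    then obtain x y w b where m: "map_of (positions ?its ?cs c) i = Some (x, y, w, b)" by fastforce
    \<comment> \<open>\<open>map_of\<close> finds some entry for \<open>i\<close>, possibly of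
      another container. As \<open>c ! i\<close> names a single container and orientation, the entry
      is the expected one.\<close>
    from map_of_SomeD[OF m] obtain j' where j': "(i, x, y, w, b) \<in> set (?cp j')" unfolding setpos by blast
    then have "(i, w, b) \<in> box_of ` set (?cp j')" by force
    then have "(i, w, b) \<in> set (boxes_in ?its c j')" unfolding boxes .
    then have "j' = j" "(w, b) = oriented rot (?its ! i)"
      using set_boxes_in[of c ?its i "(w, b)" j'] lenc ci by auto
    with m j' show ?thesis by blast
  qed
  have Snth: "S ! i = (case c ! i of None \<Rightarrow> None | Some a \<Rightarrow>
       (case map_of (positions ?its ?cs c) i of None \<Rightarrow> None
        | Some q \<Rightarrow> Some \<lparr>cont = fst (fst a), rotated = snd (fst a),
            xpos = real_of_int (fst q) / ?Q, ypos = real_of_int (fst (snd q)) / ?Q\<rparr>))"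
    if "i < ?n" for i
    using that lenc by (simp add: S_def solution_of_def nth_enumerate_eq)
  have lenS: "length S = ?n" by (simp add: S_def solution_of_def lenc)
  have ent: "\<exists>x y w b. (i, x, y, w, b) \<in> set (?cp j) \<and> (w, b) = oriented rot (?its ! i) \<and>
      S ! i = Some \<lparr>cont = j, rotated = rot, xpos = real_of_int x / ?Q, ypos = real_of_int y / ?Q\<rparr> \<and>
      pwidth I S i = real_of_int w / ?Q \<and> pheight I S i = real_of_int b / ?Q"
    if i: "i < ?n" and ci: "c ! i = Some ((j, rot), v)" for i j rot v
  proof -
    obtain x y w b where xy: "map_of (positions ?its ?cs c) i = Some (x, y, w, b)"
      "(i, x, y, w, b) \<in> set (?cp j)" "(w, b) = oriented rot (?its ! i)"
      using pos[OF i ci] by blast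
    have Si: "S ! i = Some \<lparr>cont = j, rotated = rot, xpos = real_of_int x / ?Q, ypos = real_of_int y / ?Q\<rparr>"
      using Snth[OF i] ci xy(1) by simp
    have "real_of_int w = pwidth I S i * ?Q" "real_of_int b = pheight I S i * ?Q"
      using oriented_ints(3,4)[OF i, of rot] xy(3)[symmetric] Si by (simp_all add: pwidth_def pheight_def)
    then have "pwidth I S i = real_of_int w / ?Q" "pheight I S i = real_of_int b / ?Q" using Q by simp_all
    with xy Si show ?thesis by blast
  qed
  have packed: "packed S = {i. i < ?n \<and> c ! i \<noteq> None}"
  proof (rule set_eqI)
    fix i
    show "i \<in> packed S \<longleftrightarrow> i \<in> {i. i < ?n \<and> c ! i \<noteq> None}"
    proof (cases "i < ?n \<and> c ! i \<noteq> None")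
      case True
      then obtain j rot v where "c ! i = Some ((j, rot), v)" by (metis option.exhaust surj_pair)
      with ent[of i j rot v] True show ?thesis by (auto simp: packed_def lenS)
    next
      case False
      then show ?thesis using Snth[of i] by (cases "i < ?n") (simp_all add: packed_def lenS del: not_None_eq)
    qed
  qed
  have pin: "packed_in S j = chosen c j" for j
  proof (rule set_eqI)
    fix i
    show "i \<in> packed_in S j \<longleftrightarrow> i \<in> chosen c j"
    proof (cases "i < ?n \<and> c ! i \<noteq> None")
      case True
      then obtain j' rot v where "c ! i = Some ((j', rot), v)" by (metis option.exhaust surj_pair)
      with ent[of i j' rot v] True show ?thesis by (auto simp: packed_in_def packed chosen_def)
    next
      case False
      then show ?thesis by (auto simp: packed_in_def packed chosen_def)
    qed
  qed
  have cont: "container_ok I S j" if j: "j < ?m" for j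
  proof -
    let ?l = "label_code (clabel (containers I ! j))" and ?L = "boxes_in ?its c j"
    define W' where "W' = real_of_rat (cwidth (containers I ! j))"
    define H' where "H' = real_of_rat (cheight (containers I ! j))"
    obtain W H where C: "?cs ! j = (W, H, ?l)" "real_of_int W = W' * ?Q" "real_of_int H = H' * ?Q"
      "0 < W" "0 < H"
      using container_ints[OF j] unfolding W'_def H'_def by blast
    have WH: "W' = real_of_int W / ?Q" "H' = real_of_int H / ?Q" using C Q by simp_all
    have cp: "?cp j = shelf_pack (if ?l = 1 then 0 else W) ?L" by (simp add: container_positions_def C)
    have L: "\<exists>rot v. i < ?n \<and> c ! i = Some ((j, rot), v) \<and> b = oriented rot (?its ! i)" if "(i, b) \<in> set ?L" for i b
      using that set_boxes_in[of c ?its i b j] lenc by auto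
    have posL: "positive_boxes ?L"
      unfolding positive_boxes_def
    proof (clarify)
      fix i w b assume "(i, w, b) \<in> set ?L"
      from L[OF this] obtain rot where "i < ?n" "(w, b) = oriented rot (?its ! i)" by blast
      then show "0 < w \<and> 0 < b" using oriented_ints(1,2)[of i rot] by (metis fst_conv snd_conv)
    qed
    have fitsL: "\<forall>(i, b) \<in> set ?L. fits ?e ?f (W, H, ?l) b"
      using L admissible_choice(3)[OF adm, of _ j] unfolding C by fastforce
    have sumL: "(\<Sum>(i, b) \<leftarrow> ?L. g b) = (\<Sum>i \<in> chosen c j. g (oriented (snd (fst (the (c ! i)))) (?its ! i)))"
      for g :: "int \<times> int \<Rightarrow> int"
    proof -
      have "set ?L = (\<lambda>i. (i, oriented (snd (fst (the (c ! i)))) (?its ! i))) ` chosen c j"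
      proof (rule set_eqI)
        fix p :: "nat box"
        obtain i b where p: "p = (i, b)" by (metis surj_pair)
        have "(i, b) \<in> set ?L \<longleftrightarrow> i \<in> chosen c j \<and> b = oriented (snd (fst (the (c ! i)))) (?its ! i)"
          using set_boxes_in[of c ?its i b j] lenc by (auto simp: chosen_def)
        then show "p \<in> set ?L \<longleftrightarrow> p \<in> (\<lambda>i. (i, oriented (snd (fst (the (c ! i)))) (?its ! i))) ` chosen c j"
          unfolding p by blast
      qed
      moreover have "(\<Sum>(i, b) \<leftarrow> ?L. g b) = (\<Sum>(i, b) \<in> set ?L. g b)"
        by (rule sum_list_distinct_conv_sum_set[OF distinct_boxes_in])
      ultimately show ?thesis by (simp add: sum.reindex inj_on_def)
    qed
    have loadL: "(\<Sum>(i, b) \<leftarrow> ?L. usage ?f ?l b) \<le> capacity ?e ?f (W, H, ?l)"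
    proof -
      have "(\<Sum>(i, b) \<leftarrow> ?L. usage ?f ?l b) = load c j"
        unfolding sumL load_container[OF adm j] by (simp add: C)
      also have "\<dots> \<le> kcaps d I ! j" using fit j by (simp add: fitting_def)
      finally show ?thesis by (simp add: kcaps_nth j C)
    qed
    have l: "?l \<in> {0, 1, 2, 3}" by (cases "clabel (containers I ! j)") simp_all
    note correct = container_positions_correct[OF posL fitsL loadL eps_facts(3,2) C(4,5) l]
    have A: "\<exists>x y w b. (i, x, y, w, b) \<in> set (?cp j) \<and> 0 < w \<and> 0 < b \<and> fits ?e ?f (W, H, ?l) (w, b) \<and>
        (w, b) = oriented (snd (fst (the (c ! i)))) (?its ! i) \<and>
        left_edge S i = real_of_int x / ?Q \<and> bottom_edge S i = real_of_int y / ?Q \<and>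
        right_edge I S i = real_of_int (x + w) / ?Q \<and> top_edge I S i = real_of_int (y + b) / ?Q \<and>
        pwidth I S i = real_of_int w / ?Q \<and> pheight I S i = real_of_int b / ?Q"
      if iA: "i \<in> packed_in S j" for i
    proof -
      obtain rot v where i: "i < ?n" and ci: "c ! i = Some ((j, rot), v)"
        using iA unfolding pin chosen_def by blast
      obtain x y w b where e: "(i, x, y, w, b) \<in> set (?cp j)" "(w, b) = oriented rot (?its ! i)"
        "S ! i = Some \<lparr>cont = j, rotated = rot, xpos = real_of_int x / ?Q, ypos = real_of_int y / ?Q\<rparr>"
        "pwidth I S i = real_of_int w / ?Q" "pheight I S i = real_of_int b / ?Q"
        using ent[OF i ci] by blast
      have "0 < w" "0 < b" using oriented_ints(1,2)[OF i, of rot] e(2)[symmetric] by simp_all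
      moreover have "fits ?e ?f (W, H, ?l) (w, b)" using admissible_choice(3)[OF adm i ci] e(2) C by simp
      ultimately show ?thesis
        using e ci by (intro exI[of _ x] exI[of _ y] exI[of _ w] exI[of _ b])
          (simp add: left_edge_def bottom_edge_def right_edge_def top_edge_def add_divide_distrib)
    qed
    have div_le: "real_of_int a / ?Q \<le> real_of_int b / ?Q \<longleftrightarrow> a \<le> b" for a b
      using Q by (simp add: divide_le_cancel)
    have inside: "rect I S i \<subseteq> {0..W'} \<times> {0..H'}" if iA: "i \<in> packed_in S j" for i
    proof -
      obtain x y w b where e: "(i, x, y, w, b) \<in> set (?cp j)" "0 < w" "0 < b"
        "left_edge S i = real_of_int x / ?Q" "bottom_edge S i = real_of_int y / ?Q"
        "right_edge I S i = real_of_int (x + w) / ?Q" "top_edge I S i = real_of_int (y + b) / ?Q"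
        "pwidth I S i = real_of_int w / ?Q" "pheight I S i = real_of_int b / ?Q"
        using A[OF iA] by blast
      have "0 < pwidth I S i" "0 < pheight I S i" using e Q by simp_all
      moreover have "0 \<le> x \<and> x + w \<le> W \<and> 0 \<le> y \<and> y + b \<le> H" using correct[of i x y w b] e(1) cp by simp
      ultimately show ?thesis
        using Q by (simp only: rect_subset_iff e WH div_le) simp
    qed
    have sep: "(right_edge I S i \<le> left_edge S i' \<or> right_edge I S i' \<le> left_edge S i \<or>
        top_edge I S i \<le> bottom_edge S i' \<or> top_edge I S i' \<le> bottom_edge S i) \<and>
        (?l = 1 \<longrightarrow> top_edge I S i \<le> bottom_edge S i' \<or> top_edge I S i' \<le> bottom_edge S i) \<and>
        (?l = 2 \<longrightarrow> right_edge I S i \<le> left_edge S i' \<or> right_edge I S i' \<le> left_edge S i)"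
      if iA: "i \<in> packed_in S j" "i' \<in> packed_in S j" "i \<noteq> i'" for i i'
    proof -
      obtain x y w b where e: "(i, x, y, w, b) \<in> set (?cp j)" "0 < w" "0 < b"
        "left_edge S i = real_of_int x / ?Q" "bottom_edge S i = real_of_int y / ?Q"
        "right_edge I S i = real_of_int (x + w) / ?Q" "top_edge I S i = real_of_int (y + b) / ?Q"
        using A[OF iA(1)] by blast
      obtain x' y' w' b' where e': "(i', x', y', w', b') \<in> set (?cp j)" "0 < w'" "0 < b'"
        "left_edge S i' = real_of_int x' / ?Q" "bottom_edge S i' = real_of_int y' / ?Q"
        "right_edge I S i' = real_of_int (x' + w') / ?Q" "top_edge I S i' = real_of_int (y' + b') / ?Q"
        using A[OF iA(2)] by blast
      have ws: "well_separated (i, x, y, w, b) (i', x', y', w', b') \<or> well_separated (i', x', y', w', b') (i, x, y, w, b)"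
        using sorted_wrt_two[OF shelf_pack_separated[OF posL] e(1)[unfolded cp] e'(1)[unfolded cp]] iA(3) by simp
      \<comment> \<open>In a row all bottoms are 0, in a stack all left edges are 0. Since sides are
        positive, only one alternative of \<open>well_separated\<close> remains possible, namely the
        one that the label demands.\<close>
      have yx: "(?l \<in> {0, 2} \<longrightarrow> y = 0 \<and> y' = 0) \<and> (?l = 1 \<longrightarrow> x = 0 \<and> x' = 0)"
        using correct[of i x y w b] correct[of i' x' y' w' b'] e(1) e'(1) cp by auto
      have "(x + w \<le> x' \<or> x' + w' \<le> x \<or> y + b \<le> y' \<or> y' + b' \<le> y) \<and>
          (?l = 1 \<longrightarrow> y + b \<le> y' \<or> y' + b' \<le> y) \<and> (?l = 2 \<longrightarrow> x + w \<le> x' \<or> x' + w' \<le> x)"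
        using ws yx e(2,3) e'(2,3) by (auto simp: well_separated_def)
      then show ?thesis unfolding e(4-7) e'(4-7) div_le .
    qed
    have disjoint: "open_rect I S i \<inter> open_rect I S i' = {}"
      if "i \<in> packed_in S j" "i' \<in> packed_in S j" "i \<noteq> i'" for i i'
      using sep[OF that] by (auto simp: open_rect_def)
    have label: "case clabel (containers I ! j) of
        Large \<Rightarrow> card (packed_in S j) \<le> 1
      | Wide \<Rightarrow> (\<forall>i \<in> packed_in S j. \<forall>i' \<in> packed_in S j. i \<noteq> i' \<longrightarrow>
          top_edge I S i \<le> bottom_edge S i' \<or> top_edge I S i' \<le> bottom_edge S i)
      | Tall \<Rightarrow> (\<forall>i \<in> packed_in S j. \<forall>i' \<in> packed_in S j. i \<noteq> i' \<longrightarrow>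
          right_edge I S i \<le> left_edge S i' \<or> right_edge I S i' \<le> left_edge S i)
      | Area \<Rightarrow> (\<forall>i \<in> packed_in S j. pwidth I S i \<le> of_rat (eps' I) * W' \<and> pheight I S i \<le> of_rat (eps' I) * H') \<and>
          (\<Sum>i \<in> packed_in S j. pwidth I S i * pheight I S i) \<le> (1 - of_rat (eps' I))\<^sup>2 * W' * H'"
    proof (cases "clabel (containers I ! j)")
      case Large
      have "int (card (chosen c j)) \<le> 1"
        using loadL unfolding sumL by (simp add: Large usage_def capacity_def case_prod_beta)
      then show ?thesis using Large by (simp add: pin)
    next
      case Area
      let ?F = "real_of_int ?f" and ?E = "real_of_int ?e"
      have F: "0 < ?F" using eps_facts by simp
      have small: "pwidth I S i \<le> ?E / ?F * W' \<and> pheight I S i \<le> ?E / ?F * H'" if iA: "i \<in> packed_in S j" for i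
      proof -
        obtain w b where e: "fits ?e ?f (W, H, ?l) (w, b)"
          "pwidth I S i = real_of_int w / ?Q" "pheight I S i = real_of_int b / ?Q"
          using A[OF iA] by blast
        then have "?f * w \<le> ?e * W" "?f * b \<le> ?e * H" using Area by (simp_all add: fits_def)
        then have "?F * real_of_int w \<le> ?E * real_of_int W" "?F * real_of_int b \<le> ?E * real_of_int H"
          by (metis of_int_le_iff of_int_mult)+
        then have "real_of_int w \<le> ?E * real_of_int W / ?F" "real_of_int b \<le> ?E * real_of_int H / ?F"
          using F by (simp_all add: pos_le_divide_eq mult.commute)
        then have "real_of_int w / ?Q \<le> ?E * real_of_int W / ?F / ?Q" "real_of_int b / ?Q \<le> ?E * real_of_int H / ?F / ?Q"
          using Q by (simp_all only: divide_right_mono less_imp_le)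
        then show ?thesis by (simp add: e WH)
      qed
      have area: "(\<Sum>i \<in> packed_in S j. pwidth I S i * pheight I S i) \<le> (1 - ?E / ?F)\<^sup>2 * W' * H'"
      proof -
        let ?wh = "\<lambda>i. fst (oriented (snd (fst (the (c ! i)))) (?its ! i)) * snd (oriented (snd (fst (the (c ! i)))) (?its ! i))"
        have "?f * ?f * (\<Sum>i \<in> packed_in S j. ?wh i) \<le> (?f - ?e) * (?f - ?e) * W * H"
          using loadL unfolding sumL pin[symmetric]
          by (simp add: Area usage_def capacity_def case_prod_beta sum_distrib_left)
        then have "real_of_int (?f * ?f * (\<Sum>i \<in> packed_in S j. ?wh i)) \<le> real_of_int ((?f - ?e) * (?f - ?e) * W * H)"
          by (simp only: of_int_le_iff)
        moreover have "(\<Sum>i \<in> packed_in S j. pwidth I S i * pheight I S i) * (?Q * ?Q) = real_of_int (\<Sum>i \<in> packed_in S j. ?wh i)"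
        proof -
          have "pwidth I S i * pheight I S i * (?Q * ?Q) = real_of_int (?wh i)" if iA: "i \<in> packed_in S j" for i
          proof -
            obtain w b where "(w, b) = oriented (snd (fst (the (c ! i)))) (?its ! i)"
              "pwidth I S i = real_of_int w / ?Q" "pheight I S i = real_of_int b / ?Q"
              using A[OF iA] by blast
            then show ?thesis using Q by (simp add: eq_commute[of "(w, b)"])
          qed
          then show ?thesis by (simp add: sum_distrib_right)
        qed
        ultimately have "?F * ?F * ((\<Sum>i \<in> packed_in S j. pwidth I S i * pheight I S i) * (?Q * ?Q)) \<le>
            (?F - ?E) * (?F - ?E) * (W' * ?Q) * (H' * ?Q)"
          by (simp add: C)
        also have "(?F - ?E) * (?F - ?E) * (W' * ?Q) * (H' * ?Q) = ?F * ?F * (((1 - ?E / ?F)\<^sup>2 * W' * H') * (?Q * ?Q))"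
        proof -
          have "?F - ?E = ?F * (1 - ?E / ?F)" using F by (simp add: right_diff_distrib)
          then show ?thesis by (simp only: power2_eq_square) (simp add: ac_simps)
        qed
        finally show ?thesis using F Q by (simp add: mult_le_cancel_left_pos mult_le_cancel_right_pos)
      qed
      show ?thesis using small area by (simp add: Area eps_facts(4))
    qed (use sep in simp_all)
    show ?thesis
      unfolding container_ok_def Let_def W'_def[symmetric] H'_def[symmetric]
      using inside disjoint label by blast
  qed
  have weights: "(\<Sum>i \<in> packed S. weights (items I ! i) ! t) \<le> 1" if t: "t < d" for t
  proof -
    have "load c (?m + t) \<le> kcaps d I ! (?m + t)" using fit t by (simp add: fitting_def)
    then have "real_of_int (load c (?m + t)) \<le> ?Q" by (simp add: kcaps_nth t)
    then have "(\<Sum>i \<in> packed S. real_of_rat (weights (items I ! i) ! t)) * ?Q \<le> 1 * ?Q"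
      unfolding load_weight[OF adm t] packed by simp
    then have "(\<Sum>i \<in> packed S. real_of_rat (weights (items I ! i) ! t)) \<le> 1"
      using Q by (simp only: mult_le_cancel_right_pos)
    then have "real_of_rat (\<Sum>i \<in> packed S. weights (items I ! i) ! t) \<le> of_rat 1" by (simp add: of_rat_sum)
    then show ?thesis by (simp only: of_rat_less_eq)
  qed
  have place: "cont (the (S ! i)) < ?m \<and> (rotated (the (S ! i)) \<longrightarrow> rotation)" if "i \<in> packed S" for i
  proof -
    from that obtain j rot v where i: "i < ?n" and ci: "c ! i = Some ((j, rot), v)"
      unfolding packed by (auto simp del: split_paired_Ex)
    from ent[OF i ci] have "cont (the (S ! i)) = j" "rotated (the (S ! i)) = rot" by auto
    then show ?thesis using admissible_choice(1,2)[OF adm i ci] by simp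
  qed
  show "feasible_packing rotation d I S"
    unfolding feasible_packing_def using lenS place cont weights by blast
  show "real_of_int (gain (kitems rotation I) c) = total_profit I S * ?Q"
    unfolding gain_profit total_profit_def packed ..
qed

end

section \<open>Running time of the conversions\<close>

lemma ptime_app4:
  assumes "ptime UNIV (\<lambda>p. f (fst p) (fst (snd p)) (fst (snd (snd p))) (snd (snd (snd p))))"
    "ptime D F" "ptime D G" "ptime D H" "ptime D K"
  shows "ptime D (\<lambda>x. f (F x) (G x) (H x) (K x))"
  using ptime_comp[OF assms(1) ptime_pair[OF assms(2) ptime_pair[OF assms(3) ptime_pair[OF assms(4,5)]]]]
  by simp

lemma ptime_app5:
  assumes "ptime UNIV (\<lambda>p. f (fst p) (fst (snd p)) (fst (snd (snd p))) (fst (snd (snd (snd p))))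
      (snd (snd (snd (snd p)))))"
    "ptime D F" "ptime D G" "ptime D H" "ptime D K" "ptime D L"
  shows "ptime D (\<lambda>x. f (F x) (G x) (H x) (K x) (L x))"
  using ptime_comp[OF assms(1) ptime_pair[OF assms(2) ptime_pair[OF assms(3) ptime_pair[OF assms(4)
    ptime_pair[OF assms(5,6)]]]]]
  by simp

lemma ptime_to_int: "ptime D F \<Longrightarrow> ptime D G \<Longrightarrow> ptime D (\<lambda>x. to_int (F x) (G x))"
  unfolding to_int_def by (intro ptime_intros)

lemma ptime_common_den: "ptime D F \<Longrightarrow> ptime D (\<lambda>x. common_den (F x))"
  unfolding common_den_def denominators_def by (intro ptime_intros ptime_list_intros)

lemma ptime_int_item: "ptime UNIV (\<lambda>p. int_item (fst p) (snd p))"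
  unfolding int_item_def by (intro ptime_to_int ptime_intros ptime_list_intros)

lemma ptime_int_container: "ptime D F \<Longrightarrow> ptime D G \<Longrightarrow> ptime D (\<lambda>x. int_container (F x) (G x))"
  unfolding int_container_def by (intro ptime_to_int ptime_intros)

lemma ptime_oriented: "ptime D F \<Longrightarrow> ptime D G \<Longrightarrow> ptime D (\<lambda>x. oriented (F x) (G x))"
  unfolding oriented_def by (intro ptime_intros)

lemma ptime_fits:
  "ptime D E \<Longrightarrow> ptime D F \<Longrightarrow> ptime D C \<Longrightarrow> ptime D B \<Longrightarrow> ptime D (\<lambda>x. fits (E x) (F x) (C x) (B x))"
  unfolding fits_def by (intro ptime_intros)

lemma ptime_usage: "ptime D F \<Longrightarrow> ptime D L \<Longrightarrow> ptime D B \<Longrightarrow> ptime D (\<lambda>x. usage (F x) (L x) (B x))"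
  unfolding usage_def by (intro ptime_intros)

lemma ptime_capacity: "ptime D E \<Longrightarrow> ptime D F \<Longrightarrow> ptime D C \<Longrightarrow> ptime D (\<lambda>x. capacity (E x) (F x) (C x))"
  unfolding capacity_def by (intro ptime_intros)

lemma ptime_usage_vec: "ptime UNIV (\<lambda>p. usage_vec (fst p) (fst (snd p)) (fst (snd (snd p)))
    (fst (snd (snd (snd p)))) (snd (snd (snd (snd p)))))"
  unfolding usage_vec_def by (intro ptime_usage ptime_intros ptime_list_intros)

lemma ptime_placements: "ptime UNIV (\<lambda>p. placements rs (fst p) (fst (snd p)) (fst (snd (snd p))) (snd (snd (snd p))))"
  unfolding placements_def
  by (intro ptime_app5[where f = usage_vec, OF ptime_usage_vec] ptime_fits ptime_oriented
      ptime_intros ptime_list_intros)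

lemma ptime_knapsack_items:
  "ptime UNIV (\<lambda>p. knapsack_items rs (fst p) (fst (snd p)) (fst (snd (snd p))) (snd (snd (snd p))))"
  unfolding knapsack_items_def
  by (intro ptime_app4[where f = "placements rs", OF ptime_placements] ptime_intros ptime_list_intros)

lemma ptime_capacities:
  "ptime UNIV (\<lambda>p. capacities d (fst p) (fst (snd p)) (fst (snd (snd p))) (snd (snd (snd p))))"
  unfolding capacities_def by (intro ptime_capacity ptime_intros ptime_list_intros)

section \<open>Sorting and shelf packing in polynomial time\<close>

lemma ptime_insert_desc: "ptime UNIV (\<lambda>p. insert_desc (fst p) (snd p))"
  unfolding insert_desc_def by (intro ptime_intros ptime_list_intros)

lemma esize_mset_eq:
  assumes "mset xs = mset ys" shows "esize xs = esize ys"
proof -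
  have "mset (map (\<lambda>x. 1 + esize x) xs) = mset (map (\<lambda>x. 1 + esize x) ys)"
    by (simp only: mset_map assms)
  then have "(\<Sum>x\<leftarrow>xs. 1 + esize x) = (\<Sum>x\<leftarrow>ys. 1 + esize x)"
    by (simp only: sum_mset_sum_list[symmetric])
  then show ?thesis by (simp only: esize_list)
qed

lemma ptime_sort_desc:
  assumes L: "ptime D L" shows "ptime D (\<lambda>x. sort_desc (L x))"
  unfolding sort_desc_def
proof (rule ptime_fold[OF L ptime_const])
  show "poly_bounded D (\<lambda>x. esize (L x))" by (rule ptime_poly_bounded[OF L])
  show "esize (fold insert_desc ys []) \<le> esize (L x)" if "L x = ys @ zs" for x ys zs
    using esize_mset_eq[OF mset_sort_desc[of ys]] esize_take[of "length ys" "L x"] that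
    by (simp add: sort_desc_def)
qed (intro ptime_app2[where f = insert_desc, OF ptime_insert_desc] ptime_intros)

text \<open>The recursion of \<open>nfdh\<close> is restated with an accumulator, the form that
  \<open>ptime_fold\<close> can handle.\<close>

definition nfdh_step :: "int \<Rightarrow> 'k box \<Rightarrow> int \<times> int \<times> int \<times> 'k placed_box list \<Rightarrow>
    int \<times> int \<times> int \<times> 'k placed_box list" where
  "nfdh_step W p s = (case p of (i, w, b) \<Rightarrow> case s of (x, y, h, acc) \<Rightarrow>
     if x + w \<le> W then (x + w, y, h, (i, x, y, w, b) # acc)
     else (w, y + h, b, (i, 0, y + h, w, b) # acc))"

lemma fold_nfdh_step:
  "snd (snd (snd (fold (nfdh_step W) ls (x, y, h, acc)))) = rev (nfdh W x y h ls) @ acc"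
  by (induction W x y h ls arbitrary: acc rule: nfdh.induct) (simp_all add: nfdh_step_def)

text \<open>Coordinates grow only by addition, so they stay below \<open>M\<close>, the sum of the
  extents seen so far, whose bit length is linear in the input size. Absolute values appear because
  computability is shown for boxes of arbitrary sign.\<close>

definition nfdh_inv :: "int \<Rightarrow> 'k box set \<Rightarrow> int \<times> int \<times> int \<times> 'k placed_box list \<Rightarrow> bool" where
  "nfdh_inv M B s \<longleftrightarrow> (case s of (x, y, h, acc) \<Rightarrow> \<bar>x\<bar> + \<bar>y\<bar> + \<bar>h\<bar> \<le> M \<and>
     (\<forall>q \<in> set acc. box_of q \<in> B \<and> \<bar>fst (snd q)\<bar> \<le> M \<and> \<bar>fst (snd (snd q))\<bar> \<le> M))"

lemma nfdh_inv_step: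
  assumes "nfdh_inv M B s"
  shows "nfdh_inv (M + (\<bar>w\<bar> + \<bar>b\<bar>)) (insert (i, w, b) B) (nfdh_step W (i, w, b) s)"
proof -
  obtain x y h acc where s: "s = (x, y, h, acc)" by (metis surj_pair)
  have M: "\<bar>x\<bar> + \<bar>y\<bar> + \<bar>h\<bar> \<le> M" using assms by (simp add: nfdh_inv_def s)
  let ?M = "M + (\<bar>w\<bar> + \<bar>b\<bar>)"
  have acc: "\<forall>q \<in> set acc. box_of q \<in> insert (i, w, b) B \<and> \<bar>fst (snd q)\<bar> \<le> ?M \<and> \<bar>fst (snd (snd q))\<bar> \<le> ?M"
  proof
    fix q assume "q \<in> set acc"
    then have "box_of q \<in> B" "\<bar>fst (snd q)\<bar> \<le> M" "\<bar>fst (snd (snd q))\<bar> \<le> M"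
      using assms by (simp_all add: nfdh_inv_def s)
    moreover have "M \<le> ?M" by simp
    ultimately show "box_of q \<in> insert (i, w, b) B \<and> \<bar>fst (snd q)\<bar> \<le> ?M \<and> \<bar>fst (snd (snd q))\<bar> \<le> ?M"
      by (meson insertI2 order_trans)
  qed
  have nonneg: "0 \<le> \<bar>x\<bar>" "0 \<le> \<bar>y\<bar>" "0 \<le> \<bar>h\<bar>" "0 \<le> \<bar>w\<bar>" "0 \<le> \<bar>b\<bar>" "\<bar>x + w\<bar> \<le> \<bar>x\<bar> + \<bar>w\<bar>" "\<bar>y + h\<bar> \<le> \<bar>y\<bar> + \<bar>h\<bar>"
    by (simp_all add: abs_triangle_ineq)
  have le: "\<bar>x + w\<bar> + \<bar>y\<bar> + \<bar>h\<bar> \<le> ?M" "\<bar>w\<bar> + \<bar>y + h\<bar> + \<bar>b\<bar> \<le> ?M" "\<bar>x\<bar> \<le> ?M" "\<bar>y\<bar> \<le> ?M" "\<bar>y + h\<bar> \<le> ?M" "0 \<le> ?M"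
    using M nonneg
    by (smt (verit))+
  show ?thesis
    using acc le by (simp add: nfdh_inv_def nfdh_step_def s)
qed

lemma nfdh_inv_fold:
  "nfdh_inv M B s \<Longrightarrow>
    nfdh_inv (M + (\<Sum>(i, w, b) \<leftarrow> ls. \<bar>w\<bar> + \<bar>b\<bar>)) (B \<union> set ls) (fold (nfdh_step W) ls s)"
proof (induction ls arbitrary: M B s)
  case (Cons p ls)
  obtain i w b where p: "p = (i, w, b)" by (metis surj_pair)
  from Cons.IH[OF nfdh_inv_step[OF Cons.prems, of w b i W]] show ?case
    by (simp add: p add.assoc)
qed simp

lemma bitlength_mono:
  assumes "\<bar>a\<bar> \<le> M" shows "bitlength a \<le> bitlength M"
proof (rule bitlength_leI)
  have "\<bar>a\<bar> \<le> \<bar>M\<bar>" using assms by simp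
  also have "\<bar>M\<bar> < 2 ^ bitlength M" by (rule abs_less_bitlength)
  finally show "\<bar>a\<bar> < 2 ^ bitlength M" .
qed

lemma bitlength_abs_add: "bitlength (\<bar>a\<bar> + b) \<le> 1 + bitlength a + bitlength b"
proof -
  have "bitlength (\<bar>a\<bar> + b) \<le> max (bitlength \<bar>a\<bar>) (bitlength b) + 1" by (rule bitlength_add_max)
  also have "bitlength \<bar>a\<bar> = bitlength a" by (simp add: bitlength_def)
  also have "max (bitlength a) (bitlength b) + 1 \<le> 1 + bitlength a + bitlength b" by simp
  finally show ?thesis .
qed

lemma bitlength_extent:
  "bitlength (\<bar>W\<bar> + (\<Sum>(i, w, b) \<leftarrow> ls. \<bar>w\<bar> + \<bar>b\<bar>)) \<le> bitlength W + esize (ls :: 'k :: codable box list)"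
proof (induction ls)
  case Nil
  show ?case by (simp add: bitlength_def)
next
  case (Cons p ls)
  obtain i w b where p: "p = (i, w, b)" by (metis surj_pair)
  let ?s = "\<bar>W\<bar> + (\<Sum>(i, w, b) \<leftarrow> ls. \<bar>w\<bar> + \<bar>b\<bar>)"
  have "\<bar>W\<bar> + (\<Sum>(i, w, b) \<leftarrow> p # ls. \<bar>w\<bar> + \<bar>b\<bar>) = \<bar>w\<bar> + (\<bar>b\<bar> + ?s)" by (simp add: p)
  also have "bitlength \<dots> \<le> 1 + bitlength w + bitlength (\<bar>b\<bar> + ?s)" by (rule bitlength_abs_add)
  also have "\<dots> \<le> 1 + bitlength w + (1 + bitlength b + bitlength ?s)"
    by (intro add_left_mono bitlength_abs_add)
  also have "\<dots> \<le> 1 + bitlength w + (1 + bitlength b + (bitlength W + esize ls))"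
    by (intro add_left_mono Cons.IH)
  also have "\<dots> \<le> bitlength W + esize (p # ls)" by (simp add: p)
  finally show ?case .
qed

lemma ptime_shelf_pack:
  fixes L :: "'a :: codable \<Rightarrow> 'k :: codable box list"
  assumes W: "ptime D W" and L: "ptime D L" shows "ptime D (\<lambda>x. shelf_pack (W x) (L x))"
proof -
  let ?M = "\<lambda>x. esize (W x) + esize (L x)"
  let ?B = "\<lambda>x. 3 + 3 * (1 + ?M x) + (1 + esize (L x) * (1 + (4 + esize (L x) + 2 * (1 + ?M x))))"
  have "ptime D (\<lambda>x. fold (nfdh_step (W x)) (sort_desc (L x)) (W x, 0, 0, []))"
  proof (rule ptime_fold[OF ptime_sort_desc[OF L] ptime_pair[OF W ptime_const]])
    show "poly_bounded D ?B"
      by (intro poly_bounded_add poly_bounded_mult poly_bounded_const ptime_poly_bounded W L)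
    show "ptime {y. fst y \<in> D \<and> (\<exists>ys zs. sort_desc (L (fst y)) = ys @ fst (snd y) # zs \<and>
        snd (snd y) = fold (nfdh_step (W (fst y))) ys (W (fst y), 0, 0, []))}
        (\<lambda>y. nfdh_step (W (fst y)) (fst (snd y)) (snd (snd y)))"
      unfolding nfdh_step_def by (intro ptime_intros ptime_map_prod_comp W)
    fix x ys zs assume ys: "sort_desc (L x) = ys @ zs"
    let ?s = "fold (nfdh_step (W x)) ys (W x, 0, 0, [])"
    let ?m = "\<bar>W x\<bar> + (\<Sum>(i, w, b) \<leftarrow> ys. \<bar>w\<bar> + \<bar>b\<bar>)"
    have size: "esize ys \<le> esize (L x)"
      using esize_take[of "length ys" "sort_desc (L x)"] esize_mset_eq[OF mset_sort_desc[of "L x"]] ys by simp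
    have "bitlength ?m \<le> ?M x"
      using bitlength_extent[of "W x" ys] size by simp
    then have bl: "esize a \<le> 1 + ?M x" if "\<bar>a\<bar> \<le> ?m" for a :: int
      using bitlength_mono[OF that] by simp
    have inv: "nfdh_inv ?m (set ys) ?s"
      using nfdh_inv_fold[where M = "\<bar>W x\<bar>" and B = "{}" and s = "(W x, 0, 0, [])" and W = "W x" and ls = ys] by (simp add: nfdh_inv_def)
    obtain x' y' h' acc where s: "?s = (x', y', h', acc)" by (metis surj_pair)
    have acc: "acc = rev (nfdh (W x) (W x) 0 0 ys)"
      using fold_nfdh_step[of "W x" ys "W x" 0 0 "[]"] by (simp add: s)
    have len: "length acc = length ys"
      using arg_cong[OF map_box_of_nfdh[of "W x" "W x" 0 0 ys], of length] by (simp add: acc)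
    have "esize acc \<le> 1 + length acc * (1 + (4 + esize (L x) + 2 * (1 + ?M x)))"
    proof (rule esize_list_le)
      fix q assume q: "q \<in> set acc"
      obtain i u v w b where qq: "q = (i, u, v, w, b)" by (metis surj_pair)
      have "(i, w, b) \<in> set ys" "\<bar>u\<bar> \<le> ?m" "\<bar>v\<bar> \<le> ?m"
        using inv q by (simp_all add: nfdh_inv_def s) (metis fst_conv snd_conv qq)+
      then have "esize (i, w, b) \<le> esize (L x)" "esize u \<le> 1 + ?M x" "esize v \<le> 1 + ?M x"
        using esize_member[of "(i, w, b)" ys] size bl by auto
      then show "esize q \<le> 4 + esize (L x) + 2 * (1 + ?M x)" by (simp add: qq)
    qed
    also have "\<dots> \<le> 1 + esize (L x) * (1 + (4 + esize (L x) + 2 * (1 + ?M x)))"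
      using len length_le_esize[of ys] size by (intro add_left_mono mult_right_mono) auto
    finally have a: "esize acc \<le> 1 + esize (L x) * (1 + (4 + esize (L x) + 2 * (1 + ?M x)))" .
    have "\<bar>x'\<bar> + \<bar>y'\<bar> + \<bar>h'\<bar> \<le> ?m" using inv by (simp add: nfdh_inv_def s)
    then have "esize x' \<le> 1 + ?M x" "esize y' \<le> 1 + ?M x" "esize h' \<le> 1 + ?M x"
      by (intro bl; linarith)+
    moreover have "esize ?s = 3 + (esize x' + esize y' + esize h') + esize acc" unfolding s by simp
    moreover have "e \<le> 3 + 3 * m + k" if "a \<le> m" "b \<le> m" "c \<le> m" "e = 3 + (a + b + c) + d" "d \<le> k"
      for a b c d e m k :: nat using that by simp
    ultimately show "esize ?s \<le> ?B x" using a by blast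
  qed
  then have "ptime D (\<lambda>x. rev (snd (snd (snd (fold (nfdh_step (W x)) (sort_desc (L x)) (W x, 0, 0, []))))))"
    by (intro ptime_rev ptime_snd)
  then show ?thesis by (simp add: fold_nfdh_step shelf_pack_def)
qed

lemma ptime_map_of:
  fixes K :: "'a :: codable \<Rightarrow> nat"
  assumes L: "ptime D L" and K: "ptime D K" shows "ptime D (\<lambda>x. map_of (L x) (K x))"
proof (rule ptime_cong)
  show "ptime D (\<lambda>x. case filter (\<lambda>q. fst q = K x) (L x) of [] \<Rightarrow> None | q # _ \<Rightarrow> Some (snd q))"
    by (intro ptime_intros ptime_list_intros ptime_map_prod_comp L K)
  have "(case filter (\<lambda>q. fst q = k) xs of [] \<Rightarrow> None | q # _ \<Rightarrow> Some (snd q)) = map_of xs k"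
    for xs :: "(nat \<times> 'b) list" and k
    by (induction xs) auto
  then show "(case filter (\<lambda>q. fst q = K x) (L x) of [] \<Rightarrow> None | q # _ \<Rightarrow> Some (snd q)) = map_of (L x) (K x)" for x
    by simp
qed

lemma ptime_boxes_in: "ptime UNIV (\<lambda>p. boxes_in (fst p) (fst (snd p)) (snd (snd p)))"
  unfolding boxes_in_def boxes_def by (intro ptime_oriented ptime_intros ptime_list_intros)

lemma ptime_positions: "ptime UNIV (\<lambda>p. positions (fst p) (fst (snd p)) (snd (snd p)))"
  unfolding positions_def container_positions_def
  by (intro ptime_shelf_pack ptime_app3[where f = boxes_in, OF ptime_boxes_in] ptime_intros ptime_list_intros)

lemma ptime_encode_choice:
  "ptime UNIV (\<lambda>p. encode_choice (fst p) (fst (snd p)) (fst (snd (snd p))) (snd (snd (snd p))))"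
  unfolding encode_choice_def
  by (intro ptime_app3[where f = positions, OF ptime_positions] ptime_map_of ptime_intros ptime_list_intros)

section \<open>The approximation scheme\<close>

definition algorithm :: "nat \<Rightarrow> nat \<Rightarrow> bool \<Rightarrow> raw_instance \<Rightarrow> val list" where
  "algorithm r d rotation x = (
     let Q = common_den x;
         its = map (int_item Q) (fst x);
         cs = map (int_container Q) (fst (snd x));
         e = fst (quotient_of (fst (snd (snd x))));
         f = snd (quotient_of (fst (snd (snd x))))
     in encode_choice Q its cs
          (solve r (knapsack_items (rots rotation) e f cs its) (capacities d Q e f cs)))"

lemma algorithm_raw_instance:
  "algorithm r d rotation (raw_instance I) =
     encode_choice (den_of I) (items_of I) (containers_of I) (solve r (kitems rotation I) (kcaps d I))"
  by (simp add: algorithm_def kitems_def kcaps_def items_of_def containers_of_def eps_num_def eps_den_def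
      den_of_def raw_instance_def Let_def)

lemma ptime_algorithm:
  "ptime {raw_instance I | I. valid_instance d k I} (algorithm r d rotation)"
proof -
  let ?D = "{raw_instance I | I. valid_instance d k I}"
  let ?Q = "\<lambda>x :: raw_instance. common_den x"
  let ?its = "\<lambda>x :: raw_instance. map (int_item (?Q x)) (fst x)"
  let ?cs = "\<lambda>x :: raw_instance. map (int_container (?Q x)) (fst (snd x))"
  let ?e = "\<lambda>x :: raw_instance. fst (quotient_of (fst (snd (snd x))))"
  let ?f = "\<lambda>x :: raw_instance. snd (quotient_of (fst (snd (snd x))))"
  let ?k = "\<lambda>x. knapsack_items (rots rotation) (?e x) (?f x) (?cs x) (?its x)"
  let ?c = "\<lambda>x. capacities d (?Q x) (?e x) (?f x) (?cs x)"
  have Q: "ptime ?D ?Q" by (intro ptime_common_den ptime_intros)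
  have its: "ptime ?D ?its"
    by (intro ptime_app2[where f = int_item, OF ptime_int_item] ptime_common_den ptime_intros ptime_list_intros)
  have cs: "ptime ?D ?cs"
    by (intro ptime_int_container ptime_common_den ptime_intros ptime_list_intros)
  have e: "ptime ?D ?e" and f: "ptime ?D ?f" by (intro ptime_intros)+
  have k: "ptime ?D ?k"
    by (intro ptime_app4[where f = "knapsack_items (rots rotation)", OF ptime_knapsack_items] e f cs its)
  have c: "ptime ?D ?c"
    by (intro ptime_app4[where f = "capacities d", OF ptime_capacities] Q e f cs)
  \<comment> \<open>The constant number of containers enters here: the knapsack problem has at most
    \<open>k + d\<close> dimensions.\<close>
  have dom: "(?k x, ?c x) \<in> {p. wf_items (length (snd p)) (fst p) \<and> length (snd p) \<le> k + d}" if "x \<in> ?D" for x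
  proof -
    from that obtain I where x: "x = raw_instance I" and valid: "valid_instance d k I" by blast
    have "?k x = kitems rotation I" "?c x = kcaps d I"
      by (simp_all add: x kitems_def kcaps_def items_of_def containers_of_def eps_num_def eps_den_def
          den_of_def raw_instance_def)
    then show ?thesis
      using wf_kitems[OF valid] lengths(4)[OF valid] valid by (simp add: valid_instance_def)
  qed
  have "ptime ?D (\<lambda>x. solve r (fst (?k x, ?c x)) (snd (?k x, ?c x)))"
    by (rule ptime_comp[OF ptime_solve ptime_pair[OF k c] dom])
  then have s: "ptime ?D (\<lambda>x. solve r (?k x) (?c x))" by simp
  have "ptime ?D (\<lambda>x. encode_choice (?Q x) (?its x) (?cs x) (solve r (?k x) (?c x)))"
    by (intro ptime_app4[where f = encode_choice, OF ptime_encode_choice] Q its cs s)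
  then show ?thesis unfolding algorithm_def[abs_def] Let_def .
qed

text \<open>A run starts by calling function 0, so the main expression is put there and all
  functions of \<open>P\<close> move up by one.\<close>

lemma ptime_runs:
  assumes "ptime D F"
  obtains P q where "\<And>x. x \<in> D \<Longrightarrow> \<exists>t. runs P (enc x) (enc (F x)) t \<and> t \<le> poly q (esize x)"
proof -
  from assms obtain P e where "computes P e D F" unfolding ptime_def by blast
  then obtain T where T: "poly_bounded D T" "\<And>x. x \<in> D \<Longrightarrow> \<exists>t \<le> T x. evals_to P [enc x] e (enc (F x)) t"
    by (elim computesE) (rule that, assumption+)
  have "poly_bounded D (\<lambda>x. T x + 2)" by (intro poly_bounded_add poly_bounded_const T)
  then obtain q where q: "\<And>x. x \<in> D \<Longrightarrow> T x + 2 \<le> poly q (esize x)" unfolding poly_bounded_def by blast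
  let ?e = "reloc 1 e"
  let ?P = "[?e] @ map (reloc 1) P @ []"
  show ?thesis
  proof
    fix x assume x: "x \<in> D"
    then obtain t where t: "t \<le> T x" "evals_to P [enc x] e (enc (F x)) t" using T(2) by blast
    have "evals_to ?P [enc x] ?e (enc (F x)) t"
      using evals_to_reloc[OF t(2), of "[?e]" "[]"] by simp
    then have "runs ?P (enc x) (enc (F x)) (1 + t + 1)"
      unfolding runs_def by (intro evals_to_call[OF evals_to_var0]) simp_all
    then show "\<exists>t. runs ?P (enc x) (enc (F x)) t \<and> t \<le> poly q (esize x)"
      using q[OF x] t(1) by (intro exI[of _ "1 + t + 1"]) simp
  qed
qed

lemma container_packing_PTAS: "admits_PTAS (container_packing rotation d k)"
  unfolding admits_PTAS_def
proof (intro allI impI)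
  fix \<epsilon> :: real assume \<epsilon>: "0 < \<epsilon>"
  \<comment> \<open>The loss is at most \<open>(k + d) / r\<close> of the optimum, so
    \<open>r\<close> has to be at least \<open>(k + d) / \<epsilon>\<close>, and at least 1 for
    \<open>solve_approximates\<close>.\<close>
  obtain n :: nat where n: "real (k + d) / \<epsilon> < real n" using reals_Archimedean2 by blast
  define r where "r = max 1 n"
  have r: "1 \<le> r" and kd: "real (k + d) \<le> \<epsilon> * real r"
  proof -
    show "1 \<le> r" by (simp add: r_def)
    have "real (k + d) / \<epsilon> \<le> real r" using n by (simp add: r_def)
    then show "real (k + d) \<le> \<epsilon> * real r" using \<epsilon> by (simp add: pos_divide_le_eq mult.commute)
  qed
  obtain P q where P: "\<And>x. x \<in> {raw_instance I | I. valid_instance d k I} \<Longrightarrow>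
      \<exists>t. runs P (enc x) (enc (algorithm r d rotation x)) t \<and> t \<le> poly q (esize x)"
    by (rule ptime_runs[OF ptime_algorithm[of d k r rotation]]) (rule that)
  have "poly_time_approx (container_packing rotation d k) (1 - \<epsilon>) P"
    unfolding poly_time_approx_def
  proof (intro exI[of _ q] ballI)
    fix I assume "I \<in> instances (container_packing rotation d k)"
    then have valid: "valid_instance d k I" by (simp add: container_packing_def)
    let ?Q = "real_of_int (den_of I)" and ?m = "length (kcaps d I)"
    define c where "c = solve r (kitems rotation I) (kcaps d I)"
    define S where "S = solution_of (den_of I) (items_of I) (containers_of I) c"
    have Q: "0 < ?Q" using den_pos[OF valid] by simp
    have fit: "fitting (kitems rotation I) (kcaps d I) c"
      unfolding c_def by (rule solve_fitting[OF wf_kitems[OF valid] kcaps_nonneg[OF valid]])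
    note S' = choice_to_packing[OF valid fit, folded S_def]
    obtain O' where O': "feasible_packing rotation d I O'"
      "total_profit I O' = opt (container_packing rotation d k) I"
      using opt_container_packing_attained[OF valid] by blast
    obtain c' where c': "fitting (kitems rotation I) (kcaps d I) c'"
      "real_of_int (gain (kitems rotation I) c') = total_profit I O' * ?Q"
      using packing_to_choice[OF valid O'(1)] by blast
    have m: "?m \<le> k + d" using lengths(4)[OF valid] valid by (simp add: valid_instance_def)
    have nonneg: "0 \<le> total_profit I O'"
      unfolding total_profit_def
    proof (rule sum_nonneg)
      fix i assume "i \<in> packed O'"
      then have "i < length (items I)" using O'(1) by (auto simp: packed_def feasible_packing_def)
      then have "0 \<le> profit (items I ! i)" using valid by (simp add: valid_instance_def)
      then show "0 \<le> real_of_rat (profit (items I ! i))" by simp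
    qed
    have "(int r - int ?m) * gain (kitems rotation I) c' \<le> int r * gain (kitems rotation I) c"
      unfolding c_def by (rule solve_approximates[OF wf_kitems[OF valid] kcaps_nonneg[OF valid] r c'(1)])
    then have "real_of_int ((int r - int ?m) * gain (kitems rotation I) c') \<le>
        real_of_int (int r * gain (kitems rotation I) c)"
      by (simp only: of_int_le_iff)
    then have "(real r - real ?m) * total_profit I O' * ?Q \<le> real r * total_profit I S * ?Q"
      by (simp add: S'(2) c'(2) mult.assoc)
    then have "(real r - real ?m) * total_profit I O' \<le> real r * total_profit I S"
      using Q by (simp only: mult_le_cancel_right_pos)
    moreover have "(real r - \<epsilon> * real r) * total_profit I O' \<le> (real r - real ?m) * total_profit I O'"
      using nonneg kd m by (intro mult_right_mono) auto
    ultimately have "real r * ((1 - \<epsilon>) * total_profit I O') \<le> real r * total_profit I S"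
      by (simp add: algebra_simps)
    then have profit: "(1 - \<epsilon>) * total_profit I O' \<le> total_profit I S"
      using r by simp
    have enc: "encode (container_packing rotation d k) I = enc (raw_instance I)"
      by (simp add: container_packing_def enc_raw_instance)
    obtain t where t: "runs P (enc (raw_instance I)) (enc (algorithm r d rotation (raw_instance I))) t"
      "t \<le> poly q (esize (raw_instance I))"
      using P[of "raw_instance I"] valid by blast
    have "repr_solution (enc (algorithm r d rotation (raw_instance I))) S"
      unfolding algorithm_raw_instance S_def c_def by (rule repr_encode_choice) (use Q in simp)
    with t S'(1) profit O'(2) show "\<exists>y t. runs P (encode (container_packing rotation d k) I) y t \<and>
        t \<le> poly q (val_size (encode (container_packing rotation d k) I)) \<and>
        (\<exists>S. represents (container_packing rotation d k) y S \<and>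
          feasible (container_packing rotation d k) I S \<and>
          (1 - \<epsilon>) * opt (container_packing rotation d k) I \<le> objective (container_packing rotation d k) I S)"
      unfolding enc
      by (intro exI[of _ "enc (algorithm r d rotation (raw_instance I))"] exI[of _ t] exI[of _ S] conjI)
        (simp_all add: container_packing_def)
  qed
  then show "\<exists>P. poly_time_approx (container_packing rotation d k) (1 - \<epsilon>) P" by blast
qed

theorem theorem12:
  fixes d k :: nat
  shows "admits_PTAS (container_packing False d k) \<and> admits_PTAS (container_packing True d k)"
  using container_packing_PTAS by blast

end
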